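(* $(A,\ell)$-Path Packing is fixed-parameter tractable when parameterized by $\mathsf{cvd}+|A|$. That is, there is an algorithm solving it in time $f(\mathsf{cvd}(G)+|A|)\cdot |V(G)|^{O(1)}$ for some computable function $f$.
   Context: For an undirected graph $G$ and $A\subseteq V(G)$, an $A$-path is a path in $G$ that starts and ends at two distinct vertices of $A$ and whose internal vertices all lie in $V(G)\setminus A$. The problem $(A,\ell)$-Path Packing takes as input an undirected graph $G$, a set $A\subseteq V(G)$ and integers $k,\ell$. It asks whether $G$ contains $k$ pairwise vertex-disjoint $A$-paths, each of length exactly $\ell$. The cluster vertex deletion number $\mathsf{cvd}(G)$ is the minimum number of vertices whose deletion from $G$ leaves a disjoint union of cliques. *)

theory Defs
  imports
    "HOL-Library.Disjoint_Sets"
    "Graph_Theory.Pair_Digraph"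
    "Graph_Theory.Vertex_Walk"
begin

section \<open>Graph notions\<close>

text \<open>An undirected (finite, simple) graph is a \<^locale>\<open>pair_graph\<close>: a loop-free digraph with
  symmetric arc relation, where the arcs \<open>(u, v)\<close> and \<open>(v, u)\<close> together stand for the edge
  \<open>uv\<close>.\<close>

definition a_path :: "'a pair_pre_digraph \<Rightarrow> 'a set \<Rightarrow> 'a vwalk \<Rightarrow> bool" where
  "a_path G A p \<longleftrightarrow>
     vpath p (with_proj G) \<and> hd p \<in> A \<and> last p \<in> A \<and> hd p \<noteq> last p \<and>
     set (butlast (tl p)) \<subseteq> pverts G - A"

definition has_a_path_packing :: "'a pair_pre_digraph \<Rightarrow> 'a set \<Rightarrow> nat \<Rightarrow> nat \<Rightarrow> bool" where
  "has_a_path_packing G A k l \<longleftrightarrow>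
     (\<exists>P. finite P \<and> card P = k \<and>
          (\<forall>p\<in>P. a_path G A p \<and> vwalk_length p = l) \<and>
          pairwise (\<lambda>p q. set p \<inter> set q = {}) P)"

definition delete_verts :: "'a pair_pre_digraph \<Rightarrow> 'a set \<Rightarrow> 'a pair_pre_digraph" where
  "delete_verts G S = \<lparr>pverts = pverts G - S,
                       parcs = {(u, v) \<in> parcs G. u \<notin> S \<and> v \<notin> S}\<rparr>"

definition disjoint_union_of_cliques :: "'a pair_pre_digraph \<Rightarrow> bool" where
  "disjoint_union_of_cliques G \<longleftrightarrow>
     (\<exists>\<C>. partition_on (pverts G) \<C> \<and>
          parcs G = {(u, v). u \<noteq> v \<and> (\<exists>C\<in>\<C>. u \<in> C \<and> v \<in> C)})"

definition cvd :: "'a pair_pre_digraph \<Rightarrow> nat" where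
  "cvd G = (LEAST m. \<exists>S \<subseteq> pverts G. card S = m \<and> disjoint_union_of_cliques (delete_verts G S))"


section \<open>Machine model\<close>

text \<open>A random access machine over the natural numbers, presented as a structured while-language.
  The memory consists of unbounded arrays, of which a program can mention only finitely many; cell
  \<open>0\<close> of an array serves as a scalar variable. Every read, constant, arithmetic operation, comparison, connective, write
  and branch costs one unit. The only arithmetic is addition and truncated subtraction:
  unit-cost multiplication is deliberately absent, because with it numbers of exponential bit
  length would become available in polynomial time. With addition alone, the bit length of every
  number grows by at most a constant in each step, so the model is polynomially equivalent to Turing
  machines.\<close>

type_synonym name = string
type_synonym state = "name \<Rightarrow> nat \<Rightarrow> nat"

datatype aexp = Const nat | Read name aexp | Add aexp aexp | Sub aexp aexp

datatype bexp = LessB aexp aexp | NotB bexp | AndB bexp bexp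

datatype com =
    Skip
  | Write name aexp aexp
  | Seq com com
  | Cond bexp com com
  | While bexp com

fun aval :: "aexp \<Rightarrow> state \<Rightarrow> nat" where
  "aval (Const n) s = n"
| "aval (Read x i) s = s x (aval i s)"
| "aval (Add a b) s = aval a s + aval b s"
| "aval (Sub a b) s = aval a s - aval b s"

fun acost :: "aexp \<Rightarrow> nat" where
  "acost (Const n) = 1"
| "acost (Read x i) = 1 + acost i"
| "acost (Add a b) = 1 + acost a + acost b"
| "acost (Sub a b) = 1 + acost a + acost b"

fun bval :: "bexp \<Rightarrow> state \<Rightarrow> bool" where
  "bval (LessB a b) s \<longleftrightarrow> aval a s < aval b s"
| "bval (NotB b) s \<longleftrightarrow> \<not> bval b s"
| "bval (AndB b c) s \<longleftrightarrow> bval b s \<and> bval c s"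

fun bcost :: "bexp \<Rightarrow> nat" where
  "bcost (LessB a b) = 1 + acost a + acost b"
| "bcost (NotB b) = 1 + bcost b"
| "bcost (AndB b c) = 1 + bcost b + bcost c"

definition store :: "state \<Rightarrow> name \<Rightarrow> nat \<Rightarrow> nat \<Rightarrow> state" where
  "store s x i v = s(x := (s x)(i := v))"

text \<open>\<open>exec c s t s'\<close>: started in state \<open>s\<close>, the program \<open>c\<close> halts in state \<open>s'\<close> after
  exactly \<open>t\<close> time units.\<close>

inductive exec :: "com \<Rightarrow> state \<Rightarrow> nat \<Rightarrow> state \<Rightarrow> bool" where
  Skip: "exec Skip s 1 s"
| Write: "exec (Write x i a) s (1 + acost i + acost a) (store s x (aval i s) (aval a s))"
| Seq: "exec c s t s' \<Longrightarrow> exec d s' u s'' \<Longrightarrow> exec (Seq c d) s (t + u) s''"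
| CondTrue: "bval b s \<Longrightarrow> exec c s t s' \<Longrightarrow> exec (Cond b c d) s (1 + bcost b + t) s'"
| CondFalse: "\<not> bval b s \<Longrightarrow> exec d s t s' \<Longrightarrow> exec (Cond b c d) s (1 + bcost b + t) s'"
| WhileFalse: "\<not> bval b s \<Longrightarrow> exec (While b c) s (1 + bcost b) s"
| WhileTrue: "bval b s \<Longrightarrow> exec c s t s' \<Longrightarrow> exec (While b c) s' u s'' \<Longrightarrow>
    exec (While b c) s (1 + bcost b + t + u) s''"

inductive_cases SkipE: "exec Skip s t s'"
inductive_cases WriteE: "exec (Write x i a) s t s'"
inductive_cases SeqE: "exec (Seq c d) s t s'"
inductive_cases CondE: "exec (Cond b c d) s t s'"
inductive_cases WhileE: "exec (While b c) s t s'"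

lemma exec_deterministic:
  assumes "exec c s t s'" and "exec c s u s''"
  shows "t = u \<and> s' = s''"
  using assms
proof (induction arbitrary: u s'' rule: exec.induct)
  case Skip
  then show ?case by (auto elim: SkipE)
next
  case Write
  then show ?case by (auto elim: WriteE)
next
  case Seq
  from Seq.prems show ?case by (rule SeqE) (auto dest!: Seq.IH)
next
  case CondTrue
  from CondTrue.prems show ?case by (rule CondE) (use CondTrue.hyps in \<open>auto dest: CondTrue.IH\<close>)
next
  case CondFalse
  from CondFalse.prems show ?case by (rule CondE) (use CondFalse.hyps in \<open>auto dest: CondFalse.IH\<close>)
next
  case WhileFalse
  from WhileFalse.prems show ?case by (rule WhileE) (use WhileFalse.hyps in auto)
next
  case WhileTrue
  from WhileTrue.prems show ?case by (rule WhileE) (use WhileTrue.hyps in \<open>auto dest!: WhileTrue.IH\<close>)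
qed

definition input_state :: "nat \<Rightarrow> state" where
  "input_state n = store (\<lambda>_ _. 0) ''in'' 0 n"

definition computable :: "(nat \<Rightarrow> nat) \<Rightarrow> bool" where
  "computable f \<longleftrightarrow> (\<exists>c. \<forall>n. \<exists>t s. exec c (input_state n) t s \<and> s ''out'' 0 = f n)"

text \<open>\<open>X\<close> is the set of instances, \<open>enc\<close> their encoding as initial memory contents, \<open>sz\<close> the
  size measure, \<open>\<kappa>\<close> the parameter and \<open>yes\<close> the set of yes-instances. The \<open>max 1\<close>
  matters only for instances of size \<open>0\<close>, where the bound would otherwise degenerate to \<open>0\<close>.\<close>

definition fixed_parameter_tractable ::
  "'i set \<Rightarrow> ('i \<Rightarrow> state) \<Rightarrow> ('i \<Rightarrow> nat) \<Rightarrow> ('i \<Rightarrow> nat) \<Rightarrow> ('i \<Rightarrow> bool) \<Rightarrow> bool" where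
  "fixed_parameter_tractable X enc sz \<kappa> yes \<longleftrightarrow>
     (\<exists>c f d. computable f \<and>
        (\<forall>x\<in>X. \<exists>t s. exec c (enc x) t s \<and>
                      s ''out'' 0 = of_bool (yes x) \<and>
                      t \<le> f (\<kappa> x) * max 1 (sz x) ^ d))"


section \<open>The problem\<close>

record path_packing_instance =
  inst_graph :: "nat pair_pre_digraph"
  inst_terminals :: "nat set"
  inst_number :: nat
  inst_length :: nat

abbreviation inst_order :: "path_packing_instance \<Rightarrow> nat" where
  "inst_order I \<equiv> card (pverts (inst_graph I))"

text \<open>As usual for inputs of algorithms, the vertices are numbered \<open>0, \<dots>, n - 1\<close>.\<close>

definition path_packing_instances :: "path_packing_instance set" where
  "path_packing_instances =
     {I. pair_graph (inst_graph I) \<and>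
         pverts (inst_graph I) = {..<inst_order I} \<and>
         inst_terminals I \<subseteq> pverts (inst_graph I)}"

text \<open>The graph is given by its order \<open>n\<close> and its adjacency matrix, stored row by row: the entry
  for \<open>(u, v)\<close> is cell \<open>u * n + v\<close>.\<close>

definition encode_instance :: "path_packing_instance \<Rightarrow> state" where
  "encode_instance I x i =
     (if x = ''n'' \<and> i = 0 then inst_order I
      else if x = ''k'' \<and> i = 0 then inst_number I
      else if x = ''l'' \<and> i = 0 then inst_length I
      else if x = ''A'' then of_bool (i \<in> inst_terminals I)
      else if x = ''adj'' then
        of_bool (\<exists>(u, v) \<in> parcs (inst_graph I). i = u * inst_order I + v)
      else 0)"

definition path_packing_yes :: "path_packing_instance \<Rightarrow> bool" where
  "path_packing_yes I \<longleftrightarrow>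
     has_a_path_packing (inst_graph I) (inst_terminals I) (inst_number I) (inst_length I)"

end

theory Submission
  imports Defs
begin

text \<open>Let \<open>M\<close> consist of the terminals and of greedily chosen disjoint induced paths on three
  vertices. Every cluster deletion set meets each of these, so \<open>|M| \<le> |A| + 3 cvd\<close>, and outside
  \<open>M\<close> the graph is a disjoint union of cliques. Deleting from an \<open>A\<close>-path every vertex that, with
  both its neighbours on the path, lies outside \<open>M\<close> leaves a reduced path; all reduced paths together
  have at most \<open>L = 3 |M|\<close> vertices. Conversely a reduced path can be lengthened by inserting clique
  vertices between two consecutive vertices outside \<open>M\<close>. So a packing exists iff there are disjoint
  reduced paths and disjoint sets of fillers of the right sizes, and the latter is decided by Hall's
  condition over all sets of paths.

  The reduced paths are guessed from boundedly many candidates. A vertex outside \<open>M\<close> is described by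
  a group (one for each clique in use), by its neighbours in \<open>M\<close> on the path, and by its rank
  among the vertices of the clique that have these neighbours; a rank below \<open>L\<close> always suffices, since
  some vertex of small rank is not in use. The groups are then assigned to cliques greedily, each
  group taking the largest clique in which its description can be realized. If the groups are
  numbered by decreasing clique size in some solution, every group receives a clique at least as large
  as in that solution, which can only help Hall's condition.\<close>

section \<open>A language with bounded sums and loops\<close>

text \<open>The parameter is never computed: \<open>cvd\<close> occurs only in the analysis of
  \<open>M\<close>, and all loop bounds are functions of \<open>n\<close> and \<open>card M\<close>.
  A fixed program whose loop bounds are at most \<open>Z\<close> takes \<open>Z ^ d\<close> steps
  with \<open>d\<close> read off its syntax; with \<open>Z\<close> the product of
  \<open>max 1 n\<close> and a function of the parameter this is the required form. So the whole
  search has to be a fixed nest of loops with bounds known in advance. In particular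
  \<open>k\<close> and \<open>l\<close>, which may be arbitrarily large, never bound a loop:
  \<open>l\<close> only enters additions, subtractions and comparisons, and \<open>k\<close> is
  compared with \<open>L\<close>, since each of the \<open>k\<close> disjoint reduced paths takes at
  least two of at most \<open>L\<close> vertices. The guess becomes one number \<open>w < W\<close>,
  read in base \<open>L + 1\<close>. Products are written as bounded sums, the machine having no
  multiplication. A wrong guess may leave arbitrary array contents. Soundness is unaffected, as the
  resulting paths and Hall's condition are checked in full; only completeness depends on the guess
  and the greedy assignment.\<close>

datatype ex = K nat | Rd name ex | Plus ex ex | Minus ex ex | Lt ex ex | Ite ex ex ex | Sum name name ex

datatype prog = Asg name ex ex | Sq prog prog | When ex prog | For name name prog

fun eval :: "ex \<Rightarrow> state \<Rightarrow> nat" where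
  "eval (K c) s = c"
| "eval (Rd x e) s = s x (eval e s)"
| "eval (Plus a b) s = eval a s + eval b s"
| "eval (Minus a b) s = eval a s - eval b s"
| "eval (Lt a b) s = of_bool (eval a s < eval b s)"
| "eval (Ite c a b) s = (if eval c s > 0 then eval a s else eval b s)"
| "eval (Sum x N e) s = (\<Sum>j<s N 0. eval e (store s x 0 j))"

fun den :: "prog \<Rightarrow> state \<Rightarrow> state" where
  "den (Asg x i e) s = store s x (eval i s) (eval e s)"
| "den (Sq p q) s = den q (den p s)"
| "den (When e p) s = (if eval e s > 0 then den p s else s)"
| "den (For x N p) s = fold (\<lambda>j s. den p (store s x 0 j)) [0..<s N 0] s"

abbreviation scratch :: name where "scratch \<equiv> ''#''"

text \<open>The cells \<open>N 0\<close> for \<open>N \<in> R\<close> bound the loops; since they are never written, all loop bounds are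
  known in advance.\<close>
fun wf_ex :: "name set \<Rightarrow> ex \<Rightarrow> bool" where
  "wf_ex R (K c) \<longleftrightarrow> True"
| "wf_ex R (Rd x e) \<longleftrightarrow> x \<noteq> scratch \<and> wf_ex R e"
| "wf_ex R (Plus a b) \<longleftrightarrow> wf_ex R a \<and> wf_ex R b"
| "wf_ex R (Minus a b) \<longleftrightarrow> wf_ex R a \<and> wf_ex R b"
| "wf_ex R (Lt a b) \<longleftrightarrow> wf_ex R a \<and> wf_ex R b"
| "wf_ex R (Ite c a b) \<longleftrightarrow> wf_ex R c \<and> wf_ex R a \<and> wf_ex R b"
| "wf_ex R (Sum x N e) \<longleftrightarrow> x \<noteq> scratch \<and> x \<notin> R \<and> N \<in> R \<and> wf_ex R e"

fun wf_prog :: "name set \<Rightarrow> prog \<Rightarrow> bool" where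
  "wf_prog R (Asg x i e) \<longleftrightarrow> x \<noteq> scratch \<and> x \<notin> R \<and> wf_ex R i \<and> wf_ex R e"
| "wf_prog R (Sq p q) \<longleftrightarrow> wf_prog R p \<and> wf_prog R q"
| "wf_prog R (When e p) \<longleftrightarrow> wf_ex R e \<and> wf_prog R p"
| "wf_prog R (For x N p) \<longleftrightarrow> x \<noteq> scratch \<and> x \<notin> R \<and> N \<in> R \<and> wf_prog R p"

section \<open>Compilation of the language to the machine\<close>

abbreviation reg :: "nat \<Rightarrow> aexp" where "reg d \<equiv> Read scratch (Const d)"

text \<open>The value is left in register \<open>d\<close>; registers from \<open>d\<close> on are overwritten, and nothing else
  changes: a sum uses its own variable as loop counter and restores it at the end.\<close>
fun cmp_ex :: "nat \<Rightarrow> ex \<Rightarrow> com" where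
  "cmp_ex d (K c) = Write scratch (Const d) (Const c)"
| "cmp_ex d (Rd x e) = Seq (cmp_ex d e) (Write scratch (Const d) (Read x (reg d)))"
| "cmp_ex d (Plus a b) = Seq (cmp_ex d a) (Seq (cmp_ex (Suc d) b)
     (Write scratch (Const d) (Add (reg d) (reg (Suc d)))))"
| "cmp_ex d (Minus a b) = Seq (cmp_ex d a) (Seq (cmp_ex (Suc d) b)
     (Write scratch (Const d) (aexp.Sub (reg d) (reg (Suc d)))))"
| "cmp_ex d (Lt a b) = Seq (cmp_ex d a) (Seq (cmp_ex (Suc d) b)
     (Cond (LessB (reg d) (reg (Suc d))) (Write scratch (Const d) (Const 1))
        (Write scratch (Const d) (Const 0))))"
| "cmp_ex d (Ite c a b) = Seq (cmp_ex d c) (Cond (LessB (Const 0) (reg d)) (cmp_ex d a) (cmp_ex d b))"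
| "cmp_ex d (Sum x N e) =
     Seq (Write scratch (Const d) (Const 0))
    (Seq (Write scratch (Const (Suc d)) (Read x (Const 0)))
    (Seq (Write x (Const 0) (Const 0))
    (Seq (While (LessB (Read x (Const 0)) (Read N (Const 0)))
           (Seq (cmp_ex (Suc (Suc d)) e)
           (Seq (Write scratch (Const d) (Add (reg d) (reg (Suc (Suc d)))))
                (Write x (Const 0) (Add (Read x (Const 0)) (Const 1))))))
         (Write x (Const 0) (reg (Suc d))))))"

text \<open>The loop counter lives in register \<open>d\<close>, because the body may overwrite the
  loop variable \<open>x\<close>; the body works with registers from \<open>d + 1\<close> on and so
  leaves the counter alone. In accordance with \<open>den\<close>, \<open>x\<close> is not restored
  afterwards.\<close>

fun cmp_prog :: "nat \<Rightarrow> prog \<Rightarrow> com" where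
  "cmp_prog d (Asg x i e) = Seq (cmp_ex d i) (Seq (cmp_ex (Suc d) e) (Write x (reg d) (reg (Suc d))))"
| "cmp_prog d (Sq p q) = Seq (cmp_prog d p) (cmp_prog d q)"
| "cmp_prog d (When e p) = Seq (cmp_ex d e) (Cond (LessB (Const 0) (reg d)) (cmp_prog d p) Skip)"
| "cmp_prog d (For x N p) =
     Seq (Write scratch (Const d) (Const 0))
         (While (LessB (reg d) (Read N (Const 0)))
           (Seq (Write x (Const 0) (reg d))
           (Seq (cmp_prog (Suc d) p)
                (Write scratch (Const d) (Add (reg d) (Const 1))))))"

text \<open>Exponents of \<open>Z\<close> in the running time of compiled code. They add where costs
  add, since a sum of powers of \<open>Z\<close> is below the power with the summed exponents plus
  one; a loop multiplies by at most \<open>Z\<close> and pays for its overhead with the rest of the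
  increment.\<close>

fun ecost :: "ex \<Rightarrow> nat" where
  "ecost (K c) = 1"
| "ecost (Rd x e) = ecost e + 1"
| "ecost (Plus a b) = ecost a + ecost b + 1"
| "ecost (Minus a b) = ecost a + ecost b + 1"
| "ecost (Lt a b) = ecost a + ecost b + 1"
| "ecost (Ite c a b) = ecost c + ecost a + ecost b + 1"
| "ecost (Sum x N e) = ecost e + 3"

fun pcost :: "prog \<Rightarrow> nat" where
  "pcost (Asg x i e) = ecost i + ecost e + 1"
| "pcost (Sq p q) = pcost p + pcost q + 1"
| "pcost (When e p) = ecost e + pcost p + 1"
| "pcost (For x N p) = pcost p + 3"

text \<open>The registers of compiled code live in \<open>scratch\<close>, of which the source
  semantics knows nothing; states can be compared only outside it.\<close>

definition agree :: "state \<Rightarrow> state \<Rightarrow> bool" (infix \<open>\<simeq>\<close> 50) where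
  "s \<simeq> s' \<longleftrightarrow> (\<forall>x. x \<noteq> scratch \<longrightarrow> s x = s' x)"

text \<open>Registers below \<open>d\<close> hold intermediate results of the enclosing code, which
  must survive.\<close>

definition preserves :: "nat \<Rightarrow> state \<Rightarrow> state \<Rightarrow> bool" where
  "preserves d s s' \<longleftrightarrow> (\<forall>j<d. s' scratch j = s scratch j)"

lemma agree_refl [simp]: "s \<simeq> s"
  by (simp add: agree_def)

lemma agree_trans [trans]: "s \<simeq> s' \<Longrightarrow> s' \<simeq> s'' \<Longrightarrow> s \<simeq> s''"
  by (simp add: agree_def)

lemma agree_store: "s \<simeq> s' \<Longrightarrow> store s x i v \<simeq> store s' x i v"
  by (simp add: agree_def store_def)

lemma agree_scratch [simp]: "store s scratch i v \<simeq> s' \<longleftrightarrow> s \<simeq> s'"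
  by (simp add: agree_def store_def)

lemma store_apply: "store s x i v y = (if x = y then (s y)(i := v) else s y)"
  by (simp add: store_def)

lemma eval_cong: "wf_ex R e \<Longrightarrow> s \<simeq> s' \<Longrightarrow> scratch \<notin> R \<Longrightarrow> eval e s = eval e s'"
proof (induction e arbitrary: s s')
  case (Rd x e)
  then show ?case by (simp add: agree_def) (metis)
next
  case (Sum x N e)
  have "N \<noteq> scratch" using Sum.prems by auto
  then have "s N 0 = s' N 0" using Sum.prems by (simp add: agree_def)
  moreover have "eval e (store s x 0 j) = eval e (store s' x 0 j)" for j
    using Sum.prems by (intro Sum.IH) (auto intro: agree_store)
  ultimately show ?case by simp
next
  case (Plus a b) from this(1,2)[of s s'] this(3-) show ?case by simp
next
  case (Minus a b) from this(1,2)[of s s'] this(3-) show ?case by simp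
next
  case (Lt a b) from this(1,2)[of s s'] this(3-) show ?case by simp
next
  case (Ite c a b) from this(1,2,3)[of s s'] this(4-) show ?case by simp
qed simp

text \<open>The exponents never have to be computed: every construct costs at most one factor
  \<open>Z\<close> more than its parts.\<close>

definition run :: "com \<Rightarrow> state \<Rightarrow> nat \<Rightarrow> (state \<Rightarrow> bool) \<Rightarrow> bool" where
  "run c s T Q \<longleftrightarrow> (\<exists>t s'. exec c s t s' \<and> t \<le> T \<and> Q s')"

lemma run_mono: "run c s T Q \<Longrightarrow> T \<le> T' \<Longrightarrow> (\<And>s'. Q s' \<Longrightarrow> Q' s') \<Longrightarrow> run c s T' Q'"
  unfolding run_def by (meson le_trans)

lemma run_Write: "Q (store s x (aval i s) (aval a s)) \<Longrightarrow> 1 + acost i + acost a \<le> T \<Longrightarrow> run (Write x i a) s T Q"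
  unfolding run_def using exec.Write by blast

lemma run_Skip: "Q s \<Longrightarrow> 1 \<le> T \<Longrightarrow> run Skip s T Q"
  unfolding run_def using exec.Skip by blast

lemma run_Seq: "run c s T P \<Longrightarrow> (\<And>s'. P s' \<Longrightarrow> run d s' U Q) \<Longrightarrow> T + U \<le> V \<Longrightarrow> run (Seq c d) s V Q"
  unfolding run_def by (meson add_mono exec.Seq le_trans)

lemma run_Cond:
  assumes "bval b s \<Longrightarrow> run c s T Q" "\<not> bval b s \<Longrightarrow> run d s T Q" "1 + bcost b + T \<le> V"
  shows "run (Cond b c d) s V Q"
proof (cases "bval b s")
  case True
  then obtain t s' where "exec c s t s'" "t \<le> T" "Q s'" using assms(1) by (auto simp: run_def)
  then show ?thesis unfolding run_def
    using exec.CondTrue[OF True] assms(3) by (intro exI[of _ "1 + bcost b + t"] exI[of _ s']) auto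
next
  case False
  then obtain t s' where "exec d s t s'" "t \<le> T" "Q s'" using assms(2) by (auto simp: run_def)
  then show ?thesis unfolding run_def
    using exec.CondFalse[OF False] assms(3) by (intro exI[of _ "1 + bcost b + t"] exI[of _ s']) auto
qed

lemma run_While:
  assumes "I 0 s"
    and "\<And>j s. j < n \<Longrightarrow> I j s \<Longrightarrow> bval b s \<and> run c s T (I (Suc j))"
    and "\<And>s. I n s \<Longrightarrow> \<not> bval b s"
    and "n * (1 + bcost b + T) + 1 + bcost b \<le> V"
  shows "run (While b c) s V (I n)"
proof -
  have "run (While b c) s ((n - j) * (1 + bcost b + T) + 1 + bcost b) (I n)" if "I j s" "j \<le> n" for j s
    using that
  proof (induction "n - j" arbitrary: j s)
    case 0
    then have "j = n" by simp
    with 0 assms(3) have "exec (While b c) s (1 + bcost b) s" by (intro exec.WhileFalse) simp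
    with 0 \<open>j = n\<close> show ?case unfolding run_def by auto
  next
    case (Suc m)
    then have j: "j < n" by simp
    from assms(2)[OF j Suc.prems(1)] obtain t s' where
      b: "bval b s" and c: "exec c s t s'" "t \<le> T" "I (Suc j) s'" by (auto simp: run_def)
    have "run (While b c) s' ((n - Suc j) * (1 + bcost b + T) + 1 + bcost b) (I n)"
      using Suc.hyps(2) j c by (intro Suc.hyps(1)) auto
    then obtain u s'' where
      w: "exec (While b c) s' u s''" "u \<le> (n - Suc j) * (1 + bcost b + T) + 1 + bcost b" "I n s''"
      unfolding run_def by blast
    have "(n - j) = Suc (n - Suc j)" using j by simp
    then have "1 + bcost b + t + u \<le> (n - j) * (1 + bcost b + T) + 1 + bcost b"
      using c w by simp
    then show ?case unfolding run_def using exec.WhileTrue[OF b c(1) w(1)] w(3) by blast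
  qed
  from this[OF assms(1)] assms(4) show ?thesis by (auto intro: run_mono)
qed

text \<open>Origin of the threshold 32: three powers and the instruction overhead 20 amount to at
  most 23 copies of \<open>Z ^ (a + b + c)\<close>, which one more factor \<open>Z\<close>
  absorbs.\<close>

lemma pow_add_le:
  fixes Z :: nat
  assumes "32 \<le> Z"
  shows "Z ^ a + Z ^ b + Z ^ c + 20 \<le> Z ^ (a + b + c + 1)"
proof -
  have "Z ^ a \<le> Z ^ (a+b+c)" "Z ^ b \<le> Z ^ (a+b+c)" "Z ^ c \<le> Z ^ (a+b+c)" "1 \<le> Z ^ (a+b+c)"
    using assms by (auto intro: power_increasing)
  then have "Z ^ a + Z ^ b + Z ^ c + 20 \<le> 32 * Z ^ (a + b + c)" by linarith
  also have "\<dots> \<le> Z * Z ^ (a + b + c)" using assms by simp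
  finally show ?thesis by simp
qed

lemma pow_loop_le:
  fixes Z :: nat
  assumes "32 \<le> Z" "n \<le> Z"
  shows "n * (Z ^ a + 20) + 30 \<le> Z ^ (a + 2)"
proof -
  have 1: "1 \<le> Z ^ a" using assms by auto
  have "n * (Z ^ a + 20) + 30 \<le> Z * (Z ^ a + 20) + Z" using assms by (intro add_mono mult_mono) auto
  also have "\<dots> = Z * (Z ^ a + 21)" by algebra
  also have "\<dots> \<le> Z * (32 * Z ^ a)" using 1 by (intro mult_left_mono) linarith+
  also have "\<dots> \<le> Z * (Z * Z ^ a)" using assms by simp
  finally show ?thesis by simp
qed

definition ex_post :: "nat \<Rightarrow> state \<Rightarrow> nat \<Rightarrow> state \<Rightarrow> bool" where
  "ex_post d s v s' \<longleftrightarrow> s' \<simeq> s \<and> preserves d s s' \<and> s' scratch d = v"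

lemma run_cmp_ex:
  assumes "wf_ex R e" "scratch \<notin> R" "\<forall>N\<in>R. s N 0 \<le> Z" "32 \<le> Z"
  shows "run (cmp_ex d e) s (Z ^ ecost e) (ex_post d s (eval e s))"
  using assms(1,3)
proof (induction e arbitrary: d s)
  case (K c)
  then show ?case using assms(4) by (auto intro!: run_Write simp: ex_post_def preserves_def store_apply)
next
  case (Rd x e)
  have IH: "run (cmp_ex d e) s (Z ^ ecost e) (ex_post d s (eval e s))" using Rd by simp
  show ?case unfolding cmp_ex.simps
  proof (rule run_Seq[OF IH])
    fix s' assume "ex_post d s (eval e s) s'"
    then show "run (Write scratch (Const d) (Read x (reg d))) s' 5 (ex_post d s (eval (Rd x e) s))"
      using Rd.prems
      by (intro run_Write) (auto simp: ex_post_def preserves_def store_apply agree_def)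
  next
    show "Z ^ ecost e + 5 \<le> Z ^ ecost (Rd x e)" using pow_add_le[OF assms(4), of "ecost e" 0 0] by simp
  qed
next
  case (Plus a b)
  have IH: "run (cmp_ex d a) s (Z ^ ecost a) (ex_post d s (eval a s))" using Plus by simp
  show ?case unfolding cmp_ex.simps
  proof (rule run_Seq[OF IH])
    fix s' assume s': "ex_post d s (eval a s) s'"
    have "eval b s' = eval b s" using Plus.prems s' assms(2) eval_cong by (auto simp: ex_post_def)
    moreover have "run (cmp_ex (Suc d) b) s' (Z ^ ecost b) (ex_post (Suc d) s' (eval b s'))"
      using Plus.prems s' assms(2) by (intro Plus.IH) (auto simp: ex_post_def agree_def, metis)
    ultimately show "run (Seq (cmp_ex (Suc d) b) (Write scratch (Const d) (Add (reg d) (reg (Suc d))))) s'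
       (Z ^ ecost b + 7) (ex_post d s (eval (Plus a b) s))"
      using s' by (elim run_Seq) (auto intro!: run_Write simp: ex_post_def preserves_def store_apply agree_def)
  next
    show "Z ^ ecost a + (Z ^ ecost b + 7) \<le> Z ^ ecost (Plus a b)"
      using pow_add_le[OF assms(4), of "ecost a" "ecost b" 0] by simp
  qed
next
  case (Minus a b)
  have IH: "run (cmp_ex d a) s (Z ^ ecost a) (ex_post d s (eval a s))" using Minus by simp
  show ?case unfolding cmp_ex.simps
  proof (rule run_Seq[OF IH])
    fix s' assume s': "ex_post d s (eval a s) s'"
    have "eval b s' = eval b s" using Minus.prems s' assms(2) eval_cong by (auto simp: ex_post_def)
    moreover have "run (cmp_ex (Suc d) b) s' (Z ^ ecost b) (ex_post (Suc d) s' (eval b s'))"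
      using Minus.prems s' assms(2) by (intro Minus.IH) (auto simp: ex_post_def agree_def, metis)
    ultimately show "run (Seq (cmp_ex (Suc d) b) (Write scratch (Const d) (aexp.Sub (reg d) (reg (Suc d))))) s'
       (Z ^ ecost b + 7) (ex_post d s (eval (Minus a b) s))"
      using s' by (elim run_Seq) (auto intro!: run_Write simp: ex_post_def preserves_def store_apply agree_def)
  next
    show "Z ^ ecost a + (Z ^ ecost b + 7) \<le> Z ^ ecost (Minus a b)"
      using pow_add_le[OF assms(4), of "ecost a" "ecost b" 0] by simp
  qed
next
  case (Lt a b)
  have IH: "run (cmp_ex d a) s (Z ^ ecost a) (ex_post d s (eval a s))" using Lt by simp
  show ?case unfolding cmp_ex.simps
  proof (rule run_Seq[OF IH])
    fix s' assume s': "ex_post d s (eval a s) s'"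
    have "eval b s' = eval b s" using Lt.prems s' assms(2) eval_cong by (auto simp: ex_post_def)
    moreover have "run (cmp_ex (Suc d) b) s' (Z ^ ecost b) (ex_post (Suc d) s' (eval b s'))"
      using Lt.prems s' assms(2) by (intro Lt.IH) (auto simp: ex_post_def agree_def, metis)
    ultimately show "run (Seq (cmp_ex (Suc d) b)
        (Cond (LessB (reg d) (reg (Suc d))) (Write scratch (Const d) (Const 1))
        (Write scratch (Const d) (Const 0)))) s'
       (Z ^ ecost b + 9) (ex_post d s (eval (Lt a b) s))"
      using s' by (elim run_Seq)
        (auto intro!: run_Cond[where T = 3] run_Write simp: ex_post_def preserves_def store_apply agree_def)
  next
    show "Z ^ ecost a + (Z ^ ecost b + 9) \<le> Z ^ ecost (Lt a b)"
      using pow_add_le[OF assms(4), of "ecost a" "ecost b" 0] by simp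
  qed
next
  case (Ite c a b)
  have IH: "run (cmp_ex d c) s (Z ^ ecost c) (ex_post d s (eval c s))" using Ite by simp
  show ?case unfolding cmp_ex.simps
  proof (rule run_Seq[OF IH])
    fix s' assume s': "ex_post d s (eval c s) s'"
    have bd: "\<forall>N\<in>R. s' N 0 \<le> Z"
      using Ite.prems s' assms(2) by (auto simp: ex_post_def agree_def, metis)
    have ev: "eval a s' = eval a s" "eval b s' = eval b s"
      using Ite.prems s' assms(2) eval_cong by (auto simp: ex_post_def)
    have post: "ex_post d s' v s'' \<Longrightarrow> ex_post d s v s''" for v s''
      using s' by (auto simp: ex_post_def agree_def preserves_def)
    show "run (Cond (LessB (Const 0) (reg d)) (cmp_ex d a) (cmp_ex d b)) s'
       (Z ^ ecost a + Z ^ ecost b + 9) (ex_post d s (eval (Ite c a b) s))"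
    proof (rule run_Cond[where T = "Z ^ ecost a + Z ^ ecost b"])
      assume "bval (LessB (Const 0) (reg d)) s'"
      then have "eval (Ite c a b) s = eval a s'" using s' ev by (simp add: ex_post_def)
      then show "run (cmp_ex d a) s' (Z ^ ecost a + Z ^ ecost b) (ex_post d s (eval (Ite c a b) s))"
        using Ite.IH(2)[of s' d] Ite.prems bd post by (auto intro: run_mono)
    next
      assume "\<not> bval (LessB (Const 0) (reg d)) s'"
      then have "eval (Ite c a b) s = eval b s'" using s' ev by (simp add: ex_post_def)
      then show "run (cmp_ex d b) s' (Z ^ ecost a + Z ^ ecost b) (ex_post d s (eval (Ite c a b) s))"
        using Ite.IH(3)[of s' d] Ite.prems bd post by (auto intro: run_mono)
    qed simp
  next
    show "Z ^ ecost c + (Z ^ ecost a + Z ^ ecost b + 9) \<le> Z ^ ecost (Ite c a b)"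
      using pow_add_le[OF assms(4), of "ecost c" "ecost a" "ecost b"] by simp
  qed
next
  case (Sum x N e)
  define n where "n = s N 0"
  have x: "x \<noteq> scratch" "x \<notin> R" "N \<in> R" "wf_ex R e" "N \<noteq> scratch" "x \<noteq> N"
    using Sum.prems assms(2) by auto
  have n: "n \<le> Z" using x Sum.prems by (auto simp: n_def)
  \<comment> \<open>Register \<open>d\<close> accumulates the sum and register \<open>d + 1\<close>
    keeps the old value of \<open>x\<close>; outside \<open>scratch\<close> the state is the one in
    which the \<open>j\<close>-th summand is to be evaluated.\<close>
  define I where "I j s' \<longleftrightarrow> s' \<simeq> store s x 0 j \<and> preserves d s s' \<and>
     s' scratch d = (\<Sum>i<j. eval e (store s x 0 i)) \<and> s' scratch (Suc d) = s x 0" for j s'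
  have loop: "run (While (LessB (Read x (Const 0)) (Read N (Const 0)))
           (Seq (cmp_ex (Suc (Suc d)) e)
           (Seq (Write scratch (Const d) (Add (reg d) (reg (Suc (Suc d)))))
                (Write x (Const 0) (Add (Read x (Const 0)) (Const 1)))))) s'
         (n * (Z ^ ecost e + 19) + 6) (I n)" if "I 0 s'" for s'
  proof (rule run_While[where I = I and n = n and T = "Z ^ ecost e + 13", OF that])
    fix j s1 assume j: "j < n" and I: "I j s1"
    have ev: "eval e s1 = eval e (store s x 0 j)"
      using I x assms(2) eval_cong by (auto simp: I_def)
    have bd: "\<forall>N\<in>R. s1 N 0 \<le> Z"
    proof
      fix N' assume "N' \<in> R"
      then have "N' \<noteq> scratch" "N' \<noteq> x" using x assms(2) by auto
      then have "s1 N' 0 = s N' 0"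
        using I x assms(2) by (auto simp: I_def agree_def store_apply)
      then show "s1 N' 0 \<le> Z" using Sum.prems \<open>N' \<in> R\<close> by simp
    qed
    show "bval (LessB (Read x (Const 0)) (Read N (Const 0))) s1 \<and>
          run (Seq (cmp_ex (Suc (Suc d)) e)
           (Seq (Write scratch (Const d) (Add (reg d) (reg (Suc (Suc d)))))
                (Write x (Const 0) (Add (Read x (Const 0)) (Const 1))))) s1 (Z ^ ecost e + 13) (I (Suc j))"
    proof
      show "bval (LessB (Read x (Const 0)) (Read N (Const 0))) s1"
        using I j x by (simp add: I_def agree_def store_apply n_def)
      show "run (Seq (cmp_ex (Suc (Suc d)) e)
           (Seq (Write scratch (Const d) (Add (reg d) (reg (Suc (Suc d)))))
                (Write x (Const 0) (Add (Read x (Const 0)) (Const 1))))) s1 (Z ^ ecost e + 13) (I (Suc j))"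
      proof (rule run_Seq[OF Sum.IH])
        show "wf_ex R e" "\<forall>N\<in>R. s1 N 0 \<le> Z" using x bd by auto
        fix s2 assume s2: "ex_post (Suc (Suc d)) s1 (eval e s1) s2"
        have s2': "s2 \<simeq> store s x 0 j" using s2 I by (auto simp: ex_post_def I_def agree_def)
        have s2p: "preserves d s s2" using s2 I by (auto simp: ex_post_def I_def preserves_def)
        have s2d: "s2 scratch d = (\<Sum>i<j. eval e (store s x 0 i))" "s2 scratch (Suc d) = s x 0"
          "s2 scratch (Suc (Suc d)) = eval e (store s x 0 j)"
          using s2 I ev by (auto simp: ex_post_def I_def preserves_def)
        show "run (Seq (Write scratch (Const d) (Add (reg d) (reg (Suc (Suc d)))))
                (Write x (Const 0) (Add (Read x (Const 0)) (Const 1)))) s2 13 (I (Suc j))"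
        proof (rule run_Seq[where T = 7 and U = 6 and
              P = "\<lambda>s3. s3 = store s2 scratch d (\<Sum>i<Suc j. eval e (store s x 0 i))"])
          fix s3 assume s3: "s3 = store s2 scratch d (\<Sum>i<Suc j. eval e (store s x 0 i))"
          show "run (Write x (Const 0) (Add (Read x (Const 0)) (Const 1))) s3 6 (I (Suc j))"
            using s2' s2p s2d x unfolding s3
            by (intro run_Write) (auto simp: I_def agree_def store_apply preserves_def)
        qed (auto intro!: run_Write simp: s2d add.commute)
      qed simp
    qed
  next
    fix s1 assume "I n s1"
    then show "\<not> bval (LessB (Read x (Const 0)) (Read N (Const 0))) s1"
      using x by (simp add: I_def agree_def store_apply n_def)
  qed simp
  show ?case unfolding cmp_ex.simps
  proof (rule run_Seq[where T = 3 and U = "4 + (3 + (n * (Z ^ ecost e + 19) + 6 + 4))" and P = "\<lambda>s1. s1 = store s scratch d 0"], goal_cases)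
    case 1 show ?case by (rule run_Write) auto
  next
    case (2 s1)
    show ?case
    proof (rule run_Seq[where T = 4 and U = "3 + (n * (Z ^ ecost e + 19) + 6 + 4)" and P = "\<lambda>s2. s2 = store s1 scratch (Suc d) (s1 x 0)"], goal_cases)
      case 1 show ?case by (rule run_Write) auto
    next
      case (2 s2)
      show ?case
      proof (rule run_Seq[where T = 3 and U = "n * (Z ^ ecost e + 19) + 6 + 4" and P = "I 0"], goal_cases)
        case 1
        show ?case using x \<open>s2 = _\<close> \<open>s1 = _\<close>
          by (intro run_Write) (auto simp: I_def agree_def store_apply preserves_def)
      next
        case (2 s3)
        show ?case
        proof (rule run_Seq[where U = 4, OF loop[OF 2]], goal_cases)
          case (1 s4)
          then show ?case using x
            by (intro run_Write[where T = 4]) (auto simp: I_def ex_post_def agree_def store_apply preserves_def n_def)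
        qed (rule order_refl)
      qed (rule order_refl)
    qed (rule order_refl)
  next
    case 3
    have "n * (Z ^ ecost e + 19) \<le> n * (Z ^ ecost e + 20)" by simp
    then have "3 + (4 + (3 + (n * (Z ^ ecost e + 19) + 6 + 4))) \<le> n * (Z ^ ecost e + 20) + 30"
      by linarith
    also have "\<dots> \<le> Z ^ (ecost e + 2)" by (rule pow_loop_le[OF assms(4) n])
    also have "\<dots> \<le> Z ^ (ecost e + 3)" using assms(4) by (intro power_increasing) auto
    finally show ?case by simp
  qed
qed

definition prog_post :: "nat \<Rightarrow> state \<Rightarrow> state \<Rightarrow> state \<Rightarrow> bool" where
  "prog_post d s s1 s' \<longleftrightarrow> s' \<simeq> s1 \<and> preserves d s s'"

fun written :: "prog \<Rightarrow> name set" where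
  "written (Asg x i e) = {x}"
| "written (Sq p q) = written p \<union> written q"
| "written (When e p) = written p"
| "written (For x N p) = insert x (written p)"

lemma den_For_inv:
  assumes "I 0 s" "\<And>j s'. j < s N 0 \<Longrightarrow> I j s' \<Longrightarrow> I (Suc j) (den p (store s' x 0 j))"
  shows "I (s N 0) (den (For x N p) s)"
proof -
  have "I j (fold (\<lambda>j s. den p (store s x 0 j)) [0..<j] s)" if "j \<le> s N 0" for j
    using that by (induction j) (auto simp: assms)
  then show ?thesis by simp
qed

lemma den_frame: "x \<notin> written p \<Longrightarrow> den p s x = s x"
proof (induction p arbitrary: s)
  case (For y N p)
  then show ?case
    by (intro den_For_inv[where I = "\<lambda>_ s'. s' x = s x"]) (auto simp: store_apply)
qed (auto simp: store_apply)

lemma wf_prog_written: "wf_prog R p \<Longrightarrow> written p \<inter> R = {}"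
  by (induction p) auto

lemma run_cmp_prog:
  assumes "wf_prog R p" "scratch \<notin> R" "\<forall>N\<in>R. s0 N 0 \<le> Z" "32 \<le> Z" "s \<simeq> s0"
  shows "run (cmp_prog d p) s (Z ^ pcost p) (prog_post d s (den p s0))"
  using assms(1,3,5)
proof (induction p arbitrary: d s s0)
  case (Asg x i e)
  have bd: "\<forall>N\<in>R. s' N 0 \<le> Z" if "s' \<simeq> s0" for s'
    using Asg.prems assms(2) that by (auto simp: agree_def, metis)
  have x: "x \<noteq> scratch" "wf_ex R i" "wf_ex R e" using Asg.prems by auto
  have ev: "eval i s = eval i s0" using eval_cong[OF x(2) _ assms(2)] Asg.prems by blast
  show ?case unfolding cmp_prog.simps
  proof (rule run_Seq[OF run_cmp_ex[where s = s and Z = Z, OF x(2) assms(2) bd[OF Asg.prems(3)] assms(4)]])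
    fix s1 assume s1: "ex_post d s (eval i s) s1"
    have s1': "s1 \<simeq> s0" using s1 Asg.prems(3) by (auto simp: ex_post_def intro: agree_trans)
    have ev1: "eval e s1 = eval e s0" using eval_cong[OF x(3) s1' assms(2)] .
    show "run (Seq (cmp_ex (Suc d) e) (Write x (reg d) (reg (Suc d)))) s1 (Z ^ ecost e + 5)
       (prog_post d s (den (Asg x i e) s0))"
    proof (rule run_Seq[OF run_cmp_ex[where s = s1 and Z = Z, OF x(3) assms(2) bd[OF s1'] assms(4)]])
      fix s2 assume s2: "ex_post (Suc d) s1 (eval e s1) s2"
      show "run (Write x (reg d) (reg (Suc d))) s2 5 (prog_post d s (den (Asg x i e) s0))"
        using s1 s2 s1' ev ev1 x(1)
        by (intro run_Write) (auto simp: prog_post_def ex_post_def agree_def store_apply preserves_def)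
    qed simp
  next
    show "Z ^ ecost i + (Z ^ ecost e + 5) \<le> Z ^ pcost (Asg x i e)"
      using pow_add_le[OF assms(4), of "ecost i" "ecost e" 0] by simp
  qed
next
  case (Sq p q)
  have "written p \<inter> R = {}" using Sq.prems wf_prog_written by auto
  then have bd: "\<forall>N\<in>R. den p s0 N 0 \<le> Z"
    using Sq.prems(2) den_frame by (metis IntI empty_iff)
  show ?case unfolding cmp_prog.simps
  proof (rule run_Seq[OF Sq.IH(1)])
    fix s1 assume "prog_post d s (den p s0) s1"
    then show "run (cmp_prog d q) s1 (Z ^ pcost q) (prog_post d s (den (Sq p q) s0))"
      using Sq.IH(2)[of "den p s0" s1 d] bd Sq.prems(1)
      by (auto simp: prog_post_def preserves_def elim!: run_mono)
  next
    show "Z ^ pcost p + Z ^ pcost q \<le> Z ^ pcost (Sq p q)"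
      using pow_add_le[OF assms(4), of "pcost p" "pcost q" 0] by simp
  qed (use Sq.prems in auto)
next
  case (When e p)
  have bd: "\<forall>N\<in>R. s' N 0 \<le> Z" if "s' \<simeq> s0" for s'
    using When.prems assms(2) that by (auto simp: agree_def, metis)
  have x: "wf_ex R e" "wf_prog R p" using When.prems by auto
  have ev: "eval e s = eval e s0" using eval_cong[OF x(1) _ assms(2)] When.prems by blast
  show ?case unfolding cmp_prog.simps
  proof (rule run_Seq[OF run_cmp_ex[where s = s and Z = Z, OF x(1) assms(2) bd[OF When.prems(3)] assms(4)]])
    fix s1 assume s1: "ex_post d s (eval e s) s1"
    have s1': "s1 \<simeq> s0" using s1 When.prems(3) by (auto simp: ex_post_def intro: agree_trans)
    have post: "prog_post d s1 v s' \<Longrightarrow> prog_post d s v s'" for v s'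
      using s1 by (auto simp: prog_post_def ex_post_def preserves_def)
    show "run (Cond (LessB (Const 0) (reg d)) (cmp_prog d p) Skip) s1 (Z ^ pcost p + 6)
       (prog_post d s (den (When e p) s0))"
    proof (rule run_Cond[where T = "Z ^ pcost p + 1"])
      assume "bval (LessB (Const 0) (reg d)) s1"
      then have "den (When e p) s0 = den p s0" using s1 ev by (simp add: ex_post_def)
      then show "run (cmp_prog d p) s1 (Z ^ pcost p + 1) (prog_post d s (den (When e p) s0))"
        using When.IH[of s0 s1 d] When.prems s1' x post by (auto elim!: run_mono)
    next
      assume "\<not> bval (LessB (Const 0) (reg d)) s1"
      then have "den (When e p) s0 = s0" using s1 ev by (simp add: ex_post_def)
      then show "run Skip s1 (Z ^ pcost p + 1) (prog_post d s (den (When e p) s0))"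
        using s1 s1' by (auto intro!: run_Skip simp: prog_post_def ex_post_def)
    qed simp
  next
    show "Z ^ ecost e + (Z ^ pcost p + 6) \<le> Z ^ pcost (When e p)"
      using pow_add_le[OF assms(4), of "ecost e" "pcost p" 0] by simp
  qed
next
  case (For x N p)
  define n where "n = s0 N 0"
  have x: "x \<noteq> scratch" "x \<notin> R" "N \<in> R" "wf_prog R p" "N \<noteq> scratch" "x \<noteq> N"
    using For.prems assms(2) by auto
  have n: "n \<le> Z" using x For.prems by (auto simp: n_def)
  have wr: "written p \<inter> R = {}" using x wf_prog_written by auto
  define st where "st j = fold (\<lambda>j s. den p (store s x 0 j)) [0..<j] s0" for j
  have stSuc: "st (Suc j) = den p (store (st j) x 0 j)" for j by (simp add: st_def)
  have stR: "st j N' 0 = s0 N' 0" if "N' \<in> R" for j N'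
  proof (induction j)
    case (Suc j)
    have "N' \<notin> written p" "N' \<noteq> x" using wr x that by auto
    then show ?case using Suc by (simp add: stSuc den_frame store_apply)
  qed (simp add: st_def)
  define I where "I j s' \<longleftrightarrow> s' \<simeq> st j \<and> preserves d s s' \<and> s' scratch d = j" for j s'
  show ?case unfolding cmp_prog.simps
  proof (rule run_Seq[where T = 3 and U = "n * (Z ^ pcost p + 16) + 6" and P = "I 0"], goal_cases)
    case 1
    show ?case using For.prems(3)
      by (intro run_Write) (auto simp: I_def st_def preserves_def store_apply)
  next
    case (2 s1)
    have "run (While (LessB (reg d) (Read N (Const 0)))
           (Seq (Write x (Const 0) (reg d))
           (Seq (cmp_prog (Suc d) p)
                (Write scratch (Const d) (Add (reg d) (Const 1)))))) s1 (n * (Z ^ pcost p + 16) + 6) (I n)"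
    proof (rule run_While[where I = I and n = n and T = "Z ^ pcost p + 10", OF 2])
      fix j s2 assume j: "j < n" and I: "I j s2"
      show "bval (LessB (reg d) (Read N (Const 0))) s2 \<and>
          run (Seq (Write x (Const 0) (reg d))
           (Seq (cmp_prog (Suc d) p)
                (Write scratch (Const d) (Add (reg d) (Const 1))))) s2 (Z ^ pcost p + 10) (I (Suc j))"
      proof
        show "bval (LessB (reg d) (Read N (Const 0))) s2"
          using I j x stR[OF x(3)] by (simp add: I_def agree_def n_def)
        show "run (Seq (Write x (Const 0) (reg d))
           (Seq (cmp_prog (Suc d) p)
                (Write scratch (Const d) (Add (reg d) (Const 1))))) s2 (Z ^ pcost p + 10) (I (Suc j))"
        proof (rule run_Seq[where T = 4 and U = "Z ^ pcost p + 6" and P = "\<lambda>s3. s3 = store s2 x 0 j"], goal_cases)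
          case 1
          show ?case using I by (intro run_Write) (auto simp: I_def)
        next
          case (2 s3)
          have s3: "s3 \<simeq> store (st j) x 0 j" "s3 scratch = s2 scratch"
            using 2 I x by (auto simp: I_def agree_def store_apply)
          have bd: "\<forall>N\<in>R. store (st j) x 0 j N 0 \<le> Z"
            using stR For.prems(2) x by (auto simp: store_apply)
          show ?case
          proof (rule run_Seq[where U = 6, OF For.IH[OF x(4) bd s3(1)]], goal_cases)
            case (1 s4)
            then show ?case using I s3
              by (intro run_Write[where T = 6])
                (auto simp: I_def prog_post_def preserves_def stSuc, auto simp: store_apply)
          qed (rule order_refl)
        qed simp
      qed
    next
      fix s2 assume "I n s2"
      then show "\<not> bval (LessB (reg d) (Read N (Const 0))) s2"
        using x stR[OF x(3)] by (simp add: I_def agree_def n_def)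
    qed simp
    then show ?case
      by (rule run_mono[OF _ order_refl]) (auto simp: I_def prog_post_def st_def n_def)
  next
    case 3
    have "n * (Z ^ pcost p + 16) \<le> n * (Z ^ pcost p + 20)" by simp
    then have "3 + (n * (Z ^ pcost p + 16) + 6) \<le> n * (Z ^ pcost p + 20) + 30"
      by linarith
    also have "\<dots> \<le> Z ^ (pcost p + 2)" by (rule pow_loop_le[OF assms(4) n])
    also have "\<dots> \<le> Z ^ (pcost p + 3)" using assms(4) by (intro power_increasing) auto
    finally show ?case by simp
  qed
qed

section \<open>Packings and reduced paths\<close>

text \<open>Induction on the total demand. One unit of a demand \<open>D i > 0\<close> is served by
  some \<open>v\<close> in \<open>N i\<close>, and \<open>v\<close> is removed everywhere. A choice
  of \<open>v\<close> fails only if some tight set \<open>X\<close> without \<open>i\<close> has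
  \<open>v\<close> among its neighbours. By submodularity of the neighbourhood size, tight sets are
  closed under union; so if every choice failed, one tight set would have all of \<open>N i\<close>
  in its neighbourhood, and adding \<open>i\<close> to it would violate Hall's condition.\<close>

lemma hall_with_multiplicities:
  fixes N :: "'i \<Rightarrow> 'a set" and D :: "'i \<Rightarrow> nat"
  assumes "finite I" and "\<And>i. i \<in> I \<Longrightarrow> finite (N i)"
    and "\<And>X. X \<subseteq> I \<Longrightarrow> sum D X \<le> card (\<Union>i\<in>X. N i)"
  shows "\<exists>F. (\<forall>i\<in>I. F i \<subseteq> N i \<and> card (F i) = D i) \<and>
             (\<forall>i\<in>I. \<forall>j\<in>I. i \<noteq> j \<longrightarrow> F i \<inter> F j = {})"
  using assms(2,3)
proof (induction "sum D I" arbitrary: D N)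
  case 0
  then have "\<forall>i\<in>I. D i = 0" using assms(1) by simp
  then show ?case by (intro exI[of _ "\<lambda>_. {}"]) auto
next
  case (Suc m)
  note fin = Suc.prems(1) and hall = Suc.prems(2)
  have finU: "X \<subseteq> I \<Longrightarrow> finite (\<Union>i\<in>X. N i)" for X
    using fin assms(1) finite_subset by blast
  have finX: "X \<subseteq> I \<Longrightarrow> finite X" for X using assms(1) finite_subset by blast
  from Suc.hyps(2) obtain i where i: "i \<in> I" "D i > 0"
    by (metis not_gr_zero sum.neutral nat.distinct(1))
  define D' where "D' = D(i := D i - 1)"
  have D'sum: "sum D' X = (if i \<in> X then sum D X - 1 else sum D X)" if "X \<subseteq> I" for X
  proof (cases "i \<in> X")
    case True
    then have "sum D X = D i + sum D (X - {i})" "sum D' X = D' i + sum D' (X - {i})"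
      using finX[OF that] by (auto simp: sum.remove)
    moreover have "sum D' (X - {i}) = sum D (X - {i})" by (rule sum.cong) (auto simp: D'_def)
    ultimately show ?thesis using True i by (simp add: D'_def)
  next
    case False
    then show ?thesis by (auto simp: D'_def intro!: sum.cong)
  qed
  \<comment> \<open>Under Hall's condition the inequality is an equality: no neighbour of
    \<open>X\<close> can be spared.\<close>
  define tight where "tight X \<longleftrightarrow> X \<subseteq> I - {i} \<and> card (\<Union>j\<in>X. N j) \<le> sum D X" for X
  have tight_Un: "tight (X \<union> Y)" if "tight X" "tight Y" for X Y
  proof -
    have XY: "X \<subseteq> I" "Y \<subseteq> I" using that by (auto simp: tight_def)
    let ?U = "\<lambda>X. \<Union>j\<in>X. N j"
    have "card (?U (X \<union> Y)) + card (?U X \<inter> ?U Y) = card (?U X) + card (?U Y)"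
      using card_Un_Int[OF finU[OF XY(1)] finU[OF XY(2)]] by (simp add: UN_Un)
    moreover have "card (?U (X \<inter> Y)) \<le> card (?U X \<inter> ?U Y)"
      using finU[OF XY(1)] by (intro card_mono) auto
    moreover have "sum D (X \<inter> Y) \<le> card (?U (X \<inter> Y))" using hall XY by (meson le_infI1)
    moreover have "sum D (X \<union> Y) + sum D (X \<inter> Y) = sum D X + sum D Y"
      using sum.union_inter[OF finX[OF XY(1)] finX[OF XY(2)]] .
    ultimately have "card (?U (X \<union> Y)) \<le> sum D (X \<union> Y)"
      using that unfolding tight_def by linarith
    then show ?thesis using that by (auto simp: tight_def)
  qed
  have "\<exists>v\<in>N i. \<forall>X\<subseteq>I. sum D' X \<le> card (\<Union>j\<in>X. N j - {v})"
  proof (rule ccontr)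
    assume no: "\<not> ?thesis"
    have ex: "\<exists>X. tight X \<and> v \<in> (\<Union>j\<in>X. N j)" if v: "v \<in> N i" for v
    proof -
      from no v obtain X where X: "X \<subseteq> I" "sum D' X > card (\<Union>j\<in>X. N j - {v})"
        by (meson not_le)
      have eq: "(\<Union>j\<in>X. N j - {v}) = (\<Union>j\<in>X. N j) - {v}" by blast
      have c: "card (\<Union>j\<in>X. N j) \<le> Suc (card (\<Union>j\<in>X. N j - {v}))"
        unfolding eq using card_Suc_Diff1[OF finU[OF X(1)]] by (metis Diff_insert0 Diff_empty le_SucI order_refl)
      have "i \<notin> X"
      proof
        assume "i \<in> X"
        then show False using X D'sum[OF X(1)] hall[OF X(1)] c by simp
      qed
      moreover have "v \<in> (\<Union>j\<in>X. N j)"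
      proof (rule ccontr)
        assume "v \<notin> (\<Union>j\<in>X. N j)"
        then have "card (\<Union>j\<in>X. N j - {v}) = card (\<Union>j\<in>X. N j)" unfolding eq by simp
        then show False using X \<open>i \<notin> X\<close> D'sum[OF X(1)] hall[OF X(1)] by simp
      qed
      ultimately show ?thesis using X c D'sum[OF X(1)]
        by (intro exI[of _ X]) (auto simp: tight_def)
    qed
    have "finite {X. tight X}" using assms(1) by (auto simp: tight_def intro: finite_subset[of _ "Pow I"])
    moreover have "tight {}" by (simp add: tight_def)
    \<comment> \<open>A maximal tight set contains every tight set, because its union with another
      one is tight again.\<close>
    ultimately obtain T where T: "tight T" "\<And>X. tight X \<Longrightarrow> T \<subseteq> X \<Longrightarrow> X = T"
      using finite_has_maximal[of "{X. tight X}"] by (metis empty_iff mem_Collect_eq)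
    have "N i \<subseteq> (\<Union>j\<in>T. N j)"
    proof
      fix v assume "v \<in> N i"
      then obtain X where X: "tight X" "v \<in> (\<Union>j\<in>X. N j)" using ex by blast
      have "T \<union> X = T" using T(2)[OF tight_Un[OF T(1) X(1)]] by simp
      then show "v \<in> (\<Union>j\<in>T. N j)" using X(2) by blast
    qed
    then have "(\<Union>j\<in>insert i T. N j) = (\<Union>j\<in>T. N j)" by blast
    moreover have "insert i T \<subseteq> I" "i \<notin> T" "finite T" using T(1) i finX by (auto simp: tight_def)
    ultimately show False using hall[of "insert i T"] T(1) i by (simp add: tight_def)
  qed
  then obtain v where v: "v \<in> N i" "\<And>X. X \<subseteq> I \<Longrightarrow> sum D' X \<le> card (\<Union>j\<in>X. N j - {v})" by blast
  have "m = sum D' I" using D'sum[of I] i Suc.hyps(2) by simp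
  then have "\<exists>F. (\<forall>j\<in>I. F j \<subseteq> N j - {v} \<and> card (F j) = D' j) \<and>
      (\<forall>j\<in>I. \<forall>j'\<in>I. j \<noteq> j' \<longrightarrow> F j \<inter> F j' = {})"
    using v(2) fin by (intro Suc.hyps(1)) auto
  then obtain F where F: "\<forall>j\<in>I. F j \<subseteq> N j - {v} \<and> card (F j) = D' j"
      "\<forall>j\<in>I. \<forall>j'\<in>I. j \<noteq> j' \<longrightarrow> F j \<inter> F j' = {}"
    by blast
  define G where "G = F(i := insert v (F i))"
  have "F i \<subseteq> N i - {v}" using F(1) i(1) by blast
  then have "finite (F i)" "v \<notin> F i" using fin[OF i(1)] finite_subset by blast+
  then have "\<forall>j\<in>I. G j \<subseteq> N j \<and> card (G j) = D j"
    using F(1) v(1) i by (auto simp: G_def D'_def)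
  moreover have "\<forall>j\<in>I. \<forall>j'\<in>I. j \<noteq> j' \<longrightarrow> G j \<inter> G j' = {}"
  proof (intro ballI impI)
    fix j j' assume jj: "j \<in> I" "j' \<in> I" "j \<noteq> j'"
    then have "v \<notin> F j" "v \<notin> F j'" "F j \<inter> F j' = {}" using F by blast+
    then show "G j \<inter> G j' = {}" using jj(3) by (cases "j = i"; cases "j' = i") (simp_all add: G_def)
  qed
  ultimately show ?case by (intro exI[of _ G]) blast
qed

text \<open>Induction on \<open>T\<close>: a further index either repeats an earlier one in both
  families at once, or its sets are disjoint from all earlier ones in both, and then cardinalities
  add. Applied to the cliques in use before and after an exchange.\<close>

lemma card_UN_mono_classes:
  assumes "finite T"
    and "\<And>p. p \<in> T \<Longrightarrow> finite (C p) \<and> finite (C' p) \<and> card (C p) \<le> card (C' p)"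
    and "\<And>p q. p \<in> T \<Longrightarrow> q \<in> T \<Longrightarrow> C p = C q \<and> C' p = C' q \<or> C p \<inter> C q = {} \<and> C' p \<inter> C' q = {}"
  shows "card (\<Union>p\<in>T. C p) \<le> card (\<Union>p\<in>T. C' p)"
  using assms
proof (induction T rule: finite_induct)
  case (insert p T)
  have IH: "card (\<Union>p\<in>T. C p) \<le> card (\<Union>p\<in>T. C' p)" using insert by blast
  show ?case
  proof (cases "\<exists>q\<in>T. C p = C q \<and> C' p = C' q")
    case True
    then have "(\<Union>p\<in>insert p T. C p) = (\<Union>p\<in>T. C p)" "(\<Union>p\<in>insert p T. C' p) = (\<Union>p\<in>T. C' p)"
      by blast+
    then show ?thesis using IH by simp
  next
    case False
    have d: "C p \<inter> C q = {} \<and> C' p \<inter> C' q = {}" if "q \<in> T" for q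
    proof -
      have "\<not> (C p = C q \<and> C' p = C' q)" using False that by (meson bexI)
      moreover have "C p = C q \<and> C' p = C' q \<or> C p \<inter> C q = {} \<and> C' p \<inter> C' q = {}"
        using that by (intro insert.prems(2)) simp_all
      ultimately show ?thesis by argo
    qed
    have "card (\<Union>p\<in>insert p T. C p) = card (C p) + card (\<Union>p\<in>T. C p)"
      using d insert.prems(1) insert.hyps by (simp, intro card_Un_disjoint) auto
    moreover have "card (\<Union>p\<in>insert p T. C' p) = card (C' p) + card (\<Union>p\<in>T. C' p)"
      using d insert.prems(1) insert.hyps by (simp, intro card_Un_disjoint) auto
    ultimately show ?thesis using IH insert.prems(1)[of p] by simp
  qed
qed simp

lemma set_vwalk_arcs_nth: "set (vwalk_arcs p) = {(p ! t, p ! Suc t) |t. Suc t < length p}"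
proof (induction p rule: vwalk_arcs.induct)
  case (3 x y xs)
  have "{(((x # y # xs) ! t), ((x # y # xs) ! Suc t)) |t. Suc t < length (x # y # xs)} =
    insert (x, y) {((y # xs) ! t, (y # xs) ! Suc t) |t. Suc t < length (y # xs)}" (is "?A = ?B")
  proof
    show "?A \<subseteq> ?B"
    proof
      fix e assume "e \<in> ?A"
      then obtain t where "e = ((x # y # xs) ! t, (x # y # xs) ! Suc t)" "Suc t < length (x # y # xs)" by blast
      then show "e \<in> ?B" by (cases t) auto
    qed
    show "?B \<subseteq> ?A" by force
  qed
  then show ?case using 3 by simp
qed auto

lemma set_vwalk_arcs_append:
  "set (vwalk_arcs (xs @ u # ys)) = set (vwalk_arcs (xs @ [u])) \<union> set (vwalk_arcs (u # ys))"
  by (induction xs rule: vwalk_arcs.induct) (cases ys; auto)+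

text \<open>By \<open>p3_free\<close> the graph without \<open>M\<close> is a disjoint union of
  cliques. Since \<open>A \<subseteq> M\<close>, a path vertex outside \<open>M\<close> is always
  interior.\<close>

locale cluster_instance =
  fixes n :: nat and adj :: "nat \<Rightarrow> nat \<Rightarrow> bool" and A M :: "nat set"
  assumes adj_sym: "adj u v \<Longrightarrow> adj v u"
    and adj_irrefl: "\<not> adj u u"
    and adj_bound: "adj u v \<Longrightarrow> u < n"
    and A_sub: "A \<subseteq> M" and M_bound: "M \<subseteq> {..<n}"
    and p3_free: "u \<notin> M \<Longrightarrow> v \<notin> M \<Longrightarrow> w \<notin> M \<Longrightarrow> adj u v \<Longrightarrow> adj v w \<Longrightarrow> u \<noteq> w \<Longrightarrow> adj u w"
begin

lemma finite_M: "finite M"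
  using M_bound finite_subset by blast

text \<open>Outside \<open>M\<close> this is the equivalence relation whose classes are the
  cliques.\<close>

definition sim :: "nat \<Rightarrow> nat \<Rightarrow> bool" where
  "sim u v \<longleftrightarrow> u = v \<or> adj u v"

lemma sim_refl [simp]: "sim u u"
  by (simp add: sim_def)

lemma sim_sym: "sim u v \<Longrightarrow> sim v u"
  using adj_sym by (auto simp: sim_def)

lemma sim_trans: "sim u v \<Longrightarrow> sim v w \<Longrightarrow> u \<notin> M \<Longrightarrow> v \<notin> M \<Longrightarrow> w \<notin> M \<Longrightarrow> sim u w"
  unfolding sim_def by (metis p3_free)

definition clique :: "nat \<Rightarrow> nat set" where
  "clique u = {v. v < n \<and> v \<notin> M \<and> sim u v}"

lemma finite_clique [simp]: "finite (clique u)"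
  by (simp add: clique_def)

lemma clique_eq: "sim u v \<Longrightarrow> u \<notin> M \<Longrightarrow> v \<notin> M \<Longrightarrow> clique u = clique v"
  using sim_trans sim_sym unfolding clique_def by blast

lemma clique_disjoint: "\<not> sim u v \<Longrightarrow> u \<notin> M \<Longrightarrow> v \<notin> M \<Longrightarrow> clique u \<inter> clique v = {}"
  using sim_trans sim_sym unfolding clique_def by blast

text \<open>\<open>a_path\<close> for a graph given by \<open>adj\<close> (see
  \<open>a_path_iff\<close>); the equation for \<open>set p \<inter> A\<close> treats the ends and
  the interior at once.\<close>

definition apath :: "nat list \<Rightarrow> bool" where
  "apath p \<longleftrightarrow> distinct p \<and> set p \<subseteq> {..<n} \<and> (\<forall>(u, v)\<in>set (vwalk_arcs p). adj u v) \<and>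
     hd p \<noteq> last p \<and> set p \<inter> A = {hd p, last p}"

text \<open>An arc between two vertices outside \<open>M\<close> can be subdivided by any unused vertex of
  the same clique; a path is determined up to such fillers by its reduced form.\<close>

definition jumps :: "nat list \<Rightarrow> nat set" where
  "jumps p = {u. \<exists>v. (u, v) \<in> set (vwalk_arcs p) \<and> u \<notin> M \<and> v \<notin> M}"

lemma jumps_subset: "jumps p \<subseteq> set p"
  by (force simp: jumps_def set_vwalk_arcs_nth)

text \<open>\<open>u\<close>, \<open>u'\<close> and \<open>v\<close> lie in one clique, so
  \<open>v\<close> fits between \<open>u\<close> and \<open>u'\<close>. Both new arcs stay outside
  \<open>M\<close>, so no jump is lost and the insertion can be repeated.\<close>

lemma apath_insert:
  assumes p: "apath p" and uv: "(u, u') \<in> set (vwalk_arcs p)"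
    and M: "u \<notin> M" "u' \<notin> M" "v \<notin> M" and v: "adj u v" "v \<notin> set p"
  shows "\<exists>p'. apath p' \<and> set p' = insert v (set p) \<and> jumps p \<subseteq> jumps p'"
proof -
  from uv obtain t where t: "Suc t < length p" "u = p ! t" "u' = p ! Suc t"
    by (auto simp: set_vwalk_arcs_nth)
  define xs ys where "xs = take t p" and "ys = drop (Suc (Suc t)) p"
  have pe: "p = xs @ u # u' # ys"
    unfolding xs_def ys_def t using t(1) by (metis Cons_nth_drop_Suc Suc_lessD append_take_drop_id)
  define p' where "p' = xs @ u # v # u' # ys"
  have arcs: "set (vwalk_arcs p) = set (vwalk_arcs (xs @ [u])) \<union> insert (u, u') (set (vwalk_arcs (u' # ys)))"
    unfolding pe by (subst set_vwalk_arcs_append) simp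
  have arcs': "set (vwalk_arcs p') =
      set (vwalk_arcs (xs @ [u])) \<union> insert (u, v) (insert (v, u') (set (vwalk_arcs (u' # ys))))"
    unfolding p'_def by (subst set_vwalk_arcs_append) simp
  have "adj u u'" using p uv by (auto simp: apath_def)
  moreover have "v \<noteq> u'" using v pe by auto
  ultimately have "adj v u'" using M v p3_free[of v u u'] adj_sym by blast
  have "v < n" using v adj_bound adj_sym by blast
  have "set p' = insert v (set p)" by (auto simp: pe p'_def)
  moreover have "hd p' = hd p" "last p' = last p" by (simp_all add: pe p'_def hd_append)
  moreover have "distinct p'" using p v by (auto simp: apath_def pe p'_def)
  moreover have "v \<notin> A" using M A_sub by blast
  ultimately have "apath p'"
    using p v \<open>adj v u'\<close> \<open>v < n\<close> unfolding apath_def arcs arcs' by auto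
  moreover have "jumps p \<subseteq> jumps p'" using M unfolding jumps_def arcs arcs' by blast
  ultimately show ?thesis using \<open>set p' = _\<close> by blast
qed

lemma apath_fill:
  assumes "finite F" "apath p" "F \<inter> M = {}" "F \<inter> set p = {}" "\<forall>v\<in>F. \<exists>u\<in>jumps p. adj u v"
  shows "\<exists>p'. apath p' \<and> set p' = set p \<union> F"
  using assms
proof (induction F arbitrary: p rule: finite_induct)
  case (insert v F)
  then obtain u u' where u: "(u, u') \<in> set (vwalk_arcs p)" "u \<notin> M" "u' \<notin> M" "adj u v"
    by (auto simp: jumps_def)
  with insert.prems obtain p1 where p1: "apath p1" "set p1 = insert v (set p)" "jumps p \<subseteq> jumps p1"
    using apath_insert[of p u u' v] by auto
  have "\<exists>p'. apath p' \<and> set p' = set p1 \<union> F"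
  proof (rule insert.IH)
    show "\<forall>w\<in>F. \<exists>u\<in>jumps p1. adj u w" using insert.prems(4) p1(3) by blast
  qed (use insert.prems insert.hyps p1 in auto)
  then show ?case using p1(2) by auto
qed auto

definition reduced :: "nat list \<Rightarrow> bool" where
  "reduced p \<longleftrightarrow> (\<forall>t. Suc (Suc t) < length p \<longrightarrow> p ! t \<in> M \<or> p ! Suc t \<in> M \<or> p ! Suc (Suc t) \<in> M)"

text \<open>The middle vertex \<open>v\<close> of three consecutive vertices outside
  \<open>M\<close> is deleted, which leaves a jump in the clique of \<open>v\<close>. Later
  deletions may remove that very jump, so the induction carries the last conjunct: every clique with
  a jump keeps one, and \<open>v\<close> can be reinserted there.\<close>

lemma apath_reduce:
  assumes "apath p"
  shows "\<exists>q F. apath q \<and> reduced q \<and> set p = set q \<union> F \<and> F \<inter> set q = {} \<and> F \<inter> M = {} \<and>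
     (\<forall>v\<in>F. \<exists>u\<in>jumps q. adj u v) \<and> (\<forall>v\<in>jumps p. \<exists>u\<in>jumps q. sim u v)"
  using assms
proof (induction "length p" arbitrary: p rule: less_induct)
  case less
  show ?case
  proof (cases "reduced p")
    case True
    moreover have "\<forall>v\<in>jumps p. \<exists>u\<in>jumps p. sim u v" by force
    ultimately show ?thesis using less.prems by (intro exI[of _ p] exI[of _ "{}"]) auto
  next
    case False
    then obtain t where t: "Suc (Suc t) < length p" "p ! t \<notin> M" "p ! Suc t \<notin> M" "p ! Suc (Suc t) \<notin> M"
      by (auto simp: reduced_def)
    define xs u v u' ys where "xs = take t p" and "u = p ! t" and "v = p ! Suc t"
      and "u' = p ! Suc (Suc t)" and "ys = drop (Suc (Suc (Suc t))) p"
    have pe: "p = xs @ u # v # u' # ys"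
      unfolding xs_def ys_def u_def v_def u'_def using t(1)
      by (metis Cons_nth_drop_Suc Suc_lessD append_take_drop_id)
    have M: "u \<notin> M" "v \<notin> M" "u' \<notin> M" using t by (auto simp: u_def v_def u'_def)
    define p1 where "p1 = xs @ u # u' # ys"
    have arcs1: "set (vwalk_arcs p1) = set (vwalk_arcs (xs @ [u])) \<union> insert (u, u') (set (vwalk_arcs (u' # ys)))"
      unfolding p1_def by (subst set_vwalk_arcs_append) simp
    have arcs: "set (vwalk_arcs p) =
        set (vwalk_arcs (xs @ [u])) \<union> insert (u, v) (insert (v, u') (set (vwalk_arcs (u' # ys))))"
      unfolding pe by (subst set_vwalk_arcs_append) simp
    have d: "distinct p" and adj: "adj u v" "adj v u'" using less.prems arcs by (auto simp: apath_def)
    have "u \<noteq> u'" using d by (auto simp: pe)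
    then have "adj u u'" using adj M p3_free by blast
    have sp: "set p = insert v (set p1)" "v \<notin> set p1" using d by (auto simp: pe p1_def)
    have "hd p1 = hd p" "last p1 = last p" by (simp_all add: pe p1_def hd_append)
    moreover have "v \<notin> A" using M A_sub by blast
    ultimately have "apath p1"
      using less.prems \<open>adj u u'\<close> sp unfolding apath_def arcs arcs1 by (auto simp: pe p1_def)
    moreover have "length p1 < length p" by (simp add: pe p1_def)
    ultimately have "\<exists>q F. apath q \<and> reduced q \<and> set p1 = set q \<union> F \<and> F \<inter> set q = {} \<and> F \<inter> M = {} \<and>
     (\<forall>v\<in>F. \<exists>u\<in>jumps q. adj u v) \<and> (\<forall>v\<in>jumps p1. \<exists>u\<in>jumps q. sim u v)"
      by (intro less.hyps)
    then obtain q F where q: "apath q" "reduced q" "set p1 = set q \<union> F" "F \<inter> set q = {}" "F \<inter> M = {}"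
      "\<forall>v\<in>F. \<exists>u\<in>jumps q. adj u v" "\<forall>v\<in>jumps p1. \<exists>u\<in>jumps q. sim u v"
      by (elim exE conjE) (rule that)
    have jM: "w \<in> jumps q' \<Longrightarrow> w \<notin> M" for w q' by (auto simp: jumps_def)
    have "u \<in> jumps p1" using M by (auto simp: jumps_def arcs1)
    then obtain w where w: "w \<in> jumps q" "sim w u" using q(7) by blast
    have wv: "sim w v" using w adj M jM[OF w(1)] sim_trans[of w u v] by (auto simp: sim_def)
    have "w \<noteq> v" using w(1) jumps_subset[of q] sp(2) q(3) by auto
    then have "adj w v" using wv by (auto simp: sim_def)
    \<comment> \<open>\<open>v\<close> is the only jump of \<open>p\<close> that \<open>p1\<close>
      may lack, and \<open>w\<close> represents it.\<close>
    have jp: "jumps p \<subseteq> insert v (jumps p1)" using M unfolding jumps_def arcs arcs1 by blast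
    show ?thesis
      using q sp M w wv \<open>adj w v\<close> jp
      by (intro exI[of _ q] exI[of _ "insert v F"]) (auto 0 4)
  qed
qed

text \<open>Source of \<open>L = 3 * card M\<close>. The path is cut behind each vertex of
  \<open>M\<close>. A piece has at most two further vertices, as any three consecutive vertices
  include one of \<open>M\<close>, and nothing is left over since the path ends in
  \<open>M\<close>.\<close>

lemma reduced_length:
  assumes "reduced p" "p \<noteq> []" "last p \<in> M"
  shows "length p \<le> 3 * length (filter (\<lambda>v. v \<in> M) p)"
  using assms
proof (induction "length p" arbitrary: p rule: less_induct)
  case less
  have red_tl: "reduced q" if "reduced (a # q)" for a q
    using that unfolding reduced_def by (metis Suc_less_eq length_Cons nth_Cons_Suc)
  have IH: "length q \<le> 3 * length (filter (\<lambda>v. v \<in> M) q)"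
    if "length q < length p" "reduced q" "q = [] \<or> last q \<in> M" for q
    using less.hyps[of q] that by (cases "q = []") auto
  obtain a r where p: "p = a # r" using less.prems by (cases p) auto
  show ?case
  proof (cases "a \<in> M")
    case True
    have "length r \<le> 3 * length (filter (\<lambda>v. v \<in> M) r)"
      using less.prems red_tl p by (intro IH) (auto split: if_splits)
    then show ?thesis using p True by simp
  next
    case a: False
    then obtain b r' where r: "r = b # r'" using less.prems p by (cases r) auto
    show ?thesis
    proof (cases "b \<in> M")
      case True
      have "length r' \<le> 3 * length (filter (\<lambda>v. v \<in> M) r')"
        using less.prems red_tl p r by (intro IH) (auto split: if_splits)
      then show ?thesis using p r True by simp
    next
      case b: False
      then obtain c r'' where r': "r' = c # r''" using less.prems p r by (cases r') auto
      have c: "c \<in> M" using less.prems(1) a b unfolding reduced_def p r r'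
        by (auto dest: spec[of _ 0])
      have "length r'' \<le> 3 * length (filter (\<lambda>v. v \<in> M) r'')"
        using less.prems red_tl[of a r] red_tl[of b r'] red_tl[of c r''] p r r'
        by (intro IH) (auto split: if_splits)
      then show ?thesis using p r r' c by simp
    qed
  qed
qed

section \<open>Packings as disjoint reduced paths with enough fillers\<close>

definition packing :: "nat \<Rightarrow> nat \<Rightarrow> bool" where
  "packing k l \<longleftrightarrow> (\<exists>p. (\<forall>i<k. apath (p i) \<and> length (p i) = Suc l) \<and>
     (\<forall>i<k. \<forall>j<k. i \<noteq> j \<longrightarrow> set (p i) \<inter> set (p j) = {}))"

text \<open>The neighbourhood of the set \<open>X\<close> of paths in Hall's condition: the vertices
  still available that fit at a jump of one of them.\<close>

definition free :: "nat \<Rightarrow> (nat \<Rightarrow> nat) \<Rightarrow> (nat \<Rightarrow> nat \<Rightarrow> nat) \<Rightarrow> nat set \<Rightarrow> nat set" where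
  "free k len \<phi> X = {v. v < n \<and> v \<notin> M \<and> (\<forall>i<k. \<forall>t<len i. \<phi> i t \<noteq> v) \<and>
     (\<exists>i<k. i \<in> X \<and> (\<exists>t<len i. Suc t < len i \<and> \<phi> i t \<notin> M \<and> \<phi> i (Suc t) \<notin> M \<and> adj (\<phi> i t) v))}"

text \<open>Lengths and a position map replace lists, since the program holds the paths in arrays.
  Reducedness is kept apart as \<open>sparse\<close>: the program verifies only what it takes to
  build a packing.\<close>

definition skeleton :: "nat \<Rightarrow> nat \<Rightarrow> (nat \<Rightarrow> nat) \<Rightarrow> (nat \<Rightarrow> nat \<Rightarrow> nat) \<Rightarrow> bool" where
  "skeleton k l len \<phi> \<longleftrightarrow>
     (\<forall>i<k. 2 \<le> len i \<and> len i \<le> Suc l \<and>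
        (\<forall>t<len i. \<phi> i t < n \<and> (\<phi> i t \<in> A \<longleftrightarrow> t = 0 \<or> Suc t = len i) \<and>
           (Suc t < len i \<longrightarrow> adj (\<phi> i t) (\<phi> i (Suc t))))) \<and>
     (\<forall>i<k. \<forall>t<len i. \<forall>j<k. \<forall>u<len j. \<phi> i t = \<phi> j u \<longrightarrow> i = j \<and> t = u)"

text \<open>Hall's condition for handing out to path \<open>i\<close> the \<open>l + 1 - len i\<close> fillers it still
  needs.\<close>
definition hall :: "nat \<Rightarrow> nat \<Rightarrow> (nat \<Rightarrow> nat) \<Rightarrow> (nat \<Rightarrow> nat \<Rightarrow> nat) \<Rightarrow> nat set \<Rightarrow> bool" where
  "hall k l len \<phi> X \<longleftrightarrow> (\<Sum>i | i < k \<and> i \<in> X. Suc l - len i) \<le> card (free k len \<phi> X)"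

definition valid :: "nat \<Rightarrow> nat \<Rightarrow> (nat \<Rightarrow> nat) \<Rightarrow> (nat \<Rightarrow> nat \<Rightarrow> nat) \<Rightarrow> bool" where
  "valid k l len \<phi> \<longleftrightarrow> skeleton k l len \<phi> \<and> (\<forall>X. hall k l len \<phi> X)"

text \<open>Reduces the quantifier over all sets in \<open>valid\<close> to subsets of
  \<open>{..<k}\<close>, which the program can enumerate.\<close>

lemma hall_Int: "hall k l len \<phi> X \<longleftrightarrow> hall k l len \<phi> (X \<inter> {..<k})"
proof -
  have "free k len \<phi> X = free k len \<phi> (X \<inter> {..<k})" by (auto simp: free_def)
  moreover have "{i. i < k \<and> i \<in> X} = {i. i < k \<and> i \<in> X \<inter> {..<k}}" by auto
  ultimately show ?thesis unfolding hall_def by simp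
qed

text \<open>Hall's theorem hands the paths disjoint sets of \<open>Suc l - len i\<close> fillers,
  and \<open>apath_fill\<close> inserts them. Fillers avoid all skeleton vertices, so the filled
  paths stay disjoint.\<close>

lemma valid_imp_packing:
  assumes "valid k l len \<phi>"
  shows "packing k l"
proof -
  define q where "q i = map (\<phi> i) [0..<len i]" for i
  have sk: "skeleton k l len \<phi>" and hall: "\<And>X. hall k l len \<phi> X" using assms by (auto simp: valid_def)
  have q: "apath (q i)" "length (q i) = len i" "len i \<le> Suc l" if i: "i < k" for i
  proof -
    have len: "2 \<le> len i" "len i \<le> Suc l"
      and A: "\<And>t. t < len i \<Longrightarrow> \<phi> i t < n \<and> (\<phi> i t \<in> A \<longleftrightarrow> t = 0 \<or> Suc t = len i)"
      and adj: "\<And>t. Suc t < len i \<Longrightarrow> adj (\<phi> i t) (\<phi> i (Suc t))"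
      and inj: "\<And>t u. t < len i \<Longrightarrow> u < len i \<Longrightarrow> \<phi> i t = \<phi> i u \<Longrightarrow> t = u"
      using sk i by (auto simp: skeleton_def)
    have "hd (q i) = \<phi> i 0" "last (q i) = \<phi> i (len i - 1)"
      using len by (simp_all add: q_def hd_map last_map)
    moreover have "set (q i) \<inter> A = {\<phi> i 0, \<phi> i (len i - 1)}"
    proof -
      have "set (q i) \<inter> A = \<phi> i ` {t. t < len i \<and> (t = 0 \<or> Suc t = len i)}"
        using A by (auto simp: q_def)
      also have "{t. t < len i \<and> (t = 0 \<or> Suc t = len i)} = {0, len i - 1}" using len by auto
      finally show ?thesis by simp
    qed
    moreover have "distinct (q i)" using inj by (auto simp: q_def distinct_map inj_on_def)
    moreover have "\<phi> i 0 \<noteq> \<phi> i (len i - 1)" using inj[of 0 "len i - 1"] len by auto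
    ultimately show "apath (q i)" using A adj unfolding apath_def
      by (auto simp: set_vwalk_arcs_nth q_def)
    show "length (q i) = len i" "len i \<le> Suc l" using len by (auto simp: q_def)
  qed
  have jumps_q: "jumps (q i) = \<phi> i ` {t. Suc t < len i \<and> \<phi> i t \<notin> M \<and> \<phi> i (Suc t) \<notin> M}" for i
    by (force simp: jumps_def set_vwalk_arcs_nth q_def)
  define N where "N i = free k len \<phi> {i}" for i
  have "\<exists>F. (\<forall>i\<in>{..<k}. F i \<subseteq> N i \<and> card (F i) = Suc l - len i) \<and>
             (\<forall>i\<in>{..<k}. \<forall>j\<in>{..<k}. i \<noteq> j \<longrightarrow> F i \<inter> F j = {})"
  proof (rule hall_with_multiplicities)
    fix X assume X: "X \<subseteq> {..<k}"
    have "(\<Union>i\<in>X. N i) = free k len \<phi> X" using X by (auto simp: N_def free_def)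
    moreover have "{i. i < k \<and> i \<in> X} = X" using X by auto
    ultimately show "(\<Sum>i\<in>X. Suc l - len i) \<le> card (\<Union>i\<in>X. N i)"
      using hall[of X] by (simp add: hall_def)
  qed (auto simp: N_def free_def)
  then obtain F where F: "\<And>i. i < k \<Longrightarrow> F i \<subseteq> N i \<and> card (F i) = Suc l - len i"
    "\<And>i j. i < k \<Longrightarrow> j < k \<Longrightarrow> i \<noteq> j \<Longrightarrow> F i \<inter> F j = {}" by (metis lessThan_iff)
  have finN: "finite (N i)" for i by (simp add: N_def free_def)
  have Nq: "N i \<inter> set (q j) = {}" if "j < k" for i j
    using that unfolding N_def free_def q_def by fastforce
  have "\<exists>p. apath p \<and> set p = set (q i) \<union> F i" if i: "i < k" for i
  proof (rule apath_fill)
    show "finite (F i)" using F(1)[OF i] finN finite_subset by blast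
    show "F i \<inter> M = {}" using F(1)[OF i] by (auto simp: N_def free_def)
    show "F i \<inter> set (q i) = {}" using F(1)[OF i] Nq[OF i, of i] by blast
    show "\<forall>v\<in>F i. \<exists>u\<in>jumps (q i). adj u v"
      using F(1)[OF i] by (auto simp: N_def free_def jumps_q)
  qed (use q i in auto)
  then obtain p where p: "\<And>i. i < k \<Longrightarrow> apath (p i) \<and> set (p i) = set (q i) \<union> F i" by metis
  have "length (p i) = Suc l" if i: "i < k" for i
  proof -
    have "length (p i) = card (set (q i) \<union> F i)"
      using p[OF i] by (metis apath_def distinct_card)
    also have "\<dots> = card (set (q i)) + card (F i)"
      using F(1)[OF i] Nq[OF i, of i] finN[of i] by (intro card_Un_disjoint) (auto intro: finite_subset)
    also have "card (set (q i)) = len i" using q[OF i] by (metis apath_def distinct_card)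
    finally show ?thesis using F(1)[OF i] q[OF i] by simp
  qed
  moreover have "set (p i) \<inter> set (p j) = {}" if ij: "i < k" "j < k" "i \<noteq> j" for i j
  proof -
    have "set (q i) \<inter> set (q j) = {}"
      using sk ij by (auto simp: skeleton_def q_def)
    then show ?thesis
      using p[OF ij(1)] p[OF ij(2)] F(1)[OF ij(1)] F(1)[OF ij(2)] F(2)[OF ij] Nq[OF ij(1)] Nq[OF ij(2)] by blast
  qed
  ultimately show ?thesis unfolding packing_def using p by blast
qed

lemma apath_A_nth:
  assumes "apath p" "t < length p"
  shows "p ! t \<in> A \<longleftrightarrow> t = 0 \<or> Suc t = length p"
proof -
  have d: "distinct p" and A: "set p \<inter> A = {hd p, last p}" using assms(1) by (auto simp: apath_def)
  have ne: "p \<noteq> []" using assms(2) by auto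
  have "p ! t \<in> A \<longleftrightarrow> p ! t = p ! 0 \<or> p ! t = p ! (length p - 1)"
    using A nth_mem[OF assms(2)] unfolding hd_conv_nth[OF ne] last_conv_nth[OF ne] by blast
  also have "\<dots> \<longleftrightarrow> t = 0 \<or> t = length p - 1"
    using d assms(2) ne by (simp add: nth_eq_iff_index_eq)
  finally show ?thesis using assms(2) by auto
qed

text \<open>The vertices deleted in the reduction form a disjoint system of fillers and so prove
  Hall's condition. The length bound adds up \<open>reduced_length\<close>: disjoint paths have
  disjoint intersections with \<open>M\<close>.\<close>

lemma packing_imp_valid:
  assumes "packing k l"
  shows "\<exists>len \<phi>. valid k l len \<phi> \<and> (\<Sum>i<k. len i) \<le> 3 * card M \<and>
    (\<forall>i<k. \<forall>t. Suc (Suc t) < len i \<longrightarrow> \<phi> i t \<in> M \<or> \<phi> i (Suc t) \<in> M \<or> \<phi> i (Suc (Suc t)) \<in> M)"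
proof -
  from assms obtain p where p: "\<And>i. i < k \<Longrightarrow> apath (p i) \<and> length (p i) = Suc l"
    "\<And>i j. i < k \<Longrightarrow> j < k \<Longrightarrow> i \<noteq> j \<Longrightarrow> set (p i) \<inter> set (p j) = {}"
    unfolding packing_def by metis
  have "\<forall>i. \<exists>q F. i < k \<longrightarrow> apath q \<and> reduced q \<and> set (p i) = set q \<union> F \<and> F \<inter> set q = {} \<and> F \<inter> M = {} \<and>
     (\<forall>v\<in>F. \<exists>u\<in>jumps q. adj u v)"
    using p(1) apath_reduce by meson
  then obtain q F where q: "\<And>i. i < k \<Longrightarrow> apath (q i) \<and> reduced (q i) \<and> set (p i) = set (q i) \<union> F i \<and>
      F i \<inter> set (q i) = {} \<and> F i \<inter> M = {} \<and> (\<forall>v\<in>F i. \<exists>u\<in>jumps (q i). adj u v)"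
    by metis
  define len where "len i = length (q i)" for i
  define \<phi> where "\<phi> i t = q i ! t" for i t
  have dis: "set (q i) \<inter> set (q j) = {}" "F i \<inter> F j = {}" "F i \<inter> set (q j) = {}"
    if "i < k" "j < k" "i \<noteq> j" for i j
    using p(2)[OF that] q[OF that(1)] q[OF that(2)] by auto
  have Fq: "F i \<inter> set (q j) = {}" if "i < k" "j < k" for i j
    using dis[OF that] q[OF that(1)] by (cases "i = j") auto
  have finF: "finite (F i)" if "i < k" for i
    using q[OF that] by (metis List.finite_set finite_Un)
  have cF: "card (F i) = Suc l - len i" "len i \<le> Suc l" if i: "i < k" for i
  proof -
    have "Suc l = card (set (q i) \<union> F i)"
      using p(1)[OF i] q[OF i] by (metis apath_def distinct_card)
    also have "\<dots> = card (set (q i)) + card (F i)"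
      using q[OF i] finF[OF i] by (intro card_Un_disjoint) auto
    also have "card (set (q i)) = len i" using q[OF i] by (metis apath_def distinct_card len_def)
    finally show "card (F i) = Suc l - len i" "len i \<le> Suc l" by auto
  qed
  have len2: "2 \<le> len i" if "i < k" for i
  proof -
    have "q i \<noteq> []" "hd (q i) \<noteq> last (q i)" using q[OF that] by (auto simp: apath_def)
    then show ?thesis by (cases "q i"; cases "tl (q i)") (auto simp: len_def)
  qed
  have "skeleton k l len \<phi>" unfolding skeleton_def
  proof (intro conjI allI impI)
    fix i t assume it: "i < k" "t < len i"
    have "set (q i) \<subseteq> {..<n}" using q[OF it(1)] by (auto simp: apath_def)
    then show "\<phi> i t < n" using it nth_mem[of t "q i"] unfolding \<phi>_def len_def by blast
    show "\<phi> i t \<in> A \<longleftrightarrow> t = 0 \<or> Suc t = len i"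
      using q[OF it(1)] it apath_A_nth by (auto simp: \<phi>_def len_def)
    show "adj (\<phi> i t) (\<phi> i (Suc t))" if "Suc t < len i"
      using q[OF it(1)] that by (auto simp: apath_def \<phi>_def len_def set_vwalk_arcs_nth)
    fix j u assume ju: "j < k" "u < len j" "\<phi> i t = \<phi> j u"
    then have "\<phi> i t \<in> set (q i) \<inter> set (q j)"
      using it nth_mem[of t "q i"] nth_mem[of u "q j"] unfolding \<phi>_def len_def by simp
    then show "i = j" using dis(1) it ju by blast
    then show "t = u" using q[OF it(1)] it ju by (auto simp: apath_def \<phi>_def len_def nth_eq_iff_index_eq)
  qed (use cF len2 in auto)
  moreover have "hall k l len \<phi> X" for X
  proof -
    let ?X = "{i. i < k \<and> i \<in> X}"
    have "(\<Sum>i\<in>?X. Suc l - len i) = (\<Sum>i\<in>?X. card (F i))" using cF by (intro sum.cong) auto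
    also have "\<dots> = card (\<Union>i\<in>?X. F i)"
      using finF dis by (intro card_UN_disjoint[symmetric]) auto
    also have "\<dots> \<le> card (free k len \<phi> X)"
    proof (rule card_mono)
      show "(\<Union>i\<in>?X. F i) \<subseteq> free k len \<phi> X"
      proof
        fix v assume "v \<in> (\<Union>i\<in>?X. F i)"
        then obtain i where i: "i < k" "i \<in> X" "v \<in> F i" by auto
        have "v \<notin> M" using q[OF i(1)] i by auto
        moreover have "\<forall>j<k. \<forall>t<len j. \<phi> j t \<noteq> v"
          using Fq[OF i(1)] i(3) unfolding \<phi>_def len_def by (meson disjoint_iff nth_mem)
        moreover obtain u where u: "u \<in> jumps (q i)" "adj u v" using q[OF i(1)] i by auto
        moreover have "v < n" using u adj_bound adj_sym by blast
        ultimately show "v \<in> free k len \<phi> X"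
          using i by (auto simp: free_def jumps_def set_vwalk_arcs_nth \<phi>_def len_def) (metis Suc_lessD)
      qed
    qed (simp add: free_def)
    finally show ?thesis by (simp add: hall_def)
  qed
  ultimately have "valid k l len \<phi>" by (simp add: valid_def)
  moreover have "(\<Sum>i<k. len i) \<le> 3 * card M"
  proof -
    have "len i \<le> 3 * card (M \<inter> set (q i))" if i: "i < k" for i
    proof -
      have "q i \<noteq> []" using len2[OF i] by (auto simp: len_def)
      moreover have "last (q i) \<in> M" using q[OF i] A_sub by (auto simp: apath_def)
      ultimately have "len i \<le> 3 * length (filter (\<lambda>v. v \<in> M) (q i))"
        using q[OF i] reduced_length by (simp add: len_def)
      then show ?thesis using q[OF i] by (simp add: apath_def distinct_length_filter)
    qed
    then have "(\<Sum>i<k. len i) \<le> (\<Sum>i<k. 3 * card (M \<inter> set (q i)))" by (intro sum_mono) auto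
    also have "\<dots> = 3 * card (\<Union>i<k. M \<inter> set (q i))"
      using dis(1) by (subst card_UN_disjoint) (auto simp: sum_distrib_left)
    also have "\<dots> \<le> 3 * card M" using finite_M by (auto intro!: card_mono)
    finally show ?thesis .
  qed
  moreover have "\<forall>i<k. \<forall>t. Suc (Suc t) < len i \<longrightarrow> \<phi> i t \<in> M \<or> \<phi> i (Suc t) \<in> M \<or> \<phi> i (Suc (Suc t)) \<in> M"
    using q by (auto simp: reduced_def \<phi>_def len_def)
  ultimately show ?thesis by blast
qed

section \<open>Exchanging vertices outside the modulator\<close>

definition slots :: "nat \<Rightarrow> (nat \<Rightarrow> nat) \<Rightarrow> (nat \<Rightarrow> nat \<Rightarrow> nat) \<Rightarrow> (nat \<times> nat) set" where
  "slots k len \<phi> = {(i, t). i < k \<and> t < len i \<and> \<phi> i t \<notin> M}"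

lemma finite_slots: "finite (slots k len \<phi>)"
proof -
  have "slots k len \<phi> \<subseteq> (SIGMA i:{..<k}. {..<len i})" by (auto simp: slots_def)
  then show ?thesis by (rule finite_subset) auto
qed

lemma card_slots: "card (slots k len \<phi>) \<le> (\<Sum>i<k. len i)"
proof -
  have "slots k len \<phi> \<subseteq> (SIGMA i:{..<k}. {..<len i})" by (auto simp: slots_def)
  then have "card (slots k len \<phi>) \<le> card (SIGMA i:{..<k}. {..<len i})" by (intro card_mono) auto
  then show ?thesis by simp
qed

text \<open>Expresses the number of fillers by the cliques alone: the total size of those with a
  jump of a path in \<open>X\<close>, minus the number of positions inside them. The latter counts
  the occupied vertices because a skeleton is injective.\<close>

lemma free_eq:
  assumes "skeleton k l len \<phi>"
  shows "card (free k len \<phi> X) =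
     card (\<Union>(i, t)\<in>{(i, t). i < k \<and> i \<in> X \<and> Suc t < len i \<and> \<phi> i t \<notin> M \<and> \<phi> i (Suc t) \<notin> M}. clique (\<phi> i t)) -
     card {(j, u) \<in> slots k len \<phi>. \<exists>i t. i < k \<and> i \<in> X \<and> Suc t < len i \<and> \<phi> i t \<notin> M \<and> \<phi> i (Suc t) \<notin> M \<and>
              sim (\<phi> i t) (\<phi> j u)}" (is "_ = card ?U - card ?S")
proof -
  let ?f = "\<lambda>(j, u). \<phi> j u"
  have inj: "inj_on ?f ?S" using assms by (auto simp: inj_on_def slots_def skeleton_def)
  have sub: "?f ` ?S \<subseteq> ?U"
  proof clarify
    fix j u i t
    assume s: "(j, u) \<in> slots k len \<phi>" and it: "i < k" "i \<in> X" "Suc t < len i" "\<phi> i t \<notin> M" "\<phi> i (Suc t) \<notin> M"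
      and sm: "sim (\<phi> i t) (\<phi> j u)"
    have "\<phi> j u < n" using s assms unfolding skeleton_def slots_def by blast
    then have "\<phi> j u \<in> clique (\<phi> i t)" using s sm by (auto simp: clique_def slots_def)
    then show "\<phi> j u \<in> ?U" using it by blast
  qed
  have "free k len \<phi> X = ?U - ?f ` ?S"
  proof (intro equalityI subsetI)
    fix v assume "v \<in> free k len \<phi> X"
    then obtain i t where v: "v < n" "v \<notin> M" "\<forall>i<k. \<forall>t<len i. \<phi> i t \<noteq> v"
      and it: "i < k" "i \<in> X" "Suc t < len i" "\<phi> i t \<notin> M" "\<phi> i (Suc t) \<notin> M" "adj (\<phi> i t) v"
      by (auto simp: free_def)
    have "v \<in> clique (\<phi> i t)" using v it by (simp add: clique_def sim_def)
    moreover have "v \<notin> ?f ` ?S" using v by (auto simp: slots_def)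
    ultimately show "v \<in> ?U - ?f ` ?S" using it by blast
  next
    fix v assume v: "v \<in> ?U - ?f ` ?S"
    then obtain i t where it: "i < k" "i \<in> X" "Suc t < len i" "\<phi> i t \<notin> M" "\<phi> i (Suc t) \<notin> M"
      and c: "v < n" "v \<notin> M" "sim (\<phi> i t) v" by (auto simp: clique_def)
    have nv: "\<phi> j u \<noteq> v" if "j < k" "u < len j" for j u
    proof
      assume "\<phi> j u = v"
      then have "(j, u) \<in> ?S" using that it c by (auto simp: slots_def)
      then show False using v \<open>\<phi> j u = v\<close> by force
    qed
    then have "adj (\<phi> i t) v" using it c by (auto simp: sim_def)
    then show "v \<in> free k len \<phi> X" using it c nv unfolding free_def by (simp, meson Suc_lessD)
  qed
  moreover have "finite ?S" using finite_slots[of k len \<phi>] by (rule rev_finite_subset) auto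
  ultimately have "card (free k len \<phi> X) = card ?U - card (?f ` ?S)"
    using sub by (simp add: card_Diff_subset)
  then show ?thesis using card_image[OF inj] by simp
qed

text \<open>Exchange principle, used twice: within a clique to lower ranks
  (\<open>small_rank\<close>), and to move whole groups to cliques at least as large
  (\<open>packing_imp_guess\<close>). By \<open>cls\<close> the same positions share a clique before
  and after, so in \<open>free_eq\<close> the subtracted term is unchanged while the union of the
  cliques does not shrink.\<close>

lemma valid_transfer:
  assumes v: "valid k l len \<phi>"
    and onM: "\<And>i t. i < k \<Longrightarrow> t < len i \<Longrightarrow> \<phi> i t \<in> M \<Longrightarrow> \<phi>' i t = \<phi> i t"
    and offM: "\<And>i t. (i, t) \<in> slots k len \<phi> \<Longrightarrow>
        \<phi>' i t \<notin> M \<and> \<phi>' i t < n \<and> card (clique (\<phi> i t)) \<le> card (clique (\<phi>' i t))"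
    and cls: "\<And>i t j u. (i, t) \<in> slots k len \<phi> \<Longrightarrow> (j, u) \<in> slots k len \<phi> \<Longrightarrow>
        sim (\<phi>' i t) (\<phi>' j u) \<longleftrightarrow> sim (\<phi> i t) (\<phi> j u)"
    and inj: "\<And>i t j u. (i, t) \<in> slots k len \<phi> \<Longrightarrow> (j, u) \<in> slots k len \<phi> \<Longrightarrow> \<phi>' i t = \<phi>' j u \<Longrightarrow> i = j \<and> t = u"
    and nxt: "\<And>i t. (i, t) \<in> slots k len \<phi> \<Longrightarrow> Suc t < len i \<Longrightarrow> \<phi> i (Suc t) \<in> M \<Longrightarrow> adj (\<phi>' i t) (\<phi> i (Suc t))"
    and prv: "\<And>i t. (i, Suc t) \<in> slots k len \<phi> \<Longrightarrow> \<phi> i t \<in> M \<Longrightarrow> adj (\<phi> i t) (\<phi>' i (Suc t))"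
  shows "valid k l len \<phi>'"
proof -
  have sk: "skeleton k l len \<phi>" and hall: "\<And>X. hall k l len \<phi> X" using v by (auto simp: valid_def)
  have M_iff: "\<phi>' i t \<in> M \<longleftrightarrow> \<phi> i t \<in> M" if "i < k" "t < len i" for i t
    using onM[OF that] offM[of i t] that by (auto simp: slots_def)
  have slots_eq: "slots k len \<phi>' = slots k len \<phi>" using M_iff by (auto simp: slots_def)
  have sk': "skeleton k l len \<phi>'"
    unfolding skeleton_def
  proof (intro conjI allI impI)
    fix i t assume it: "i < k" "t < len i"
    note skit = sk[unfolded skeleton_def, THEN conjunct1, rule_format, OF it(1), THEN conjunct2, THEN conjunct2, rule_format, OF it(2)]
    show "\<phi>' i t < n" using skit onM[OF it] offM[of i t] it by (cases "\<phi> i t \<in> M") (auto simp: slots_def)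
    show "\<phi>' i t \<in> A \<longleftrightarrow> t = 0 \<or> Suc t = len i"
      using skit onM[OF it] M_iff[OF it] A_sub by (cases "\<phi> i t \<in> M") auto
    show "adj (\<phi>' i t) (\<phi>' i (Suc t))" if t: "Suc t < len i"
    proof -
      have a: "adj (\<phi> i t) (\<phi> i (Suc t))" using skit t by simp
      consider "\<phi> i t \<in> M" "\<phi> i (Suc t) \<in> M" | "\<phi> i t \<in> M" "\<phi> i (Suc t) \<notin> M" |
        "\<phi> i t \<notin> M" "\<phi> i (Suc t) \<in> M" | "\<phi> i t \<notin> M" "\<phi> i (Suc t) \<notin> M" by blast
      then show ?thesis
      proof cases
        case 4
        then have s: "(i, t) \<in> slots k len \<phi>" "(i, Suc t) \<in> slots k len \<phi>" using it t by (auto simp: slots_def)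
        then have "sim (\<phi>' i t) (\<phi>' i (Suc t))" using cls a by (auto simp: sim_def)
        moreover have "\<phi>' i t \<noteq> \<phi>' i (Suc t)" using inj[OF s] by auto
        ultimately show ?thesis by (simp add: sim_def)
      qed (use onM it t a nxt prv in \<open>auto simp: slots_def\<close>)
    qed
    fix j u assume ju: "j < k" "u < len j" "\<phi>' i t = \<phi>' j u"
    have "i = j \<and> t = u"
    proof (cases "\<phi> i t \<in> M")
      case True
      then have "\<phi> j u \<in> M" using M_iff it ju by metis
      then have "\<phi> i t = \<phi> j u" using onM it ju True by metis
      then show ?thesis using sk it ju unfolding skeleton_def by blast
    next
      case False
      then have "\<phi> j u \<notin> M" using M_iff it ju by metis
      then show ?thesis using False it ju inj by (simp add: slots_def)
    qed
    then show "i = j" "t = u" by auto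
  qed (use sk in \<open>auto simp: skeleton_def\<close>)
  have "hall k l len \<phi>' X" for X
  proof -
    let ?T = "\<lambda>\<phi>. {(i, t). i < k \<and> i \<in> X \<and> Suc t < len i \<and> \<phi> i t \<notin> M \<and> \<phi> i (Suc t) \<notin> M}"
    have T: "?T \<phi>' = ?T \<phi>" using M_iff by auto
    have Ts: "?T \<phi> \<subseteq> slots k len \<phi>" by (auto simp: slots_def)
    have fT: "finite (?T \<phi>)" using Ts finite_slots finite_subset by blast
    have S: "{(j, u) \<in> slots k len \<phi>. \<exists>i t. i < k \<and> i \<in> X \<and> Suc t < len i \<and> \<phi>' i t \<notin> M \<and> \<phi>' i (Suc t) \<notin> M \<and>
              sim (\<phi>' i t) (\<phi>' j u)} =
        {(j, u) \<in> slots k len \<phi>. \<exists>i t. i < k \<and> i \<in> X \<and> Suc t < len i \<and> \<phi> i t \<notin> M \<and> \<phi> i (Suc t) \<notin> M \<and>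
              sim (\<phi> i t) (\<phi> j u)}" (is "?S' = ?S")
    proof -
      have "(i < k \<and> i \<in> X \<and> Suc t < len i \<and> \<phi>' i t \<notin> M \<and> \<phi>' i (Suc t) \<notin> M \<and> sim (\<phi>' i t) (\<phi>' j u)) \<longleftrightarrow>
          (i < k \<and> i \<in> X \<and> Suc t < len i \<and> \<phi> i t \<notin> M \<and> \<phi> i (Suc t) \<notin> M \<and> sim (\<phi> i t) (\<phi> j u))"
        if "(j, u) \<in> slots k len \<phi>" for i t j u
        using M_iff[of i t] M_iff[of i "Suc t"] cls[of i t j u] that by (auto simp: slots_def)
      then show ?thesis by blast
    qed
    have U: "card (\<Union>(i, t)\<in>?T \<phi>. clique (\<phi> i t)) \<le> card (\<Union>(i, t)\<in>?T \<phi>. clique (\<phi>' i t))"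
    proof (rule card_UN_mono_classes[OF fT])
      fix p assume "p \<in> ?T \<phi>"
      then show "finite (case p of (i, t) \<Rightarrow> clique (\<phi> i t)) \<and> finite (case p of (i, t) \<Rightarrow> clique (\<phi>' i t)) \<and>
          card (case p of (i, t) \<Rightarrow> clique (\<phi> i t)) \<le> card (case p of (i, t) \<Rightarrow> clique (\<phi>' i t))"
        using Ts offM by (cases p) auto
    next
      fix p q assume pq: "p \<in> ?T \<phi>" "q \<in> ?T \<phi>"
      obtain i t j u where e: "p = (i, t)" "q = (j, u)" by (cases p; cases q) auto
      have s: "(i, t) \<in> slots k len \<phi>" "(j, u) \<in> slots k len \<phi>" using pq Ts e by auto
      have nM: "\<phi> i t \<notin> M" "\<phi> j u \<notin> M" "\<phi>' i t \<notin> M" "\<phi>' j u \<notin> M"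
        using s offM[OF s(1)] offM[OF s(2)] by (auto simp: slots_def)
      show "(case p of (i, t) \<Rightarrow> clique (\<phi> i t)) = (case q of (i, t) \<Rightarrow> clique (\<phi> i t)) \<and>
          (case p of (i, t) \<Rightarrow> clique (\<phi>' i t)) = (case q of (i, t) \<Rightarrow> clique (\<phi>' i t)) \<or>
          (case p of (i, t) \<Rightarrow> clique (\<phi> i t)) \<inter> (case q of (i, t) \<Rightarrow> clique (\<phi> i t)) = {} \<and>
          (case p of (i, t) \<Rightarrow> clique (\<phi>' i t)) \<inter> (case q of (i, t) \<Rightarrow> clique (\<phi>' i t)) = {}"
        unfolding e prod.case
        using cls[OF s] nM clique_eq clique_disjoint by (cases "sim (\<phi> i t) (\<phi> j u)") blast+
    qed
    have "card (free k len \<phi> X) \<le> card (free k len \<phi>' X)"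
      unfolding free_eq[OF sk] free_eq[OF sk'] slots_eq T S using U by linarith
    then show ?thesis using hall[of X] by (simp add: hall_def)
  qed
  then show ?thesis using sk' by (simp add: valid_def)
qed

text \<open>On a sparse family a position outside \<open>M\<close> has a path neighbour in
  \<open>M\<close>, but perhaps on one side only; this neighbour then stands in for the other side
  too. Thus every such position carries exactly two adjacency constraints by vertices of
  \<open>M\<close>, which gives all positions the same number of digits.\<close>

definition next_M :: "(nat \<Rightarrow> nat \<Rightarrow> nat) \<Rightarrow> nat \<Rightarrow> nat \<Rightarrow> nat" where
  "next_M \<phi> i t = (if \<phi> i (Suc t) \<in> M then \<phi> i (Suc t) else \<phi> i (t - 1))"

definition prev_M :: "(nat \<Rightarrow> nat \<Rightarrow> nat) \<Rightarrow> nat \<Rightarrow> nat \<Rightarrow> nat" where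
  "prev_M \<phi> i t = (if \<phi> i (t - 1) \<in> M then \<phi> i (t - 1) else \<phi> i (Suc t))"

definition candidates :: "(nat \<Rightarrow> nat \<Rightarrow> nat) \<Rightarrow> nat \<Rightarrow> nat \<Rightarrow> nat set" where
  "candidates \<phi> i t = {u \<in> clique (\<phi> i t). adj (prev_M \<phi> i t) u \<and> adj (next_M \<phi> i t) u}"

definition sparse :: "nat \<Rightarrow> (nat \<Rightarrow> nat) \<Rightarrow> (nat \<Rightarrow> nat \<Rightarrow> nat) \<Rightarrow> bool" where
  "sparse k len \<phi> \<longleftrightarrow>
     (\<forall>i<k. \<forall>t. Suc (Suc t) < len i \<longrightarrow> \<phi> i t \<in> M \<or> \<phi> i (Suc t) \<in> M \<or> \<phi> i (Suc (Suc t)) \<in> M)"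

text \<open>Ends of paths are terminals and hence in \<open>M\<close>. This makes
  \<open>t - 1\<close> and \<open>Suc t\<close> genuine positions.\<close>

lemma slot_interior:
  assumes "skeleton k l len \<phi>" "(i, t) \<in> slots k len \<phi>"
  shows "0 < t" "Suc t < len i"
proof -
  have it: "i < k" "t < len i" "\<phi> i t \<notin> M" using assms(2) by (auto simp: slots_def)
  have "\<not> (t = 0 \<or> Suc t = len i)" using assms(1) it A_sub unfolding skeleton_def by blast
  then show "0 < t" "Suc t < len i" using it by auto
qed

lemma slot_next_prev:
  assumes sk: "skeleton k l len \<phi>" and sp: "sparse k len \<phi>" and s: "(i, t) \<in> slots k len \<phi>"
  shows "prev_M \<phi> i t \<in> M" "next_M \<phi> i t \<in> M" "\<phi> i t \<in> candidates \<phi> i t"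
proof -
  have it: "i < k" "t < len i" "\<phi> i t \<notin> M" using s by (auto simp: slots_def)
  note int = slot_interior[OF sk s]
  have t: "t = Suc (t - 1)" using int by simp
  have "\<phi> i (t - 1) \<in> M \<or> \<phi> i (Suc t) \<in> M"
    using sp it int t unfolding sparse_def by (metis)
  then show M: "prev_M \<phi> i t \<in> M" "next_M \<phi> i t \<in> M" by (auto simp: prev_M_def next_M_def)
  have "adj (\<phi> i t) (\<phi> i (Suc t))" "\<phi> i t < n" using sk it int unfolding skeleton_def by blast+
  moreover have "adj (\<phi> i (t - 1)) (\<phi> i t)" using sk it int t unfolding skeleton_def by (metis Suc_lessD)
  ultimately show "\<phi> i t \<in> candidates \<phi> i t"
    using it adj_sym by (auto simp: candidates_def clique_def prev_M_def next_M_def)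
qed

text \<open>Descent on the sum of all vertex numbers on the paths. If \<open>L\<close> candidates
  lie below \<open>\<phi> i t\<close>, one of them is not in use, and moving the position there
  keeps the clique and the neighbours in \<open>M\<close> while the sum drops.\<close>

lemma small_rank:
  assumes "valid k l len \<phi>" "sparse k len \<phi>" "(\<Sum>i<k. len i) \<le> L"
  shows "\<exists>\<phi>. valid k l len \<phi> \<and> sparse k len \<phi> \<and>
     (\<forall>(i, t)\<in>slots k len \<phi>. card {u \<in> candidates \<phi> i t. u < \<phi> i t} < L)"
  using assms(1,2)
proof (induction "\<Sum>(i, t)\<in>(SIGMA i:{..<k}. {..<len i}). \<phi> i t" arbitrary: \<phi> rule: less_induct)
  case less
  show ?case
  proof (cases "\<forall>(i, t)\<in>slots k len \<phi>. card {u \<in> candidates \<phi> i t. u < \<phi> i t} < L")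
    case True
    then show ?thesis using less.prems by blast
  next
    case False
    then obtain i t where s: "(i, t) \<in> slots k len \<phi>"
      and big: "L \<le> card {u \<in> candidates \<phi> i t. u < \<phi> i t}" by auto
    let ?B = "{u \<in> candidates \<phi> i t. u < \<phi> i t}"
    have sk: "skeleton k l len \<phi>" using less.prems by (simp add: valid_def)
    have it: "i < k" "t < len i" "\<phi> i t \<notin> M" using s by (auto simp: slots_def)
    let ?V = "(\<lambda>(j, u). \<phi> j u) ` slots k len \<phi>"
    have "\<phi> i t \<in> ?V" using s by force
    \<comment> \<open>At most \<open>L\<close> vertices outside \<open>M\<close> are in use, one of
      them \<open>\<phi> i t\<close> itself, so the others cannot cover \<open>L\<close> smaller
      candidates.\<close>
    have "card ?V \<le> L" using card_image_le[OF finite_slots] card_slots assms(3) by (meson le_trans)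
    then have "card (?V - {\<phi> i t}) < card ?B"
      using big card_Diff1_less[OF finite_imageI[OF finite_slots] \<open>\<phi> i t \<in> ?V\<close>] by linarith
    moreover have "finite (?V - {\<phi> i t})" by (intro finite_Diff finite_imageI finite_slots)
    ultimately have "\<not> ?B \<subseteq> ?V - {\<phi> i t}" by (meson card_mono not_less)
    then obtain u where "u \<in> ?B" "u \<notin> ?V - {\<phi> i t}" by (meson subsetI)
    then have u: "u \<in> candidates \<phi> i t" "u < \<phi> i t" "u \<notin> ?V" by simp_all
    have un: "u \<notin> M" "u < n" "sim (\<phi> i t) u" "adj (prev_M \<phi> i t) u" "adj (next_M \<phi> i t) u"
      using u(1) by (auto simp: candidates_def clique_def)
    define \<phi>' where "\<phi>' j r = (if j = i \<and> r = t then u else \<phi> j r)" for j r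
    have sims: "sim (\<phi>' j r) (\<phi> j r)" "\<phi>' j r \<notin> M" if "(j, r) \<in> slots k len \<phi>" for j r
      using un that sim_sym by (auto simp: \<phi>'_def slots_def)
    have "valid k l len \<phi>'"
    proof (rule valid_transfer[OF less.prems(1)])
      show "\<phi>' j r = \<phi> j r" if "\<phi> j r \<in> M" for j r using that it by (auto simp: \<phi>'_def)
      show "\<phi>' j r \<notin> M \<and> \<phi>' j r < n \<and> card (clique (\<phi> j r)) \<le> card (clique (\<phi>' j r))"
        if js: "(j, r) \<in> slots k len \<phi>" for j r
      proof -
        have "clique (\<phi>' j r) = clique (\<phi> j r)"
          using sims[OF js] js by (intro clique_eq) (auto simp: slots_def)
        moreover have "\<phi>' j r < n" using js sk un by (auto simp: \<phi>'_def slots_def skeleton_def)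
        ultimately show ?thesis using sims[OF js] by simp
      qed
      fix j r j' r' assume jr: "(j, r) \<in> slots k len \<phi>" "(j', r') \<in> slots k len \<phi>"
      have nM: "\<phi> j r \<notin> M" "\<phi> j' r' \<notin> M" using jr by (auto simp: slots_def)
      show "sim (\<phi>' j r) (\<phi>' j' r') \<longleftrightarrow> sim (\<phi> j r) (\<phi> j' r')"
        using sims[OF jr(1)] sims[OF jr(2)] nM by (meson sim_sym sim_trans)
      show "j = j' \<and> r = r'" if eq: "\<phi>' j r = \<phi>' j' r'"
      proof (cases "(j = i \<and> r = t) \<noteq> (j' = i \<and> r' = t)")
        case True
        then have "u \<in> ?V" using eq jr by (auto simp: \<phi>'_def split: if_splits)
        then show ?thesis using u by simp
      next
        case False
        then show ?thesis using eq jr sk unfolding \<phi>'_def slots_def skeleton_def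
          by (auto split: if_splits)
      qed
    next
      show "adj (\<phi>' j r) (\<phi> j (Suc r))" if "(j, r) \<in> slots k len \<phi>" "Suc r < len j" "\<phi> j (Suc r) \<in> M" for j r
      proof (cases "j = i \<and> r = t")
        case True
        then show ?thesis using that un adj_sym by (auto simp: \<phi>'_def next_M_def)
      next
        case False
        then show ?thesis using that sk by (auto simp: \<phi>'_def slots_def skeleton_def)
      qed
      show "adj (\<phi> j r) (\<phi>' j (Suc r))" if "(j, Suc r) \<in> slots k len \<phi>" "\<phi> j r \<in> M" for j r
      proof (cases "j = i \<and> Suc r = t")
        case True
        then show ?thesis using that un by (auto simp: \<phi>'_def prev_M_def)
      next
        case False
        then show ?thesis using that sk by (auto simp: \<phi>'_def slots_def skeleton_def)
      qed
    qed
    moreover have "sparse k len \<phi>'"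
      using less.prems(2) it unfolding sparse_def \<phi>'_def by (metis un(1))
    moreover have "(\<Sum>(i, t)\<in>(SIGMA i:{..<k}. {..<len i}). \<phi>' i t) < (\<Sum>(i, t)\<in>(SIGMA i:{..<k}. {..<len i}). \<phi> i t)"
      using it u(2) by (intro sum_strict_mono_ex1) (auto simp: \<phi>'_def intro!: bexI[of _ "(i, t)"])
    ultimately show ?thesis using less.hyps by blast
  qed
qed

text \<open>Position \<open>t\<close> of path \<open>i\<close> has number \<open>p = i * L + t\<close>. Its digits \<open>5 * p, \<dots>, 5 * p + 3\<close> are the
  group, the indices (in the list \<open>ml\<close> of \<open>M\<close>) of two neighbours, and the rank. Group \<open>L\<close> means that the
  vertex lies in \<open>M\<close> and is given by the first index. Digit \<open>5 * (i * L) + 4\<close> is the length of path \<open>i\<close>.\<close>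
definition cand :: "(nat \<Rightarrow> nat) \<Rightarrow> (nat \<Rightarrow> nat) \<Rightarrow> nat \<Rightarrow> nat \<Rightarrow> nat \<Rightarrow> bool" where
  "cand ml D c p u \<longleftrightarrow> u \<notin> M \<and> sim c u \<and> adj (ml (D (5 * p + 1))) u \<and> adj (ml (D (5 * p + 2))) u"

text \<open>Ranks count from 0 in the numerical order of the candidates, so position and clique
  determine the vertex (\<open>embeds_unique\<close>).\<close>

definition embeds :: "(nat \<Rightarrow> nat) \<Rightarrow> (nat \<Rightarrow> nat) \<Rightarrow> nat \<Rightarrow> nat \<Rightarrow> nat \<Rightarrow> bool" where
  "embeds ml D c p v \<longleftrightarrow> cand ml D c p v \<and> card {u. u < v \<and> cand ml D c p u} = D (5 * p + 3)"

text \<open>As digits and clique already determine each vertex, no search is involved: the vertices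
  of the group have to exist and to be distinct. A group without positions is feasible in every
  clique.\<close>

definition feasible :: "(nat \<Rightarrow> nat) \<Rightarrow> (nat \<Rightarrow> nat) \<Rightarrow> nat \<Rightarrow> nat \<Rightarrow> nat \<Rightarrow> bool" where
  "feasible ml D L c g \<longleftrightarrow> c \<notin> M \<and> (\<forall>p<L*L. D (5 * p) = g \<longrightarrow>
     (\<exists>v<n. embeds ml D c p v \<and> (\<forall>p'<L*L. D (5 * p') = g \<and> p' \<noteq> p \<longrightarrow> \<not> embeds ml D c p' v)))"

definition eligible :: "(nat \<Rightarrow> nat) \<Rightarrow> (nat \<Rightarrow> nat) \<Rightarrow> nat \<Rightarrow> (nat \<Rightarrow> nat) \<Rightarrow> nat \<Rightarrow> nat \<Rightarrow> bool" where
  "eligible ml D L rep c g \<longleftrightarrow> feasible ml D L c g \<and> (\<forall>h<g. \<not> sim c (rep h))"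

text \<open>Vertices are compared by the size of their clique; the second summand breaks ties.\<close>
definition key :: "nat \<Rightarrow> nat" where
  "key c = n * card (clique c) + c"

text \<open>The implication form holds for every guess: if no vertex is eligible,
  \<open>rep g\<close> is arbitrary. \<open>placed\<close> has the same form for the same reason;
  failures are caught by the final check.\<close>

definition greedy :: "(nat \<Rightarrow> nat) \<Rightarrow> (nat \<Rightarrow> nat) \<Rightarrow> nat \<Rightarrow> (nat \<Rightarrow> nat) \<Rightarrow> bool" where
  "greedy ml D L rep \<longleftrightarrow> (\<forall>g<L. \<forall>c<n. eligible ml D L rep c g \<and>
      (\<forall>c'<n. eligible ml D L rep c' g \<longrightarrow> key c' \<le> key c) \<longrightarrow> rep g = c)"

definition placed :: "(nat \<Rightarrow> nat) \<Rightarrow> (nat \<Rightarrow> nat) \<Rightarrow> nat \<Rightarrow> (nat \<Rightarrow> nat) \<Rightarrow> (nat \<Rightarrow> nat) \<Rightarrow> bool" where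
  "placed ml D L rep ph \<longleftrightarrow> (\<forall>p<L*L. if D (5 * p) = L then ph p = ml (D (5 * p + 1))
      else \<forall>v<n. embeds ml D (rep (D (5 * p))) p v \<longrightarrow> ph p = v)"

section \<open>Completeness of the greedy assignment\<close>

lemma key_inj: "c < n \<Longrightarrow> c' < n \<Longrightarrow> key c = key c' \<Longrightarrow> c = c'"
  unfolding key_def by (metis mod_less mod_mult_self4)

lemma key_mono: "c < n \<Longrightarrow> c' < n \<Longrightarrow> key c \<le> key c' \<Longrightarrow> card (clique c) \<le> card (clique c')"
proof (rule ccontr)
  assume a: "c < n" "c' < n" "key c \<le> key c'" "\<not> card (clique c) \<le> card (clique c')"
  then have "n * Suc (card (clique c')) \<le> n * card (clique c)" by (intro mult_le_mono2) simp
  then show False using a by (simp add: key_def)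
qed

lemma embeds_unique: "embeds ml D c p v \<Longrightarrow> embeds ml D c p w \<Longrightarrow> v = w"
proof (induction v w rule: linorder_wlog)
  case (le v w)
  show ?case
  proof (rule ccontr)
    assume "v \<noteq> w"
    then have "insert v {u. u < v \<and> cand ml D c p u} \<subseteq> {u. u < w \<and> cand ml D c p u}"
      using le by (auto simp: embeds_def)
    then have "card (insert v {u. u < v \<and> cand ml D c p u}) \<le> card {u. u < w \<and> cand ml D c p u}"
      by (intro card_mono) auto
    then show False using le by (simp add: embeds_def)
  qed
qed auto

text \<open>Canonical vertex of the clique of some \<open>u\<close> outside \<open>M\<close>. Clique
  sizes agree within a clique, so it is the vertex with the largest number; its \<open>key\<close>
  bounds that of any representative a greedy choice could take in this clique.\<close>

definition apex :: "nat \<Rightarrow> nat" where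
  "apex u = (SOME c. c \<in> clique u \<and> (\<forall>c'\<in>clique u. key c' \<le> key c))"

lemma apex:
  assumes "u < n" "u \<notin> M"
  shows "apex u \<in> clique u" "\<And>c. c \<in> clique u \<Longrightarrow> key c \<le> key (apex u)"
proof -
  have "u \<in> clique u" using assms by (simp add: clique_def)
  then have "Max (key ` clique u) \<in> key ` clique u" by (intro Max_in) auto
  then obtain c where c: "c \<in> clique u" "key c = Max (key ` clique u)" by auto
  then have "\<exists>c. c \<in> clique u \<and> (\<forall>c'\<in>clique u. key c' \<le> key c)" by (intro exI[of _ c]) auto
  from someI_ex[OF this] show "apex u \<in> clique u" "\<And>c. c \<in> clique u \<Longrightarrow> key c \<le> key (apex u)"
    unfolding apex_def by blast+
qed

lemma apex_sim:
  assumes "u < n" "u \<notin> M" "v < n" "v \<notin> M"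
  shows "apex u = apex v \<longleftrightarrow> sim u v"
proof
  assume "sim u v"
  then have "clique u = clique v" using assms clique_eq by blast
  then show "apex u = apex v" by (simp add: apex_def)
next
  assume "apex u = apex v"
  then have "apex u \<in> clique u \<inter> clique v"
    using apex(1)[of u] apex(1)[of v] assms by auto
  then show "sim u v" using assms clique_disjoint by blast
qed

text \<open>Rank 0 belongs to the largest value. Distinct values have distinct ranks below
  \<open>card R\<close>, and there are \<open>card R\<close> of them.\<close>

lemma rank_surj:
  fixes f :: "'a \<Rightarrow> nat"
  assumes "finite R" "inj_on f R"
  shows "(\<lambda>c. card {c'\<in>R. f c < f c'}) ` R = {..<card R}"
proof -
  let ?r = "\<lambda>c. card {c'\<in>R. f c < f c'}"
  have less: "?r c < ?r d" if "c \<in> R" "d \<in> R" "f d < f c" for c d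
    using that assms(1) by (intro psubset_card_mono) auto
  have "inj_on ?r R"
  proof (rule inj_onI)
    fix c d assume cd: "c \<in> R" "d \<in> R" "?r c = ?r d"
    then have "f c = f d" using less[of c d] less[of d c] by (metis linorder_neqE_nat nat_neq_iff)
    then show "c = d" using assms(2) cd by (auto simp: inj_on_def)
  qed
  moreover have "?r ` R \<subseteq> {..<card R}"
    using assms(1) by (auto intro!: psubset_card_mono)
  ultimately show ?thesis
    by (intro card_subset_eq) (auto simp: card_image)
qed

text \<open>The digits describe a solution of small ranks whose groups are numbered by decreasing
  \<open>key\<close> of their cliques. When group \<open>g\<close> chooses, its clique in the
  solution is still available, because each earlier group took a clique with a larger
  \<open>key\<close>; so the choice is at least as large. \<open>valid_transfer\<close> then moves
  the solution to the chosen cliques.\<close>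

lemma packing_imp_guess:
  assumes pk: "packing k l" and L: "L = 3 * card M" and ml: "\<And>x. x \<in> M \<Longrightarrow> \<exists>a<card M. ml a = x"
  shows "k \<le> L \<and> (\<exists>D. (\<forall>x. D x \<le> L) \<and> (\<forall>rep ph. greedy ml D L rep \<longrightarrow> placed ml D L rep ph \<longrightarrow>
     valid k l (\<lambda>i. D (5 * (i * L) + 4)) (\<lambda>i t. ph (i * L + t)) \<and> (\<forall>i<k. D (5 * (i * L) + 4) \<le> L)))"
proof -
  from packing_imp_valid[OF pk] obtain len \<phi>0 where v0: "valid k l len \<phi>0" "sparse k len \<phi>0"
    and sum: "(\<Sum>i<k. len i) \<le> L" unfolding sparse_def L by auto
  from small_rank[OF v0 sum] obtain \<phi> where v: "valid k l len \<phi>" and sp: "sparse k len \<phi>"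
    and rank: "\<And>i t. (i, t) \<in> slots k len \<phi> \<Longrightarrow> card {u \<in> candidates \<phi> i t. u < \<phi> i t} < L" by blast
  have sk: "skeleton k l len \<phi>" using v by (simp add: valid_def)
  have len2: "2 \<le> len i" if "i < k" for i using sk that by (auto simp: skeleton_def)
  have lenL: "len i \<le> L" if "i < k" for i
    using member_le_sum[of i "{..<k}" len] that sum by auto
  have "k \<le> (\<Sum>i<k. len i)"
    using sum_mono[of "{..<k}" "\<lambda>_. 1" len] len2 by fastforce
  then have kL: "k \<le> L" using sum by simp
  define S where "S = slots k len \<phi>"
  have S: "i < k" "t < len i" "t < L" "\<phi> i t \<notin> M" "\<phi> i t < n" if "(i, t) \<in> S" for i t
    using that lenL[of i] sk by (auto simp: S_def slots_def skeleton_def)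
  define R where "R = (\<lambda>(i, t). apex (\<phi> i t)) ` S"
  have finS: "finite S" by (simp add: S_def finite_slots)
  have finR: "finite R" by (simp add: R_def finS)
  have "card R \<le> card S" unfolding R_def by (rule card_image_le[OF finS])
  also have "\<dots> \<le> L" using card_slots sum unfolding S_def by (rule le_trans)
  finally have cR: "card R \<le> L" .
  have apexS: "apex (\<phi> i t) \<in> clique (\<phi> i t)" "apex (\<phi> i t) \<in> R" if "(i, t) \<in> S" for i t
    using apex(1)[OF S(5,4)[OF that]] that by (auto simp: R_def)
  have R: "c < n" "c \<notin> M" if "c \<in> R" for c
    using that apexS by (auto simp: R_def clique_def)
  have injR: "inj_on key R" using key_inj R by (auto simp: inj_on_def)
  define rk where "rk c = card {c'\<in>R. key c < key c'}" for c
  \<comment> \<open>The groups in use form an initial segment. This matters because a group without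
    positions takes a clique as well; all such groups now choose after the others.\<close>
  have rk_img: "rk ` R = {..<card R}" unfolding rk_def by (rule rank_surj[OF finR injR])
  have rkL: "rk c < L" if "c \<in> R" for c
  proof -
    have "rk c \<in> {..<card R}" using rk_img that by blast
    then show ?thesis using cR by simp
  qed
  have rk_less: "rk c < rk d" if "c \<in> R" "d \<in> R" "key d < key c" for c d
    unfolding rk_def using that finR by (intro psubset_card_mono) auto
  have rk_mono: "rk c < rk d \<Longrightarrow> key d < key c" if "c \<in> R" "d \<in> R" for c d
    using rk_less[OF that(2,1)] that injR by (metis inj_onD less_asym linorder_neqE_nat)
  have rk_inj: "c = d" if "c \<in> R" "d \<in> R" "rk c = rk d" for c d
    using rk_less[OF that(1,2)] rk_less[OF that(2,1)] that injR by (metis inj_onD linorder_neqE_nat nat_neq_iff)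
  define ix where "ix x = (SOME a. a < card M \<and> ml a = x)" for x
  have ix: "ix x < card M" "ml (ix x) = x" if "x \<in> M" for x
    using someI_ex[OF ml[OF that, unfolded Bex_def]] by (auto simp: ix_def)
  \<comment> \<open>Positions on no path get group \<open>L\<close>, like vertices of
    \<open>M\<close>, and so constrain no clique. Digit 4 is read only at \<open>t = 0\<close>,
    which satisfies \<open>t < len i\<close> because every path has at least two vertices.\<close>
  define dig where "dig i t j = (if i < k \<and> t < len i then
      if j = 4 then len i else if \<phi> i t \<in> M then (if j = 0 then L else if j = 1 then ix (\<phi> i t) else 0)
      else if j = 0 then rk (apex (\<phi> i t)) else if j = 1 then ix (prev_M \<phi> i t)
      else if j = 2 then ix (next_M \<phi> i t) else card {u \<in> candidates \<phi> i t. u < \<phi> i t}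
    else if j = 0 then L else 0)" for i t j :: nat
  define D where "D x = dig (x div 5 div L) (x div 5 mod L) (x mod 5)" for x
  have dig_le: "dig i t j \<le> L" for i t j
  proof (cases "i < k \<and> t < len i \<and> \<phi> i t \<notin> M")
    case True
    then have s: "(i, t) \<in> S" by (auto simp: S_def slots_def)
    have "ix (prev_M \<phi> i t) < card M" "ix (next_M \<phi> i t) < card M"
      using slot_next_prev[OF sk sp s[unfolded S_def]] ix by auto
    then show ?thesis using True lenL[of i] rank[OF s[unfolded S_def]] rkL[OF apexS(2)[OF s]] L
      by (auto simp: dig_def)
  next
    case False
    then show ?thesis using lenL[of i] ix(1)[of "\<phi> i t"] L by (auto simp: dig_def)
  qed
  then have D_le: "D x \<le> L" for x by (simp add: D_def)
  have D: "D (5 * (i * L + t) + j) = dig i t j" if "t < L" "j < 5" for i t j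
  proof -
    have "(5 * q + j) div 5 = q" "(5 * q + j) mod 5 = j" for q using that by auto
    note this[of "i * L + t"]
    then show ?thesis using that by (simp add: D_def)
  qed
  have D0: "D (5 * p) = dig (p div L) (p mod L) 0" for p by (simp add: D_def)
  have DS: "D (5 * (i * L + t)) = rk (apex (\<phi> i t))" "D (5 * (i * L + t) + 1) = ix (prev_M \<phi> i t)"
    "D (5 * (i * L + t) + 2) = ix (next_M \<phi> i t)"
    "D (5 * (i * L + t) + 3) = card {u \<in> candidates \<phi> i t. u < \<phi> i t}" if "(i, t) \<in> S" for i t
    using D[OF S(3)[OF that], of 0 i] D[OF S(3)[OF that], of 1 i] D[OF S(3)[OF that], of 2 i]
      D[OF S(3)[OF that], of 3 i] S[OF that] by (simp_all add: dig_def)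
  have pos: "i * L + t < L * L" if "i < k" "t < L" for i t
  proof -
    have "i * L + t < Suc i * L" using that by simp
    also have "\<dots> \<le> L * L" using that kL by (intro mult_le_mono1) simp
    finally show ?thesis .
  qed
  have slot_of: "\<exists>i t. p = i * L + t \<and> (i, t) \<in> S \<and> rk (apex (\<phi> i t)) = g" if "D (5 * p) = g" "g < L" for p g
  proof -
    have *: "p div L < k" "p mod L < len (p div L)" "\<phi> (p div L) (p mod L) \<notin> M"
      using that unfolding D0 dig_def by (auto split: if_splits)
    then have "(p div L, p mod L) \<in> S" by (auto simp: S_def slots_def)
    moreover have "rk (apex (\<phi> (p div L) (p mod L))) = g" using that * unfolding D0 dig_def by simp
    ultimately show ?thesis by (intro exI[of _ "p div L"] exI[of _ "p mod L"]) simp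
  qed
  have cand_iff: "cand ml D c (i * L + t) u \<longleftrightarrow> u \<in> candidates \<phi> i t"
    if s: "(i, t) \<in> S" and c: "c = apex (\<phi> i t)" for i t c u
  proof -
    have cc: "clique c = clique (\<phi> i t)"
      using apexS(1)[OF s] S[OF s] sim_sym by (intro clique_eq) (auto simp: c clique_def)
    have "ml (ix (prev_M \<phi> i t)) = prev_M \<phi> i t" "ml (ix (next_M \<phi> i t)) = next_M \<phi> i t"
      using slot_next_prev[OF sk sp s[unfolded S_def]] ix by auto
    then show ?thesis using adj_bound adj_sym
      unfolding cand_def candidates_def cc[symmetric] DS[OF s] by (auto simp: clique_def)
  qed
  have emb: "embeds ml D (apex (\<phi> i t)) (i * L + t) (\<phi> i t)" if s: "(i, t) \<in> S" for i t
    using slot_next_prev(3)[OF sk sp s[unfolded S_def]]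
    unfolding embeds_def cand_iff[OF s refl] DS[OF s] by (auto intro: arg_cong[where f = card])
  have injS: "i = j \<and> t = u" if "(i, t) \<in> S" "(j, u) \<in> S" "\<phi> i t = \<phi> j u" for i t j u
    using S[OF that(1)] S[OF that(2)] that(3) sk unfolding skeleton_def by blast
  have feas: "feasible ml D L c (rk c)" if "c \<in> R" for c
    unfolding feasible_def
  proof (intro conjI allI impI)
    show "c \<notin> M" using R that by simp
    fix p assume p: "p < L * L" "D (5 * p) = rk c"
    from slot_of[OF p(2) rkL[OF that]] obtain i t where it: "p = i * L + t" "(i, t) \<in> S" "rk (apex (\<phi> i t)) = rk c"
      by blast
    then have c: "apex (\<phi> i t) = c" using rk_inj apexS that by blast
    have "\<not> embeds ml D c p' (\<phi> i t)" if p': "D (5 * p') = rk c \<and> p' \<noteq> p" for p'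
    proof
      assume e: "embeds ml D c p' (\<phi> i t)"
      from slot_of[OF _ rkL[OF \<open>c \<in> R\<close>]] p' obtain j u where
        ju: "p' = j * L + u" "(j, u) \<in> S" "rk (apex (\<phi> j u)) = rk c" by blast
      then have c': "apex (\<phi> j u) = c" using rk_inj apexS \<open>c \<in> R\<close> by blast
      have "\<phi> j u = \<phi> i t" using embeds_unique[OF emb[OF ju(2)]] e c' ju(1) by blast
      then show False using injS[OF ju(2) it(2)] p' it(1) ju(1) by blast
    qed
    then show "\<exists>v<n. embeds ml D c p v \<and> (\<forall>p'<L * L. D (5 * p') = rk c \<and> p' \<noteq> p \<longrightarrow> \<not> embeds ml D c p' v)"
      using emb[OF it(2)] c it(1) S[OF it(2)] by blast
  qed
  have main: "valid k l (\<lambda>i. D (5 * (i * L) + 4)) (\<lambda>i t. ph (i * L + t))"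
    if gr: "greedy ml D L rep" and pl: "placed ml D L rep ph" for rep ph
  proof -
    have rep: "rep g < n \<and> eligible ml D L rep (rep g) g \<and> key c \<le> key (rep g)"
      if "c \<in> R" "rk c = g" for g c
      using that
    proof (induction g arbitrary: c rule: less_induct)
      case (less g)
      have gL: "g < L" using less.prems rkL by blast
      \<comment> \<open>By induction \<open>rep h\<close> has at least the \<open>key\<close> of the
        clique numbered \<open>h\<close>, hence more than \<open>key c\<close>. As \<open>c\<close>
        is the apex of its clique, \<open>rep h\<close> lies outside that clique.\<close>
      have "\<not> sim c (rep h)" if h: "h < g" for h
      proof
        assume sm: "sim c (rep h)"
        have "h < card R" using h less.prems rk_img by (metis imageI lessThan_iff less_trans)
        then obtain d where d: "d \<in> R" "rk d = h" using rk_img by (metis imageE lessThan_iff)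
        have rh: "rep h < n" "rep h \<notin> M" "key d \<le> key (rep h)"
          using less.IH[OF h d] by (auto simp: eligible_def feasible_def)
        have "key c < key d" using rk_mono[OF d(1) less.prems(1)] d less.prems(2) h by simp
        obtain i t where it: "(i, t) \<in> S" "c = apex (\<phi> i t)" using less.prems(1) by (auto simp: R_def)
        have "sim (\<phi> i t) (rep h)"
          using apexS(1)[OF it(1)] sm S[OF it(1)] rh it(2) sim_trans[of "\<phi> i t" c "rep h"]
          by (auto simp: clique_def)
        then have "key (rep h) \<le> key c"
          using apex(2)[OF S(5,4)[OF it(1)]] rh it(2) by (auto simp: clique_def)
        then show False using rh(3) \<open>key c < key d\<close> by simp
      qed
      then have elc: "eligible ml D L rep c g" using feas less.prems by (auto simp: eligible_def)
      let ?E = "{c. c < n \<and> eligible ml D L rep c g}"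
      have cE: "c \<in> ?E" using elc R less.prems by auto
      have finE: "finite (key ` ?E)" by simp
      have "Max (key ` ?E) \<in> key ` ?E" using finE cE by (intro Max_in) auto
      then obtain d where d: "d \<in> ?E" "key d = Max (key ` ?E)" by auto
      then have mx: "key c' \<le> key d" if "c' \<in> ?E" for c' using that finE by auto
      have "rep g = d" using gr gL d mx unfolding greedy_def by blast
      then show ?case using d mx[OF cE] by simp
    qed
    define \<psi> where "\<psi> i t = ph (i * L + t)" for i t
    have slot: "embeds ml D (rep (rk (apex (\<phi> i t)))) (i * L + t) (\<psi> i t)" "\<psi> i t < n" "\<psi> i t \<notin> M"
      "sim (rep (rk (apex (\<phi> i t)))) (\<psi> i t)" if s: "(i, t) \<in> S" for i t
    proof -
      let ?g = "rk (apex (\<phi> i t))"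
      have gL: "?g < L" using rkL apexS(2)[OF s] by blast
      have p: "i * L + t < L * L" using pos S[OF s] by blast
      have "feasible ml D L (rep ?g) ?g" using rep[OF apexS(2)[OF s] refl] by (simp add: eligible_def)
      then obtain w where w: "w < n" "embeds ml D (rep ?g) (i * L + t) w"
        using p DS(1)[OF s] unfolding feasible_def by blast
      have "D (5 * (i * L + t)) \<noteq> L" using DS(1)[OF s] gL by simp
      then have "\<psi> i t = w" using pl p w DS(1)[OF s] unfolding placed_def \<psi>_def by metis
      then show "embeds ml D (rep ?g) (i * L + t) (\<psi> i t)" "\<psi> i t < n" using w by auto
      then show "\<psi> i t \<notin> M" "sim (rep ?g) (\<psi> i t)" by (auto simp: embeds_def cand_def)
    qed
    have rM: "rep (rk (apex (\<phi> i t))) \<notin> M" if "(i, t) \<in> S" for i t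
      using rep[OF apexS(2)[OF that] refl] by (auto simp: eligible_def feasible_def)
    have v': "valid k l len \<psi>"
    proof (rule valid_transfer[OF v], unfold S_def[symmetric])
      fix i t assume it: "i < k" "t < len i" "\<phi> i t \<in> M"
      have tL: "t < L" using it lenL[of i] by simp
      have p: "i * L + t < L * L" using pos it tL by blast
      have "D (5 * (i * L + t)) = L" "D (5 * (i * L + t) + 1) = ix (\<phi> i t)"
        using D[OF tL, of 0 i] D[OF tL, of 1 i] it by (auto simp: dig_def)
      then show "\<psi> i t = \<phi> i t" using pl p ix(2)[OF it(3)] by (simp add: placed_def \<psi>_def)
    next
      fix i t assume s: "(i, t) \<in> S"
      let ?r = "rep (rk (apex (\<phi> i t)))"
      have "clique (\<phi> i t) = clique (apex (\<phi> i t))"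
        using apexS(1)[OF s] S[OF s] by (intro clique_eq) (auto simp: clique_def)
      moreover have "card (clique (apex (\<phi> i t))) \<le> card (clique ?r)"
        using rep[OF apexS(2)[OF s] refl] R apexS(2)[OF s] by (intro key_mono) auto
      moreover have "clique ?r = clique (\<psi> i t)"
        using slot[OF s] rM[OF s] by (intro clique_eq) auto
      ultimately show "\<psi> i t \<notin> M \<and> \<psi> i t < n \<and> card (clique (\<phi> i t)) \<le> card (clique (\<psi> i t))"
        using slot[OF s] by simp
    next
      fix i t j u assume s: "(i, t) \<in> S" "(j, u) \<in> S"
      let ?g = "rk (apex (\<phi> i t))" and ?h = "rk (apex (\<phi> j u))"
      have sim_g: "sim (\<phi> i t) (\<phi> j u) \<longleftrightarrow> ?g = ?h"
        using apex_sim[OF S(5,4)[OF s(1)] S(5,4)[OF s(2)]] rk_inj apexS(2)[OF s(1)] apexS(2)[OF s(2)] by metis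
      \<comment> \<open>Of two groups, the later one was chosen away from the clique of the earlier
        one.\<close>
      have neq: "\<not> sim (rep ?g) (rep ?h)" if "?g \<noteq> ?h"
      proof (cases "?g < ?h")
        case True
        then show ?thesis using rep[OF apexS(2)[OF s(2)] refl] sim_sym by (auto simp: eligible_def)
      next
        case False
        then have "?h < ?g" using that by simp
        then show ?thesis using rep[OF apexS(2)[OF s(1)] refl] by (auto simp: eligible_def)
      qed
      show sm: "sim (\<psi> i t) (\<psi> j u) \<longleftrightarrow> sim (\<phi> i t) (\<phi> j u)"
      proof (cases "?g = ?h")
        case True
        then have "sim (\<psi> i t) (\<psi> j u)"
          using slot[OF s(1)] slot[OF s(2)] rM[OF s(1)] by (metis sim_sym sim_trans)
        then show ?thesis using sim_g True by simp
      next
        case False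
        have "\<not> sim (\<psi> i t) (\<psi> j u)"
          using slot[OF s(1)] slot[OF s(2)] rM[OF s(1)] rM[OF s(2)] neq[OF False] by (metis sim_sym sim_trans)
        then show ?thesis using sim_g False by simp
      qed
      show "i = j \<and> t = u" if eq: "\<psi> i t = \<psi> j u"
      proof -
        have "?g = ?h" using sm eq sim_g by simp
        have p: "i * L + t < L * L" "j * L + u < L * L" using pos S[OF s(1)] S[OF s(2)] by blast+
        have "feasible ml D L (rep ?g) ?g" using rep[OF apexS(2)[OF s(1)] refl] by (simp add: eligible_def)
        then obtain w where w: "embeds ml D (rep ?g) (i * L + t) w"
           "\<And>p'. p' < L * L \<Longrightarrow> D (5 * p') = ?g \<and> p' \<noteq> i * L + t \<Longrightarrow> \<not> embeds ml D (rep ?g) p' w"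
          using p DS(1)[OF s(1)] unfolding feasible_def by blast
        have "w = \<psi> i t" using embeds_unique w(1) slot(1)[OF s(1)] by blast
        then have "j * L + u = i * L + t"
          using w(2)[OF p(2)] slot(1)[OF s(2)] DS(1)[OF s(2)] \<open>?g = ?h\<close> eq by metis
        moreover have "(i * L + t) div L = i" "(i * L + t) mod L = t" "(j * L + u) div L = j" "(j * L + u) mod L = u"
          using S[OF s(1)] S[OF s(2)] by auto
        ultimately show ?thesis by metis
      qed
    next
      fix i t assume s: "(i, t) \<in> S" "Suc t < len i" "\<phi> i (Suc t) \<in> M"
      have "ml (D (5 * (i * L + t) + 2)) = \<phi> i (Suc t)"
        using DS(3)[OF s(1)] ix s by (simp add: next_M_def)
      then show "adj (\<psi> i t) (\<phi> i (Suc t))" using slot(1)[OF s(1)] adj_sym by (auto simp: embeds_def cand_def)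
    next
      fix i t assume s: "(i, Suc t) \<in> S" "\<phi> i t \<in> M"
      have "ml (D (5 * (i * L + Suc t) + 1)) = \<phi> i t"
        using DS(2)[OF s(1)] ix s by (simp add: prev_M_def)
      then show "adj (\<phi> i t) (\<psi> i (Suc t))" using slot(1)[OF s(1)] by (auto simp: embeds_def cand_def)
    qed
    have len_eq: "D (5 * (i * L) + 4) = len i" if "i < k" for i
      using D[of 0 4 i] that len2[OF that] lenL[OF that] by (simp add: dig_def)
    have "valid k l (\<lambda>i. D (5 * (i * L) + 4)) \<psi> \<longleftrightarrow> valid k l len \<psi>"
      unfolding valid_def skeleton_def hall_def free_def by (simp add: len_eq cong: conj_cong)
    then show ?thesis using v' unfolding \<psi>_def by simp
  qed
  have "D (5 * (i * L) + 4) \<le> L" for i by (rule D_le)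
  then show ?thesis using main kL D_le by blast
qed

end

section \<open>The search program\<close>

definition V :: "name \<Rightarrow> ex" where "V x = Rd x (K 0)"
definition Neg :: "ex \<Rightarrow> ex" where "Neg a = Ite a (K 0) (K 1)"
definition Conj :: "ex \<Rightarrow> ex \<Rightarrow> ex" where "Conj a b = Ite a b (K 0)"
definition Disj :: "ex \<Rightarrow> ex \<Rightarrow> ex" where "Disj a b = Ite a (K 1) b"
definition Imp :: "ex \<Rightarrow> ex \<Rightarrow> ex" where "Imp a b = Ite a b (K 1)"
definition Iff :: "ex \<Rightarrow> ex \<Rightarrow> ex" where "Iff a b = Conj (Imp a b) (Imp b a)"
definition Eq :: "ex \<Rightarrow> ex \<Rightarrow> ex" where "Eq a b = Neg (Disj (Lt a b) (Lt b a))"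
text \<open>As a truth value this is the bounded existential quantifier, positive numbers counting
  as true.\<close>

definition Count :: "name \<Rightarrow> name \<Rightarrow> ex \<Rightarrow> ex" where "Count x N a = Sum x N (Ite a (K 1) (K 0))"
definition Forall :: "name \<Rightarrow> name \<Rightarrow> ex \<Rightarrow> ex" where "Forall x N a = Neg (Count x N (Neg a))"

lemmas macro_defs = V_def Neg_def Conj_def Disj_def Imp_def Iff_def Eq_def Count_def Forall_def

definition holds :: "ex \<Rightarrow> state \<Rightarrow> bool" where "holds e s \<longleftrightarrow> eval e s > 0"

lemma eval_V [simp]: "eval (V x) s = s x 0"
  by (simp add: V_def)

declare eval.simps(6) [simp del]

lemma eval_Count [simp]: "eval (Count x N a) s = card {j. j < s N 0 \<and> holds a (store s x 0 j)}"
proof -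
  have "(\<Sum>j<s N 0. if eval a (store s x 0 j) > 0 then 1 else 0) = card ({..<s N 0} \<inter> {j. eval a (store s x 0 j) > 0})"
    by (simp add: sum.If_cases)
  also have "{..<s N 0} \<inter> {j. eval a (store s x 0 j) > 0} = {j. j < s N 0 \<and> holds a (store s x 0 j)}"
    by (auto simp: holds_def)
  finally show ?thesis by (simp add: Count_def eval.simps(6) cong: if_cong)
qed

lemma eval_Ite [simp]: "eval (Ite a b c) s = (if holds a s then eval b s else eval c s)"
  by (simp add: holds_def eval.simps(6))

lemma holds_simps [simp]:
  "holds (Neg a) s \<longleftrightarrow> \<not> holds a s"
  "holds (Conj a b) s \<longleftrightarrow> holds a s \<and> holds b s"
  "holds (Disj a b) s \<longleftrightarrow> holds a s \<or> holds b s"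
  "holds (Imp a b) s \<longleftrightarrow> (holds a s \<longrightarrow> holds b s)"
  "holds (Iff a b) s \<longleftrightarrow> (holds a s \<longleftrightarrow> holds b s)"
  "holds (Lt d e) s \<longleftrightarrow> eval d s < eval e s"
  "holds (Eq d e) s \<longleftrightarrow> eval d s = eval e s"
  "holds (Rd x d) s \<longleftrightarrow> s x (eval d s) > 0"
  by (auto simp: holds_def macro_defs eval.simps(6))

lemma holds_V [simp]: "holds (V x) s \<longleftrightarrow> s x 0 > 0"
  by (simp add: V_def)

lemma holds_Count [simp]: "holds (Count x N a) s \<longleftrightarrow> (\<exists>j<s N 0. holds a (store s x 0 j))"
  unfolding holds_def[of "Count x N a"] by (auto simp: card_gt_0_iff)

lemma holds_Forall [simp]: "holds (Forall x N a) s \<longleftrightarrow> (\<forall>j<s N 0. holds a (store s x 0 j))"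
  by (simp add: Forall_def)

lemma den_When [simp]: "den (When e p) s = (if holds e s then den p s else s)"
  by (simp add: holds_def)

declare den.simps(3,4) [simp del]

text \<open>The macros below bind variables of their own, such as \<open>z\<close> or
  \<open>u\<close>, which must not capture variables of their arguments. The condition is semantic:
  the value of the argument does not depend on the bound cell.\<close>

definition fresh :: "name \<Rightarrow> ex \<Rightarrow> bool" where
  "fresh x e \<longleftrightarrow> (\<forall>s j. eval e (store s x 0 j) = eval e s)"

lemma freshD [simp]: "fresh x e \<Longrightarrow> eval e (store s x 0 j) = eval e s"
  by (simp add: fresh_def)

lemma fresh_intros [simp]:
  "fresh x (K c)"
  "x \<noteq> y \<Longrightarrow> fresh x (V y)"
  "x \<noteq> y \<Longrightarrow> fresh x e \<Longrightarrow> fresh x (Rd y e)"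
  "fresh x d \<Longrightarrow> fresh x e \<Longrightarrow> fresh x (Plus d e)"
  by (auto simp: fresh_def store_apply)

lemma fresh_Sum [simp]:
  assumes "x \<noteq> y" "x \<noteq> N" "fresh x e"
  shows "fresh x (Sum y N e)"
proof -
  have "store (store s x 0 j) y 0 i = store (store s y 0 i) x 0 j" for s i j
    using assms(1) by (auto simp: store_def fun_eq_iff)
  then show ?thesis using assms(2,3) by (simp add: fresh_def store_apply)
qed

text \<open>Surjectivity of the decoding: a loop over all \<open>w < B ^ N\<close> meets every
  sequence of \<open>N\<close> digits.\<close>

lemma digits_exist:
  fixes D :: "nat \<Rightarrow> nat"
  assumes "\<And>t. t < N \<Longrightarrow> D t < B"
  shows "\<exists>w<B ^ N. \<forall>t<N. w div B ^ t mod B = D t"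
  using assms
proof (induction N arbitrary: D)
  case (Suc N)
  from Suc.IH[of "\<lambda>t. D (Suc t)"] Suc.prems obtain w where
    w: "w < B ^ N" "\<And>t. t < N \<Longrightarrow> w div B ^ t mod B = D (Suc t)" by auto
  have D0: "D 0 < B" using Suc.prems by simp
  have "D 0 + B * w < B * (w + 1)" using D0 by simp
  also have "\<dots> \<le> B * B ^ N" using w(1) by (intro mult_le_mono2) simp
  finally have "D 0 + B * w < B ^ Suc N" by simp
  moreover have "(D 0 + B * w) div B ^ t mod B = D t" if "t < Suc N" for t
  proof (cases t)
    case 0
    then show ?thesis using D0 by simp
  next
    case (Suc t')
    have "(D 0 + B * w) div B ^ t = (D 0 + B * w) div B div B ^ t'"
      by (simp add: Suc div_mult2_eq)
    also have "(D 0 + B * w) div B = w" using D0 by simp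
    finally show ?thesis using w(2)[of t'] that Suc by simp
  qed
  ultimately show ?case by blast
qed simp

text \<open>How a language with sums expresses a definite description: all other summands
  vanish.\<close>

lemma sum_unique_index:
  fixes n c :: nat
  assumes "c < n" "P c" "\<And>d. d < n \<Longrightarrow> P d \<Longrightarrow> d = c"
  shows "(\<Sum>d<n. if P d then d else 0) = c"
proof -
  have "(\<Sum>d<n. if P d then d else 0) = (\<Sum>d<n. if d = c then c else 0)"
  proof (rule sum.cong)
    fix d assume "d \<in> {..<n}"
    then have "P d \<Longrightarrow> d = c" using assms(3) by simp
    then show "(if P d then d else 0) = (if d = c then c else 0)" using assms(2) by (cases "P d") auto
  qed simp
  then show ?thesis using assms(1) by simp
qed

text \<open>Loops run up to \<open>L\<close> with a guard, since \<open>k\<close> may be huge and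
  the lengths of the paths are not cells that could bound a loop.\<close>

lemma all_bounded: "k \<le> L \<Longrightarrow> (\<forall>i<L. i < k \<longrightarrow> P i) \<longleftrightarrow> (\<forall>i<k. P i)" for k L :: nat
  by (meson less_le_trans)

lemma ex_bounded:
  "k \<le> L \<Longrightarrow> (\<exists>i<L. i < k \<and> P i) \<longleftrightarrow> (\<exists>i<k. P i)"
  "k \<le> L \<Longrightarrow> (\<exists>i<L. Suc i < k \<and> P i) \<longleftrightarrow> (\<exists>i. Suc i < k \<and> P i)" for k L :: nat
  by (meson less_le_trans Suc_lessD)+

text \<open>The inner sum is \<open>n * a\<close>, the start of row \<open>a\<close>. Without the
  guards an index outside the vertex range could read an entry of another row.\<close>

definition AdjE :: "ex \<Rightarrow> ex \<Rightarrow> ex" where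
  "AdjE a b = Conj (Lt a (V ''n'')) (Conj (Lt b (V ''n'')) (Rd ''adj'' (Plus (Sum ''z'' ''n'' a) b)))"

definition SimE :: "ex \<Rightarrow> ex \<Rightarrow> ex" where
  "SimE a b = Disj (Eq a b) (AdjE a b)"

definition digE :: "nat \<Rightarrow> ex \<Rightarrow> ex" where
  "digE j p = Rd ''D'' (Plus (Plus (Plus p p) (Plus p p)) (Plus p (K j)))"

definition candE :: "ex \<Rightarrow> ex \<Rightarrow> ex \<Rightarrow> ex" where
  "candE c p u = Conj (Neg (Rd ''M'' u)) (Conj (SimE c u)
     (Conj (AdjE (Rd ''ml'' (digE 1 p)) u) (AdjE (Rd ''ml'' (digE 2 p)) u)))"

definition embE :: "ex \<Rightarrow> ex \<Rightarrow> ex \<Rightarrow> ex" where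
  "embE c p v = Conj (candE c p v)
     (Eq (Count ''u'' ''n'' (Conj (Lt (V ''u'') v) (candE c p (V ''u'')))) (digE 3 p))"

definition feasE :: "ex \<Rightarrow> ex \<Rightarrow> ex" where
  "feasE c g = Conj (Neg (Rd ''M'' c)) (Forall ''p1'' ''LL'' (Imp (Eq (digE 0 (V ''p1'')) g)
     (Count ''v'' ''n'' (Conj (embE c (V ''p1'') (V ''v''))
        (Forall ''p2'' ''LL'' (Imp (Conj (Eq (digE 0 (V ''p2'')) g) (Neg (Eq (V ''p2'') (V ''p1''))))
           (Neg (embE c (V ''p2'') (V ''v''))))))))) "

definition eligE :: "ex \<Rightarrow> ex \<Rightarrow> ex" where
  "eligE c g = Conj (feasE c g) (Forall ''h'' ''L'' (Imp (Lt (V ''h'') g) (Neg (SimE c (Rd ''rep'' (V ''h''))))))"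

definition keyE :: "ex \<Rightarrow> ex" where
  "keyE c = Plus (Sum ''z'' ''n'' (Count ''u'' ''n'' (Conj (Neg (Rd ''M'' (V ''u''))) (SimE c (V ''u''))))) c"

text \<open>Repeated division by \<open>B\<close> without a division instruction: the quotient of
  \<open>x\<close> is the number of \<open>y\<close> with \<open>B * (y + 1) \<le> x\<close>, and
  all of these are below \<open>W\<close> because \<open>x\<close> is. The digit is the
  remainder.\<close>

definition decodeP :: "name \<Rightarrow> name \<Rightarrow> prog" where
  "decodeP a w = Sq (Asg ''x'' (K 0) (V w)) (For ''t'' ''LL5''
     (Sq (Asg ''q'' (K 0) (Count ''y'' ''W'' (Neg (Lt (V ''x'') (Sum ''z'' ''B'' (Plus (V ''y'') (K 1)))))))
     (Sq (Asg a (V ''t'') (Minus (V ''x'') (Sum ''z'' ''B'' (V ''q''))))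
         (Asg ''x'' (K 0) (V ''q'')))))"

text \<open>The sum returns the best vertex only if there is just one; \<open>key_inj\<close>
  excludes ties, which is the purpose of the second summand of \<open>key\<close>. Without an
  eligible vertex the entry becomes 0.\<close>

definition repP :: prog where
  "repP = For ''g'' ''L'' (Asg ''rep'' (V ''g'') (Sum ''c'' ''n''
     (Ite (Conj (eligE (V ''c'') (V ''g''))
        (Forall ''c2'' ''n'' (Imp (eligE (V ''c2'') (V ''g'')) (Neg (Lt (keyE (V ''c'')) (keyE (V ''c2'')))))))
        (V ''c'') (K 0))))"

definition phiP :: prog where
  "phiP = For ''p'' ''LL'' (Asg ''phi'' (V ''p'')
     (Ite (Eq (digE 0 (V ''p'')) (V ''L'')) (Rd ''ml'' (digE 1 (V ''p'')))
        (Sum ''v'' ''n'' (Ite (embE (Rd ''rep'' (digE 0 (V ''p''))) (V ''p'') (V ''v'')) (V ''v'') (K 0)))))"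

definition lenE :: "ex \<Rightarrow> ex" where
  "lenE i = digE 4 (Sum ''z1'' ''L'' i)"

definition phiE :: "ex \<Rightarrow> ex \<Rightarrow> ex" where
  "phiE i t = Rd ''phi'' (Plus (Sum ''z1'' ''L'' i) t)"

definition SucE :: "ex \<Rightarrow> ex" where
  "SucE e = Plus e (K 1)"

text \<open>Besides \<open>skeleton\<close> this tests \<open>k \<le> L\<close> and
  \<open>len i \<le> L\<close>, without which the loops up to \<open>L\<close> would miss paths or
  positions.\<close>

definition skeletonE :: ex where
  "skeletonE = Conj (Neg (Lt (V ''L'') (V ''k''))) (Forall ''i'' ''L'' (Imp (Lt (V ''i'') (V ''k''))
     (Conj (Conj (Neg (Lt (lenE (V ''i'')) (K 2)))
       (Conj (Neg (Lt (SucE (V ''l'')) (lenE (V ''i'')))) (Neg (Lt (V ''L'') (lenE (V ''i''))))))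
     (Forall ''t'' ''L'' (Imp (Lt (V ''t'') (lenE (V ''i'')))
        (Conj (Lt (phiE (V ''i'') (V ''t'')) (V ''n''))
        (Conj (Iff (Rd ''A'' (phiE (V ''i'') (V ''t'')))
                  (Disj (Eq (V ''t'') (K 0)) (Eq (SucE (V ''t'')) (lenE (V ''i'')))))
        (Conj (Imp (Lt (SucE (V ''t'')) (lenE (V ''i'')))
                   (AdjE (phiE (V ''i'') (V ''t'')) (phiE (V ''i'') (SucE (V ''t'')))))
              (Forall ''j'' ''L'' (Imp (Lt (V ''j'') (V ''k''))
                (Forall ''r'' ''L'' (Imp (Lt (V ''r'') (lenE (V ''j'')))
                  (Imp (Eq (phiE (V ''i'') (V ''t'')) (phiE (V ''j'') (V ''r'')))
                     (Conj (Eq (V ''i'') (V ''j'')) (Eq (V ''t'') (V ''r'')))))))))))))))) "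

definition freeE :: "ex \<Rightarrow> ex" where
  "freeE v = Conj (Neg (Rd ''M'' v)) (Conj
     (Forall ''i'' ''L'' (Imp (Lt (V ''i'') (V ''k'')) (Forall ''t'' ''L'' (Imp (Lt (V ''t'') (lenE (V ''i'')))
        (Neg (Eq (phiE (V ''i'') (V ''t'')) v))))))
     (Count ''i'' ''L'' (Conj (Lt (V ''i'') (V ''k'')) (Conj (Rd ''X'' (V ''i''))
        (Count ''t'' ''L'' (Conj (Lt (SucE (V ''t'')) (lenE (V ''i'')))
          (Conj (Neg (Rd ''M'' (phiE (V ''i'') (V ''t''))))
          (Conj (Neg (Rd ''M'' (phiE (V ''i'') (SucE (V ''t'')))))
                (AdjE (phiE (V ''i'') (V ''t'')) v)))))))))"

definition hallE :: ex where
  "hallE = Neg (Lt (Count ''v'' ''n'' (freeE (V ''v'')))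
     (Sum ''i'' ''L'' (Ite (Conj (Lt (V ''i'') (V ''k'')) (Rd ''X'' (V ''i'')))
        (Minus (SucE (V ''l'')) (lenE (V ''i''))) (K 0))))"

text \<open>A set of paths is coded by the number \<open>x2\<close>: path \<open>i\<close> belongs
  to it iff digit \<open>i\<close> is nonzero. Reusing \<open>W\<close> and the base
  \<open>L + 1\<close> supplies at least \<open>L\<close> digits and avoids another loop
  bound.\<close>

definition checkP :: prog where
  "checkP = Sq (Asg ''ok'' (K 0) skeletonE)
     (For ''x2'' ''W'' (Sq (decodeP ''X'' ''x2'') (When (Neg hallE) (Asg ''ok'' (K 0) (K 0)))))"

definition searchP :: prog where
  "searchP = For ''w'' ''W'' (Sq (decodeP ''D'' ''w'') (Sq repP (Sq phiP (Sq checkP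
     (When (V ''ok'') (Asg ''out'' (K 0) (K 1)))))))"

section \<open>Correctness of the search program\<close>

locale search_instance = cluster_instance +
  fixes k l L :: nat and ml :: "nat \<Rightarrow> nat"
  assumes L: "L = 3 * card M" and ml: "x \<in> M \<Longrightarrow> \<exists>a<card M. ml a = x"
begin

text \<open>What the search takes over from the input and the earlier stages; it writes none of
  these cells, so this is an invariant of all its parts.\<close>

definition env :: "state \<Rightarrow> bool" where
  "env s \<longleftrightarrow> s ''n'' 0 = n \<and> s ''k'' 0 = k \<and> s ''l'' 0 = l \<and>
     (\<forall>u<n. \<forall>v<n. s ''adj'' (n * u + v) > 0 \<longleftrightarrow> adj u v) \<and>
     (\<forall>v. s ''A'' v > 0 \<longleftrightarrow> v \<in> A) \<and> (\<forall>v. s ''M'' v > 0 \<longleftrightarrow> v \<in> M) \<and> s ''ml'' = ml \<and>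
     s ''L'' 0 = L \<and> s ''LL'' 0 = L * L \<and> s ''B'' 0 = Suc L \<and> s ''LL5'' 0 = 5 * (L * L) \<and>
     s ''W'' 0 = Suc L ^ (5 * (L * L))"

abbreviation env_names :: "name set" where
  "env_names \<equiv> {''n'', ''k'', ''l'', ''adj'', ''A'', ''M'', ''ml'', ''L'', ''LL'', ''B'', ''LL5'', ''W''}"

lemma env_cong: "(\<And>x. x \<in> env_names \<Longrightarrow> s x = s' x) \<Longrightarrow> env s = env s'"
  unfolding env_def by simp

lemma env_store [simp]: "x \<notin> env_names \<Longrightarrow> env (store s x i v) = env s"
  by (rule env_cong) (auto simp: store_apply)

lemma env_den: "written p \<inter> env_names = {} \<Longrightarrow> env (den p s) = env s"
proof (rule env_cong)
  fix x assume "written p \<inter> env_names = {}" "x \<in> env_names"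
  then have "x \<notin> written p" by (meson disjoint_iff)
  then show "den p s x = s x" by (rule den_frame)
qed

lemma env_simps:
  assumes "env s"
  shows "s ''n'' 0 = n" "s ''k'' 0 = k" "s ''l'' 0 = l" "s ''A'' v > 0 \<longleftrightarrow> v \<in> A"
    "s ''M'' v > 0 \<longleftrightarrow> v \<in> M" "s ''ml'' = ml" "s ''L'' 0 = L" "s ''LL'' 0 = L * L"
    "s ''B'' 0 = Suc L" "s ''LL5'' 0 = 5 * (L * L)" "s ''W'' 0 = Suc L ^ (5 * (L * L))"
  using assms by (auto simp: env_def)

lemma holds_AdjE [simp]:
  assumes "env s" "fresh ''z'' a"
  shows "holds (AdjE a b) s \<longleftrightarrow> adj (eval a s) (eval b s)"
proof -
  have "adj (eval a s) (eval b s) \<Longrightarrow> eval a s < n \<and> eval b s < n" using adj_bound adj_sym by blast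
  then show ?thesis using assms by (auto simp: AdjE_def env_def)
qed

lemma holds_SimE [simp]:
  "env s \<Longrightarrow> fresh ''z'' a \<Longrightarrow> holds (SimE a b) s \<longleftrightarrow> sim (eval a s) (eval b s)"
  by (simp add: SimE_def sim_def)

lemma eval_digE [simp]: "eval (digE j p) s = s ''D'' (5 * eval p s + j)"
proof -
  have "eval p s + eval p s + (eval p s + eval p s) + (eval p s + j) = 5 * eval p s + j" by simp
  then show ?thesis by (simp only: digE_def eval.simps)
qed

lemma fresh_digE [simp]: "x \<noteq> ''D'' \<Longrightarrow> fresh x p \<Longrightarrow> fresh x (digE j p)"
  by (simp add: digE_def)

lemma holds_candE [simp]:
  assumes "env s" "fresh ''z'' c" "fresh ''z'' p"
  shows "holds (candE c p u) s \<longleftrightarrow> cand ml (s ''D'') (eval c s) (eval p s) (eval u s)"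
  using assms by (simp add: candE_def cand_def env_simps)

lemma holds_embE [simp]:
  assumes "env s" "fresh ''z'' c" "fresh ''z'' p" "fresh ''u'' c" "fresh ''u'' p" "fresh ''u'' v"
  shows "holds (embE c p v) s \<longleftrightarrow> embeds ml (s ''D'') (eval c s) (eval p s) (eval v s)"
proof -
  have "{j. j < n \<and> j < eval v s \<and> cand ml (s ''D'') (eval c s) (eval p s) j} =
    {j. j < eval v s \<and> cand ml (s ''D'') (eval c s) (eval p s) j}"
    using adj_bound adj_sym by (auto simp: cand_def)
  then show ?thesis using assms by (simp add: embE_def embeds_def env_simps store_apply)
qed

lemma holds_feasE [simp]:
  assumes "env s" "\<forall>x\<in>{''z'', ''u'', ''v'', ''p1'', ''p2''}. fresh x c \<and> fresh x g"
  shows "holds (feasE c g) s \<longleftrightarrow> feasible ml (s ''D'') L (eval c s) (eval g s)"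
  using assms by (simp add: feasE_def feasible_def env_simps store_apply)

lemma holds_eligE [simp]:
  assumes "env s" "\<forall>x\<in>{''z'', ''u'', ''v'', ''p1'', ''p2'', ''h''}. fresh x c \<and> fresh x g"
    "eval g s < L"
  shows "holds (eligE c g) s \<longleftrightarrow> eligible ml (s ''D'') L (s ''rep'') (eval c s) (eval g s)"
proof -
  have "holds (eligE c g) s \<longleftrightarrow> feasible ml (s ''D'') L (eval c s) (eval g s) \<and>
      (\<forall>h<L. h < eval g s \<longrightarrow> \<not> sim (eval c s) (s ''rep'' h))"
    using assms(1,2) by (simp add: eligE_def env_simps store_apply)
  then show ?thesis using assms(3) unfolding eligible_def by (meson less_trans)
qed

lemma eval_keyE [simp]:
  assumes "env s" "fresh ''z'' c" "fresh ''u'' c"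
  shows "eval (keyE c) s = key (eval c s)"
proof -
  have "{j. j < n \<and> j \<notin> M \<and> sim (eval c s) j} = clique (eval c s)" by (auto simp: clique_def)
  then show ?thesis using assms by (simp add: keyE_def key_def env_simps store_apply)
qed

lemma decodeP:
  assumes "env s" "s w 0 < Suc L ^ (5 * (L * L))" "a \<notin> env_names" "a \<notin> {''x'', ''t'', ''q''}"
    and "t < 5 * (L * L)"
  shows "den (decodeP a w) s a t = s w 0 div Suc L ^ t mod Suc L"
proof -
  define w0 where "w0 = s w 0"
  define I where "I j s' \<longleftrightarrow> env s' \<and> s' ''x'' 0 = w0 div Suc L ^ j \<and>
    (\<forall>t<j. s' a t = w0 div Suc L ^ t mod Suc L)" for j s'
  let ?s = "store s ''x'' 0 w0"
  let ?body = "Sq (Asg ''q'' (K 0) (Count ''y'' ''W'' (Neg (Lt (V ''x'') (Sum ''z'' ''B'' (Plus (V ''y'') (K 1)))))))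
     (Sq (Asg a (V ''t'') (Minus (V ''x'') (Sum ''z'' ''B'' (V ''q''))))
         (Asg ''x'' (K 0) (V ''q'')))"
  have "I (?s ''LL5'' 0) (den (For ''t'' ''LL5'' ?body) ?s)"
  proof (rule den_For_inv)
    show "I 0 ?s" using assms by (simp add: I_def store_apply)
    fix j s' assume "I j s'"
    then have I: "env s'" "s' ''x'' 0 = w0 div Suc L ^ j" "\<And>t. t < j \<Longrightarrow> s' a t = w0 div Suc L ^ t mod Suc L"
      by (auto simp: I_def)
    define x where "x = w0 div Suc L ^ j"
    have "x \<le> w0" by (simp add: x_def)
    then have "x div Suc L < Suc L ^ (5 * (L * L))"
      using assms(2) by (metis div_le_dividend le_less_trans w0_def)
    moreover have quot: "\<not> x < Suc L * (y + 1) \<longleftrightarrow> y < x div Suc L" for y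
      by (metis Suc_eq_plus1 Suc_le_eq less_eq_div_iff_mult_less_eq mult.commute not_less zero_less_Suc)
    ultimately have "y < x div Suc L \<Longrightarrow> y < Suc L ^ (5 * (L * L))" for y by (meson less_trans)
    then have cnt: "{y. y < Suc L ^ (5 * (L * L)) \<and> \<not> x < Suc L * (y + 1)} = {..<x div Suc L}"
      unfolding quot lessThan_def by blast
    have "x div Suc L = w0 div Suc L ^ Suc j" unfolding x_def power_Suc2 by (rule div_mult2_eq[symmetric])
    moreover have "x - Suc L * (x div Suc L) = x mod Suc L" by (rule minus_mult_div_eq_mod)
    ultimately show "I (Suc j) (den ?body (store s' ''t'' 0 j))"
      using I assms(3,4) cnt unfolding I_def
      by (auto simp: store_apply env_simps x_def[symmetric] less_Suc_eq)
  qed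
  moreover have "?s ''LL5'' 0 = 5 * (L * L)" using assms(1) by (simp add: store_apply env_simps)
  moreover have "den (decodeP a w) s = den (For ''t'' ''LL5'' ?body) ?s"
    by (simp add: decodeP_def w0_def)
  ultimately show ?thesis using assms(5) by (simp add: I_def w0_def)
qed

lemma written_simps [simp]:
  "written (decodeP a w) = {''x'', ''t'', ''q'', a}"
  "written repP = {''g'', ''rep''}" "written phiP = {''p'', ''phi''}"
  "written checkP = {''ok'', ''x2'', ''x'', ''t'', ''q'', ''X''}"
  by (auto simp: decodeP_def repP_def phiP_def checkP_def)

text \<open>Group \<open>g\<close> looks only at the representatives of earlier groups, so choices
  already made stay greedy while the loop writes later ones.\<close>

lemma eligible_update: "g \<le> h \<Longrightarrow> eligible ml D L (rep(h := v)) c g = eligible ml D L rep c g"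
  by (auto simp: eligible_def)

lemma repP:
  assumes "env s"
  shows "greedy ml (s ''D'') L (den repP s ''rep'')"
proof -
  define D where "D = s ''D''"
  define best where "best rep g c \<longleftrightarrow> eligible ml D L rep c g \<and> (\<forall>c'<n. eligible ml D L rep c' g \<longrightarrow> key c' \<le> key c)"
    for rep g c
  have best_unique: "c = d" if "best rep g c" "best rep g d" "c < n" "d < n" for rep g c d
    using that key_inj by (meson best_def le_antisym)
  define I where "I j s' \<longleftrightarrow> env s' \<and> s' ''D'' = D \<and> (\<forall>g<j. \<forall>c<n. best (s' ''rep'') g c \<longrightarrow> s' ''rep'' g = c)" for j s'
  have "I (s ''L'' 0) (den repP s)"
    unfolding repP_def
  proof (rule den_For_inv)
    show "I 0 s" using assms by (simp add: I_def D_def)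
    fix j s' assume j: "j < s ''L'' 0" and I: "I j s'"
    have jL: "j < L" using j assms by (simp add: env_simps)
    have env: "env s'" and D: "s' ''D'' = D" using I by (auto simp: I_def)
    let ?e = "Sum ''c'' ''n''
     (Ite (Conj (eligE (V ''c'') (V ''g''))
        (Forall ''c2'' ''n'' (Imp (eligE (V ''c2'') (V ''g'')) (Neg (Lt (keyE (V ''c'')) (keyE (V ''c2'')))))))
        (V ''c'') (K 0))"
    define v where "v = (\<Sum>c<n. if best (s' ''rep'') j c then c else 0)"
    have v: "eval ?e (store s' ''g'' 0 j) = v"
      using env D jL by (simp add: v_def best_def env_simps store_apply not_less cong: conj_cong if_cong)
    define rep' where "rep' = (s' ''rep'')(j := v)"
    have upd: "best rep' g c = best (s' ''rep'') g c" if "g \<le> j" for g c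
      unfolding best_def rep'_def using eligible_update[OF that] by simp
    have "rep' g = c" if "g < Suc j" "c < n" "best rep' g c" for g c
    proof (cases "g = j")
      case True
      then have "best (s' ''rep'') j c" using that upd by simp
      then have "v = c" unfolding v_def using that(2) best_unique by (intro sum_unique_index) blast+
      then show ?thesis by (simp add: rep'_def True)
    next
      case False
      then have "best (s' ''rep'') g c" "g < j" using that upd by auto
      then show ?thesis using I that(2) by (simp add: I_def rep'_def)
    qed
    then show "I (Suc j) (den (Asg ''rep'' (V ''g'') ?e) (store s' ''g'' 0 j))"
      using env D v by (simp add: I_def store_apply rep'_def)
  qed
  then show ?thesis using assms by (auto simp: I_def greedy_def best_def env_simps D_def)
qed

lemma phiP:
  assumes "env s"
  shows "placed ml (s ''D'') L (s ''rep'') (den phiP s ''phi'')"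
proof -
  define D where "D = s ''D''"
  define rep where "rep = s ''rep''"
  define I where "I j s' \<longleftrightarrow> env s' \<and> s' ''D'' = D \<and> s' ''rep'' = rep \<and>
    (\<forall>p<j. if D (5 * p) = L then s' ''phi'' p = ml (D (5 * p + 1))
      else \<forall>v<n. embeds ml D (rep (D (5 * p))) p v \<longrightarrow> s' ''phi'' p = v)" for j s'
  have "I (s ''LL'' 0) (den phiP s)"
    unfolding phiP_def
  proof (rule den_For_inv)
    show "I 0 s" using assms by (simp add: I_def D_def rep_def)
    fix j s' assume I: "I j s'"
    then have env: "env s'" and D: "s' ''D'' = D" "s' ''rep'' = rep" by (auto simp: I_def)
    let ?e = "Ite (Eq (digE 0 (V ''p'')) (V ''L'')) (Rd ''ml'' (digE 1 (V ''p'')))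
        (Sum ''v'' ''n'' (Ite (embE (Rd ''rep'' (digE 0 (V ''p''))) (V ''p'') (V ''v'')) (V ''v'') (K 0)))"
    define v where "v = (if D (5 * j) = L then ml (D (5 * j + 1)) else
       (\<Sum>v<n. if embeds ml D (rep (D (5 * j))) j v then v else 0))"
    have v: "eval ?e (store s' ''p'' 0 j) = v"
      using env D by (simp add: v_def env_simps store_apply cong: if_cong)
    have "v = u" if "D (5 * j) \<noteq> L" "u < n" "embeds ml D (rep (D (5 * j))) j u" for u
      unfolding v_def using that embeds_unique by (simp, intro sum_unique_index) auto
    then show "I (Suc j) (den (Asg ''phi'' (V ''p'') ?e) (store s' ''p'' 0 j))"
      using I v by (auto simp: I_def store_apply less_Suc_eq v_def)
  qed
  then show ?thesis using assms by (auto simp: I_def placed_def env_simps D_def rep_def)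
qed

text \<open>Decoding fixes only the first \<open>5 * (L * L)\<close> digits. Positions are below
  \<open>L * L\<close>, so no other digit is read.\<close>

lemma guess_cong:
  assumes "\<And>x. x < 5 * (L * L) \<Longrightarrow> D x = D' x"
  shows "greedy ml D L rep = greedy ml D' L rep" "placed ml D L rep ph = placed ml D' L rep ph"
proof -
  have *: "embeds ml D c p v = embeds ml D' c p v" "D (5 * p) = D' (5 * p)" "D (Suc (5 * p)) = D' (Suc (5 * p))"
    if "p < L * L" for c p v
  proof -
    have "D (5 * p + j) = D' (5 * p + j)" if "j < 5" for j
      using \<open>p < L * L\<close> that by (intro assms) linarith
    from this[of 0] this[of 1] this[of 2] this[of 3]
    show "embeds ml D c p v = embeds ml D' c p v" "D (5 * p) = D' (5 * p)" "D (Suc (5 * p)) = D' (Suc (5 * p))"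
      by (simp_all add: embeds_def cand_def)
  qed
  have "feasible ml D L c g = feasible ml D' L c g" for c g
    unfolding feasible_def using * by (simp cong: conj_cong imp_cong)
  then show "greedy ml D L rep = greedy ml D' L rep" by (simp add: greedy_def eligible_def)
  show "placed ml D L rep ph = placed ml D' L rep ph"
    unfolding placed_def using * by (simp cong: imp_cong)
qed

definition len_of :: "state \<Rightarrow> nat \<Rightarrow> nat" where
  "len_of s i = s ''D'' (5 * (i * L) + 4)"

definition phi_of :: "state \<Rightarrow> nat \<Rightarrow> nat \<Rightarrow> nat" where
  "phi_of s i t = s ''phi'' (i * L + t)"

lemma eval_lenE [simp]: "env s \<Longrightarrow> fresh ''z1'' i \<Longrightarrow> eval (lenE i) s = len_of s (eval i s)"
  by (simp add: lenE_def len_of_def env_simps mult.commute)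

lemma eval_phiE [simp]: "env s \<Longrightarrow> fresh ''z1'' i \<Longrightarrow> eval (phiE i t) s = phi_of s (eval i s) (eval t s)"
  by (simp add: phiE_def phi_of_def env_simps mult.commute)

lemma of_store [simp]:
  "x \<noteq> ''D'' \<Longrightarrow> len_of (store s x i v) = len_of s"
  "x \<noteq> ''phi'' \<Longrightarrow> phi_of (store s x i v) = phi_of s"
  by (auto simp: len_of_def phi_of_def store_apply fun_eq_iff)

lemma eval_SucE [simp]: "eval (SucE e) s = Suc (eval e s)"
  by (simp add: SucE_def)

lemma fresh_more [simp]:
  "fresh x e \<Longrightarrow> fresh x (SucE e)"
  "x \<notin> {''z1'', ''L'', ''D''} \<Longrightarrow> fresh x i \<Longrightarrow> fresh x (lenE i)"
  "x \<notin> {''z1'', ''L'', ''phi''} \<Longrightarrow> fresh x i \<Longrightarrow> fresh x t \<Longrightarrow> fresh x (phiE i t)"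
  by (auto simp: SucE_def lenE_def phiE_def)

lemma holds_skeletonE:
  assumes "env s"
  shows "holds skeletonE s \<longleftrightarrow> k \<le> L \<and> (\<forall>i<k. len_of s i \<le> L) \<and> skeleton k l (len_of s) (phi_of s)"
proof -
  have "holds skeletonE s \<longleftrightarrow> k \<le> L \<and> (\<forall>i<L. i < k \<longrightarrow> (2 \<le> len_of s i \<and> len_of s i \<le> Suc l \<and> len_of s i \<le> L) \<and>
     (\<forall>t<L. t < len_of s i \<longrightarrow> phi_of s i t < n \<and>
        (phi_of s i t \<in> A \<longleftrightarrow> t = 0 \<or> Suc t = len_of s i) \<and>
        (Suc t < len_of s i \<longrightarrow> adj (phi_of s i t) (phi_of s i (Suc t))) \<and>
        (\<forall>j<L. j < k \<longrightarrow> (\<forall>r<L. r < len_of s j \<longrightarrow> phi_of s i t = phi_of s j r \<longrightarrow> i = j \<and> t = r))))"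
    using assms by (simp add: skeletonE_def env_simps store_apply not_less)
  also have "\<dots> \<longleftrightarrow> k \<le> L \<and> (\<forall>i<k. len_of s i \<le> L) \<and> skeleton k l (len_of s) (phi_of s)"
  proof (cases "k \<le> L \<and> (\<forall>i<k. len_of s i \<le> L)")
    case True
    then have kL: "k \<le> L" and len: "\<And>i. i < k \<Longrightarrow> len_of s i \<le> L" by auto
    show ?thesis unfolding skeleton_def using kL len by (simp add: all_bounded) blast
  next
    case False
    then show ?thesis by (meson less_le_trans)
  qed
  finally show ?thesis .
qed

lemma holds_hallE:
  assumes "env s" "k \<le> L" "\<forall>i<k. len_of s i \<le> L"
  shows "holds hallE s \<longleftrightarrow> hall k l (len_of s) (phi_of s) {i. s ''X'' i > 0}"
proof -
  have free: "holds (freeE (V ''v'')) (store s ''v'' 0 v) \<longleftrightarrow> v \<in> free k (len_of s) (phi_of s) {i. s ''X'' i > 0}"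
    if "v < n" for v
  proof -
    have "holds (freeE (V ''v'')) (store s ''v'' 0 v) \<longleftrightarrow> v \<notin> M \<and>
       (\<forall>i<L. i < k \<longrightarrow> (\<forall>t<L. t < len_of s i \<longrightarrow> phi_of s i t \<noteq> v)) \<and>
       (\<exists>i<L. i < k \<and> s ''X'' i > 0 \<and> (\<exists>t<L. Suc t < len_of s i \<and> phi_of s i t \<notin> M \<and>
          phi_of s i (Suc t) \<notin> M \<and> adj (phi_of s i t) v))"
      using assms by (simp add: freeE_def env_simps store_apply)
    also have "\<dots> \<longleftrightarrow> v \<in> free k (len_of s) (phi_of s) {i. s ''X'' i > 0}"
      using assms(2,3) that unfolding free_def
      by (simp add: all_bounded ex_bounded cong: conj_cong)
    finally show ?thesis .
  qed
  have "{v. v < n \<and> holds (freeE (V ''v'')) (store s ''v'' 0 v)} = free k (len_of s) (phi_of s) {i. s ''X'' i > 0}"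
    using free by (auto simp: free_def)
  moreover have "(\<Sum>i<L. if i < k \<and> s ''X'' i > 0 then Suc l - len_of s i else 0) =
      (\<Sum>i | i < k \<and> 0 < s ''X'' i. Suc l - len_of s i)"
    using assms(2) by (intro sum.mono_neutral_cong_right) auto
  ultimately show ?thesis
    using assms by (simp add: hallE_def hall_def env_simps store_apply not_less cong: if_cong)
qed

lemma checkP:
  assumes "env s"
  shows "den checkP s ''ok'' 0 > 0 \<longleftrightarrow>
    k \<le> L \<and> (\<forall>i<k. len_of s i \<le> L) \<and> valid k l (len_of s) (phi_of s)"
proof -
  let ?W = "Suc L ^ (5 * (L * L))"
  define P where "P \<longleftrightarrow> k \<le> L \<and> (\<forall>i<k. len_of s i \<le> L) \<and> skeleton k l (len_of s) (phi_of s)"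
  define H where "H x \<longleftrightarrow> hall k l (len_of s) (phi_of s) {i. i < k \<and> x div Suc L ^ i mod Suc L > 0}" for x
  \<comment> \<open>If the skeleton is bad, \<open>ok\<close> starts at 0 and is never raised.
    Otherwise everything is bounded by \<open>L\<close>, as \<open>holds_hallE\<close> requires, and
    \<open>ok\<close> records Hall's condition for the sets seen so far.\<close>
  define I where "I j s' \<longleftrightarrow> env s' \<and> len_of s' = len_of s \<and> phi_of s' = phi_of s \<and>
     (if P then (s' ''ok'' 0 > 0 \<longleftrightarrow> (\<forall>x<j. H x)) else s' ''ok'' 0 = 0)" for j s'
  let ?s = "store s ''ok'' 0 (eval skeletonE s)"
  have "I (?s ''W'' 0) (den (For ''x2'' ''W'' (Sq (decodeP ''X'' ''x2'') (When (Neg hallE) (Asg ''ok'' (K 0) (K 0))))) ?s)"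
  proof (rule den_For_inv)
    have "eval skeletonE s > 0 \<longleftrightarrow> P" using holds_skeletonE[OF assms] by (simp add: P_def holds_def)
    then show "I 0 ?s" using assms by (cases P) (auto simp: I_def store_apply)
    fix j s1 assume j: "j < ?s ''W'' 0" and I: "I j s1"
    have j: "j < ?W" using j assms by (simp add: store_apply env_simps)
    let ?s1 = "store s1 ''x2'' 0 j"
    define s2 where "s2 = den (decodeP ''X'' ''x2'') ?s1"
    have "env ?s1" "?s1 ''x2'' 0 = j" using I by (auto simp: I_def store_apply)
    then have X: "s2 ''X'' t = j div Suc L ^ t mod Suc L" if "t < 5 * (L * L)" for t
      unfolding s2_def using decodeP[OF \<open>env ?s1\<close>, of "''x2''" "''X''" t] j that by simp
    have env2: "env s2" unfolding s2_def using \<open>env ?s1\<close> by (subst env_den) auto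
    have "s2 ''D'' = s1 ''D''" "s2 ''phi'' = s1 ''phi''" "s2 ''ok'' = s1 ''ok''"
      unfolding s2_def by (simp_all add: den_frame store_apply)
    then have of2: "len_of s2 = len_of s" "phi_of s2 = phi_of s" "s2 ''ok'' 0 = s1 ''ok'' 0"
      using I by (auto simp: I_def len_of_def phi_of_def fun_eq_iff)
    have "holds hallE s2 \<longleftrightarrow> H j" if P
    proof -
      have kL: "k \<le> L" "\<forall>i<k. len_of s i \<le> L" using that by (auto simp: P_def)
      have "i < 5 * (L * L)" if "i < k" for i
      proof -
        have "i < L" using that kL by simp
        moreover have "L \<le> L * L" by simp
        ultimately show ?thesis by linarith
      qed
      then have "i < k \<Longrightarrow> s2 ''X'' i > 0 \<longleftrightarrow> j div Suc L ^ i mod Suc L > 0" for i using X[of i] by simp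
      then have "{i. s2 ''X'' i > 0} \<inter> {..<k} = {i. i < k \<and> j div Suc L ^ i mod Suc L > 0} \<inter> {..<k}"
        unfolding set_eq_iff mem_Collect_eq Int_iff lessThan_iff by blast
      then have "hall k l (len_of s) (phi_of s) {i. s2 ''X'' i > 0} \<longleftrightarrow> H j"
        unfolding H_def using hall_Int[of k l "len_of s" "phi_of s" "{i. s2 ''X'' i > 0}"]
          hall_Int[of k l "len_of s" "phi_of s" "{i. i < k \<and> j div Suc L ^ i mod Suc L > 0}"] by simp
      then show ?thesis using holds_hallE[OF env2] kL unfolding of2 by simp
    qed
    then show "I (Suc j) (den (Sq (decodeP ''X'' ''x2'') (When (Neg hallE) (Asg ''ok'' (K 0) (K 0)))) ?s1)"
      using I env2 of2 by (auto simp: I_def store_apply less_Suc_eq s2_def[symmetric])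
  qed
  then have I: "I ?W (den checkP s)" using assms by (simp add: checkP_def store_apply env_simps)
  have "(\<forall>x<?W. H x) \<longleftrightarrow> (\<forall>X. hall k l (len_of s) (phi_of s) X)" if P
  proof
    assume all: "\<forall>x<?W. H x"
    show "\<forall>X. hall k l (len_of s) (phi_of s) X"
    proof
      fix X
      have kL: "k \<le> L" using that by (simp add: P_def)
      have "\<exists>w<?W. \<forall>t<5 * (L * L). w div Suc L ^ t mod Suc L = of_bool (t \<in> X \<and> t < k)"
        using kL by (intro digits_exist) (simp add: of_bool_def)
      then obtain w where w: "w < ?W" "\<And>t. t < 5 * (L * L) \<Longrightarrow> w div Suc L ^ t mod Suc L = of_bool (t \<in> X \<and> t < k)"
        by blast
      have "i < 5 * (L * L)" if "i < k" for i
      proof -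
        have "i < L" using that kL by simp
        moreover have "L \<le> L * L" by simp
        ultimately show ?thesis by linarith
      qed
      then have "i < k \<Longrightarrow> w div Suc L ^ i mod Suc L > 0 \<longleftrightarrow> i \<in> X" for i using w(2)[of i] by simp
      then have "{i. i < k \<and> w div Suc L ^ i mod Suc L > 0} = X \<inter> {..<k}"
        unfolding set_eq_iff mem_Collect_eq Int_iff lessThan_iff by blast
      then show "hall k l (len_of s) (phi_of s) X"
        using all[rule_format, OF w(1)] unfolding H_def by (subst hall_Int) simp
    qed
  qed (simp add: H_def)
  then show ?thesis using I by (auto simp: I_def valid_def P_def split: if_splits)
qed

lemma searchP:
  assumes "env s" "s ''out'' 0 = 0"
  shows "den searchP s ''out'' 0 = of_bool (packing k l)"
proof -
  let ?W = "Suc L ^ (5 * (L * L))"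
  \<comment> \<open>For a good \<open>w\<close>, every outcome of the greedy assignment passes the
    check. A packing provides such a \<open>w\<close> by \<open>packing_imp_guess\<close>, while a
    passed check yields a packing for any \<open>w\<close>.\<close>
  define good where "good w \<longleftrightarrow> k \<le> L \<and> (\<exists>D. (\<forall>x<5 * (L * L). D x = w div Suc L ^ x mod Suc L) \<and>
     (\<forall>rep ph. greedy ml D L rep \<longrightarrow> placed ml D L rep ph \<longrightarrow>
     valid k l (\<lambda>i. D (5 * (i * L) + 4)) (\<lambda>i t. ph (i * L + t)) \<and> (\<forall>i<k. D (5 * (i * L) + 4) \<le> L)))" for w
  define I where "I j s' \<longleftrightarrow> env s' \<and> s' ''out'' 0 \<le> 1 \<and> (s' ''out'' 0 = 1 \<longrightarrow> packing k l) \<and>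
     (\<forall>w<j. good w \<longrightarrow> s' ''out'' 0 = 1)" for j s'
  have "I (s ''W'' 0) (den searchP s)"
    unfolding searchP_def
  proof (rule den_For_inv)
    show "I 0 s" using assms by (simp add: I_def)
    fix j s0 assume "j < s ''W'' 0" and I: "I j s0"
    then have j: "j < ?W" using assms by (simp add: env_simps)
    define s1 where "s1 = den (decodeP ''D'' ''w'') (store s0 ''w'' 0 j)"
    define s2 where "s2 = den repP s1"
    define s3 where "s3 = den phiP s2"
    define s4 where "s4 = den checkP s3"
    have env0: "env (store s0 ''w'' 0 j)" using I by (simp add: I_def)
    have env1: "env s1" unfolding s1_def using env0 by (subst env_den) auto
    have env2: "env s2" unfolding s2_def using env1 by (subst env_den) auto
    have env3: "env s3" unfolding s3_def using env2 by (subst env_den) auto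
    have env4: "env s4" unfolding s4_def using env3 by (subst env_den) auto
    have D1: "s1 ''D'' t = j div Suc L ^ t mod Suc L" if "t < 5 * (L * L)" for t
      unfolding s1_def using decodeP[OF env0, of "''w''" "''D''" t] j that by (simp add: store_apply)
    have D2: "s2 ''D'' = s1 ''D''" unfolding s2_def by (simp add: den_frame)
    have D3: "s3 ''D'' = s1 ''D''" "s3 ''rep'' = s2 ''rep''" unfolding s3_def by (simp_all add: den_frame D2)
    have gr: "greedy ml (s1 ''D'') L (s2 ''rep'')" using repP[OF env1] by (simp add: s2_def)
    have pl: "placed ml (s1 ''D'') L (s2 ''rep'') (s3 ''phi'')" using phiP[OF env2] D2 by (simp add: s3_def)
    have out4: "s4 ''out'' = s0 ''out''"
      unfolding s4_def s3_def s2_def s1_def by (simp add: den_frame store_apply)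
    note chk = checkP[OF env3, folded s4_def]
    have sound: "s4 ''ok'' 0 > 0 \<Longrightarrow> packing k l" using chk valid_imp_packing by blast
    have compl: "s4 ''ok'' 0 > 0" if "good j"
    proof -
      from that obtain D where kL: "k \<le> L" and D: "\<And>x. x < 5 * (L * L) \<Longrightarrow> D x = j div Suc L ^ x mod Suc L"
        and ok: "\<And>rep ph. greedy ml D L rep \<Longrightarrow> placed ml D L rep ph \<Longrightarrow>
          valid k l (\<lambda>i. D (5 * (i * L) + 4)) (\<lambda>i t. ph (i * L + t)) \<and> (\<forall>i<k. D (5 * (i * L) + 4) \<le> L)"
        unfolding good_def by blast
      have eq: "s1 ''D'' x = D x" if "x < 5 * (L * L)" for x using D D1 that by simp
      have ok': "valid k l (\<lambda>i. D (5 * (i * L) + 4)) (phi_of s3)" "\<forall>i<k. D (5 * (i * L) + 4) \<le> L"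
        using ok[of "s2 ''rep''" "s3 ''phi''"] gr pl guess_cong[of "s1 ''D''" D, OF eq]
        by (auto simp: phi_of_def[abs_def])
      have len: "len_of s3 i = D (5 * (i * L) + 4)" if "i < k" for i
      proof -
        have "Suc i * L \<le> L * L" using that kL by (intro mult_le_mono1) simp
        moreover have "L > 0" using that kL by simp
        ultimately have "5 * (i * L) + 4 < 5 * (L * L)" by simp
        then show ?thesis using eq by (simp add: len_of_def D3)
      qed
      have "valid k l (\<lambda>i. D (5 * (i * L) + 4)) (phi_of s3) \<longleftrightarrow> valid k l (len_of s3) (phi_of s3)"
        unfolding valid_def skeleton_def hall_def free_def by (simp add: len cong: conj_cong)
      then show ?thesis using chk ok' kL len by simp
    qed
    have "den (Sq (decodeP ''D'' ''w'') (Sq repP (Sq phiP (Sq checkP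
        (When (V ''ok'') (Asg ''out'' (K 0) (K 1))))))) (store s0 ''w'' 0 j) =
        (if s4 ''ok'' 0 > 0 then store s4 ''out'' 0 1 else s4)"
      by (simp add: s1_def s2_def s3_def s4_def)
    then show "I (Suc j) (den (Sq (decodeP ''D'' ''w'') (Sq repP (Sq phiP (Sq checkP
        (When (V ''ok'') (Asg ''out'' (K 0) (K 1))))))) (store s0 ''w'' 0 j))"
      using I env4 out4 sound compl unfolding I_def by (auto simp: store_apply less_Suc_eq)
  qed
  then have I: "I ?W (den searchP s)" using assms by (simp add: env_simps)
  have "\<exists>w<?W. good w" if "packing k l"
  proof -
    from packing_imp_guess[OF that L ml] obtain D where kL: "k \<le> L" and D: "\<And>x. D x \<le> L"
      "\<forall>rep ph. greedy ml D L rep \<longrightarrow> placed ml D L rep ph \<longrightarrow>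
     valid k l (\<lambda>i. D (5 * (i * L) + 4)) (\<lambda>i t. ph (i * L + t)) \<and> (\<forall>i<k. D (5 * (i * L) + 4) \<le> L)" by blast
    have "\<exists>w<?W. \<forall>t<5 * (L * L). w div Suc L ^ t mod Suc L = D t"
      using D(1) by (intro digits_exist) (simp add: less_Suc_eq_le)
    then obtain w where w: "w < ?W" "\<forall>t<5 * (L * L). D t = w div Suc L ^ t mod Suc L" by metis
    have "good w" unfolding good_def using kL D(2) w(2) by blast
    then show ?thesis using w(1) by blast
  qed
  then show ?thesis using I by (auto simp: I_def le_Suc_eq)
qed

end

section \<open>The modulator and the running time\<close>

definition initP :: prog where
  "initP = For ''v'' ''n'' (Asg ''M'' (V ''v'') (Rd ''A'' (V ''v'')))"

definition tripleP :: prog where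
  "tripleP = When (Conj (Conj (Neg (Rd ''M'' (V ''a''))) (Conj (Neg (Rd ''M'' (V ''b''))) (Neg (Rd ''M'' (V ''c'')))))
       (Conj (Conj (AdjE (V ''a'') (V ''b'')) (AdjE (V ''b'') (V ''c'')))
          (Conj (Neg (Eq (V ''a'') (V ''c''))) (Neg (AdjE (V ''a'') (V ''c''))))))
     (Sq (Asg ''M'' (V ''a'') (K 1)) (Sq (Asg ''M'' (V ''b'') (K 1)) (Asg ''M'' (V ''c'') (K 1))))"

text \<open>One sweep over all triples suffices: marks are never removed, so a triple once hit stays
  hit.\<close>

definition markP :: prog where
  "markP = For ''a'' ''n'' (For ''b'' ''n'' (For ''c'' ''n'' tripleP))"

definition listP :: prog where
  "listP = For ''v'' ''n'' (When (Rd ''M'' (V ''v''))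
     (Sq (Asg ''ml'' (V ''m'') (V ''v'')) (Asg ''m'' (K 0) (SucE (V ''m'')))))"

definition modulatorP :: prog where
  "modulatorP = Sq initP (Sq markP listP)"

definition lengthP :: prog where
  "lengthP = Asg ''L'' (K 0) (Plus (V ''m'') (Plus (V ''m'') (V ''m'')))"

definition boundsP :: prog where
  "boundsP = Sq (Asg ''B'' (K 0) (SucE (V ''L''))) (Sq (Asg ''LL'' (K 0) (Sum ''z'' ''L'' (V ''L'')))
     (Asg ''LL5'' (K 0) (Plus (V ''LL'') (Plus (Plus (V ''LL'') (V ''LL'')) (Plus (V ''LL'') (V ''LL''))))))"

definition powerP :: prog where
  "powerP = Sq (Asg ''W'' (K 0) (K 1)) (For ''t'' ''LL5'' (Asg ''W'' (K 0) (Sum ''z'' ''B'' (V ''W''))))"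

lemma den_boundsP:
  "den boundsP s ''L'' 0 = s ''L'' 0" "den boundsP s ''B'' 0 = Suc (s ''L'' 0)"
  "den boundsP s ''LL'' 0 = s ''L'' 0 * s ''L'' 0" "den boundsP s ''LL5'' 0 = 5 * (s ''L'' 0 * s ''L'' 0)"
  by (simp_all add: boundsP_def SucE_def store_apply)

lemma den_powerP: "den powerP s ''W'' 0 = s ''B'' 0 ^ s ''LL5'' 0"
proof -
  define I where "I j s' \<longleftrightarrow> s' ''B'' 0 = s ''B'' 0 \<and> s' ''W'' 0 = s ''B'' 0 ^ j" for j and s' :: state
  let ?s = "store s ''W'' 0 1"
  have "I (?s ''LL5'' 0) (den (For ''t'' ''LL5'' (Asg ''W'' (K 0) (Sum ''z'' ''B'' (V ''W'')))) ?s)"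
    by (rule den_For_inv) (auto simp: I_def store_apply)
  then show ?thesis by (simp add: powerP_def I_def store_apply)
qed

lemma written_stages:
  "written modulatorP = {''v'', ''M'', ''a'', ''b'', ''c'', ''ml'', ''m''}"
  "written lengthP = {''L''}" "written boundsP = {''B'', ''LL'', ''LL5''}" "written powerP = {''W'', ''t''}"
  by (auto simp: modulatorP_def initP_def markP_def tripleP_def listP_def lengthP_def boundsP_def powerP_def)

section \<open>The greedy modulator\<close>

locale graph_instance =
  fixes n :: nat and adj :: "nat \<Rightarrow> nat \<Rightarrow> bool" and A :: "nat set"
  assumes sym: "adj u v \<Longrightarrow> adj v u" and irrefl: "\<not> adj u u" and bound: "adj u v \<Longrightarrow> u < n"
    and A_bound: "A \<subseteq> {..<n}"
begin

definition genv :: "state \<Rightarrow> bool" where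
  "genv s \<longleftrightarrow> s ''n'' 0 = n \<and> (\<forall>u<n. \<forall>v<n. s ''adj'' (n * u + v) > 0 \<longleftrightarrow> adj u v) \<and>
     (\<forall>v. s ''A'' v > 0 \<longleftrightarrow> v \<in> A)"

lemma genv_store [simp]: "x \<notin> {''n'', ''adj'', ''A''} \<Longrightarrow> genv (store s x i v) = genv s"
  by (simp add: genv_def store_apply)

lemma holds_AdjE_genv [simp]:
  assumes "genv s" "fresh ''z'' a"
  shows "holds (AdjE a b) s \<longleftrightarrow> adj (eval a s) (eval b s)"
proof -
  have "adj (eval a s) (eval b s) \<Longrightarrow> eval a s < n \<and> eval b s < n" using bound sym by blast
  then show ?thesis using assms by (auto simp: AdjE_def genv_def)
qed

definition marked :: "state \<Rightarrow> nat set" where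
  "marked s = {v. s ''M'' v > 0}"

text \<open>Shared by all cluster deletion sets (\<open>cluster_hits\<close>) and by the final set
  of marked vertices (\<open>markP\<close>).\<close>

definition hits_p3s :: "nat set \<Rightarrow> bool" where
  "hits_p3s S \<longleftrightarrow> (\<forall>a b c. adj a b \<and> adj b c \<and> a \<noteq> c \<and> \<not> adj a c \<longrightarrow> a \<in> S \<or> b \<in> S \<or> c \<in> S)"

text \<open>The bound counts \<open>S \<inter> marked s\<close> rather than \<open>S\<close> to be
  inductive: a newly marked triple adds three vertices, at least one of which lies in
  \<open>S\<close> and was not marked before, so the right side grows by at least three too.\<close>

definition good :: "state \<Rightarrow> bool" where
  "good s \<longleftrightarrow> genv s \<and> A \<subseteq> marked s \<and> marked s \<subseteq> {..<n} \<and>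
     (\<forall>S. hits_p3s S \<longrightarrow> card (marked s) \<le> card A + 3 * card (S \<inter> marked s))"

definition p3_hit :: "state \<Rightarrow> nat \<Rightarrow> nat \<Rightarrow> nat \<Rightarrow> bool" where
  "p3_hit s a b c \<longleftrightarrow> (adj a b \<and> adj b c \<and> a \<noteq> c \<and> \<not> adj a c \<longrightarrow> a \<in> marked s \<or> b \<in> marked s \<or> c \<in> marked s)"

lemma marked_store [simp]: "x \<noteq> ''M'' \<Longrightarrow> marked (store s x i v) = marked s"
  by (simp add: marked_def store_apply)

lemma marked_insert [simp]: "marked (store s ''M'' i 1) = insert i (marked s)"
  "marked (store s ''M'' i (Suc 0)) = insert i (marked s)"
  by (auto simp: marked_def store_apply)

lemma good_store [simp]: "x \<notin> {''n'', ''adj'', ''A'', ''M''} \<Longrightarrow> good (store s x i v) = good s"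
  by (simp add: good_def)

lemma p3_hit_store [simp]: "x \<noteq> ''M'' \<Longrightarrow> p3_hit (store s x i v) = p3_hit s"
  by (auto simp: p3_hit_def fun_eq_iff)

lemma p3_hit_mono: "p3_hit s a b c \<Longrightarrow> marked s \<subseteq> marked s' \<Longrightarrow> p3_hit s' a b c"
  by (auto simp: p3_hit_def)

lemma tripleP:
  assumes "good s" "a = s ''a'' 0" "b = s ''b'' 0" "c = s ''c'' 0"
  shows "good (den tripleP s)" "marked s \<subseteq> marked (den tripleP s)" "p3_hit (den tripleP s) a b c"
proof -
  let ?P = "a \<notin> marked s \<and> b \<notin> marked s \<and> c \<notin> marked s \<and> adj a b \<and> adj b c \<and> a \<noteq> c \<and> \<not> adj a c"
  have env: "genv s" using assms(1) by (simp add: good_def)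
  let ?s = "store (store (store s ''M'' a 1) ''M'' b 1) ''M'' c 1"
  have den: "den tripleP s = (if ?P then ?s else s)"
    using env assms(2-4) by (simp add: tripleP_def store_apply) (auto simp: marked_def)
  have m: "marked ?s = insert c (insert b (insert a (marked s)))" by simp
  have "good ?s" if P: ?P
  proof -
    have lt: "a < n" "b < n" "c < n" using P bound sym by blast+
    have fin: "finite (marked s)" using assms(1) finite_subset by (auto simp: good_def)
    have "card (marked ?s) \<le> card A + 3 * card (S \<inter> marked ?s)" if S: "hits_p3s S" for S
    proof -
      have "card (marked s) \<le> card A + 3 * card (S \<inter> marked s)" using assms(1) S by (simp add: good_def)
      moreover have "card (marked ?s) \<le> 3 + card (marked s)" unfolding m using fin
        by (simp add: card_insert_if)
      moreover have "card (S \<inter> marked s) < card (S \<inter> marked ?s)"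
      proof (rule psubset_card_mono)
        have "a \<in> S \<or> b \<in> S \<or> c \<in> S" using S P by (auto simp: hits_p3s_def)
        then show "S \<inter> marked s \<subset> S \<inter> marked ?s" unfolding m using P by auto
      qed (use fin in \<open>simp add: m\<close>)
      ultimately show ?thesis by linarith
    qed
    then show ?thesis using assms(1) lt unfolding good_def m by (auto simp: genv_def store_apply)
  qed
  then show "good (den tripleP s)" using den assms(1) by simp
  show "marked s \<subseteq> marked (den tripleP s)" using den m by auto
  show "p3_hit (den tripleP s) a b c" unfolding den p3_hit_def using m by auto
qed

lemma markP:
  assumes "good s"
  shows "good (den markP s)" "hits_p3s (marked (den markP s))"
proof -
  have sn: "s' ''n'' 0 = n" if "good s'" for s' using that by (simp add: good_def genv_def)
  \<comment> \<open>\<open>I\<close>, \<open>J\<close> and \<open>H\<close> are the invariants of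
    the outer, middle and inner loop; each adds the triples met in the current round of the loop
    around it.\<close>
  define I where "I a s' \<longleftrightarrow> good s' \<and> (\<forall>a'<a. \<forall>b'<n. \<forall>c'<n. p3_hit s' a' b' c')" for a s'
  define J where "J a b s' \<longleftrightarrow> I a s' \<and> s' ''a'' 0 = a \<and> (\<forall>b'<b. \<forall>c'<n. p3_hit s' a b' c')" for a b s'
  define H where "H a b c s' \<longleftrightarrow> J a b s' \<and> s' ''b'' 0 = b \<and> (\<forall>c'<c. p3_hit s' a b c')" for a b c s'
  have stepH: "H a b (Suc c) (den tripleP (store s' ''c'' 0 c))" if H: "H a b c s'" for a b c s'
  proof -
    let ?s = "store s' ''c'' 0 c"
    have g: "good ?s" "?s ''a'' 0 = a" "?s ''b'' 0 = b" "?s ''c'' 0 = c"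
      using H by (auto simp: H_def J_def I_def store_apply)
    note t = tripleP[OF g(1) g(2-4)[symmetric]]
    have mono: "p3_hit s' x y z \<Longrightarrow> p3_hit (den tripleP ?s) x y z" for x y z
      using p3_hit_mono[of ?s x y z] t(2) by simp
    have "den tripleP ?s ''a'' = ?s ''a''" "den tripleP ?s ''b'' = ?s ''b''"
      by (rule den_frame, simp add: tripleP_def)+
    then show ?thesis using H t mono g unfolding H_def J_def I_def by (auto simp: less_Suc_eq)
  qed
  have stepJ: "J a (Suc b) (den (For ''c'' ''n'' tripleP) (store s' ''b'' 0 b))" if J: "J a b s'" for a b s'
  proof -
    let ?s = "store s' ''b'' 0 b"
    have "?s ''n'' 0 = n" using J sn by (auto simp: J_def I_def store_apply)
    moreover have "H a b (?s ''n'' 0) (den (For ''c'' ''n'' tripleP) ?s)"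
    proof (rule den_For_inv)
      show "H a b 0 ?s" using J by (simp add: H_def J_def I_def store_apply)
    qed (rule stepH)
    ultimately show ?thesis by (auto simp: H_def J_def less_Suc_eq)
  qed
  have stepI: "I (Suc a) (den (For ''b'' ''n'' (For ''c'' ''n'' tripleP)) (store s' ''a'' 0 a))" if I: "I a s'" for a s'
  proof -
    let ?s = "store s' ''a'' 0 a"
    have "?s ''n'' 0 = n" using I sn by (auto simp: I_def store_apply)
    moreover have "J a (?s ''n'' 0) (den (For ''b'' ''n'' (For ''c'' ''n'' tripleP)) ?s)"
    proof (rule den_For_inv)
      show "J a 0 ?s" using I by (simp add: J_def I_def store_apply)
    qed (rule stepJ)
    ultimately show ?thesis by (auto simp: J_def I_def less_Suc_eq)
  qed
  have "I (s ''n'' 0) (den markP s)" unfolding markP_def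
  proof (rule den_For_inv)
    show "I 0 s" using assms by (simp add: I_def)
  qed (rule stepI)
  then have I: "I n (den markP s)" using sn[OF assms] by simp
  then show "good (den markP s)" by (simp add: I_def)
  show "hits_p3s (marked (den markP s))" unfolding hits_p3s_def
  proof (intro allI impI)
    fix a b c assume p3: "adj a b \<and> adj b c \<and> a \<noteq> c \<and> \<not> adj a c"
    then have "a < n" "b < n" "c < n" using bound sym by blast+
    then have "p3_hit (den markP s) a b c" using I by (simp add: I_def)
    then show "a \<in> marked (den markP s) \<or> b \<in> marked (den markP s) \<or> c \<in> marked (den markP s)"
      using p3 by (simp add: p3_hit_def)
  qed
qed

lemma initP:
  assumes "genv s" "s ''M'' = (\<lambda>_. 0)"
  shows "good (den initP s)"
proof -
  define I where "I j s' \<longleftrightarrow> genv s' \<and> marked s' = {v \<in> A. v < j}" for j s'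
  have "I (s ''n'' 0) (den initP s)" unfolding initP_def
  proof (rule den_For_inv)
    show "I 0 s" using assms by (auto simp: I_def marked_def)
    fix j s' assume I: "I j s'"
    then have "s' ''A'' j > 0 \<longleftrightarrow> j \<in> A" by (simp add: I_def genv_def)
    moreover have "v \<in> marked s' \<longleftrightarrow> v \<in> A \<and> v < j" for v using I by (simp add: I_def)
    then have "s' ''M'' v > 0 \<longleftrightarrow> v \<in> A \<and> v < j" for v by (simp add: marked_def)
    ultimately show "I (Suc j) (den (Asg ''M'' (V ''v'') (Rd ''A'' (V ''v''))) (store s' ''v'' 0 j))"
      using I by (auto simp: I_def store_apply marked_def less_Suc_eq)
  qed
  moreover have "s ''n'' 0 = n" using assms by (simp add: genv_def)
  moreover have "{v \<in> A. v < n} = A" using A_bound by auto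
  ultimately have "genv (den initP s)" "marked (den initP s) = A" by (auto simp: I_def)
  then show ?thesis using A_bound by (simp add: good_def)
qed

lemma listP:
  assumes "genv s" "marked s = M" "M \<subseteq> {..<n}" "s ''m'' 0 = 0"
  shows "den listP s ''m'' 0 = card M" "x \<in> M \<Longrightarrow> \<exists>a<card M. den listP s ''ml'' a = x"
proof -
  define I where "I j s' \<longleftrightarrow> s' ''M'' = s ''M'' \<and> s' ''m'' 0 = card {v \<in> M. v < j} \<and>
    (\<forall>v\<in>M. v < j \<longrightarrow> (\<exists>a<s' ''m'' 0. s' ''ml'' a = v))" for j s'
  have "I (s ''n'' 0) (den listP s)" unfolding listP_def
  proof (rule den_For_inv)
    show "I 0 s" using assms by (simp add: I_def)
    fix j s' assume I: "I j s'"
    let ?b = "When (Rd ''M'' (V ''v'')) (Sq (Asg ''ml'' (V ''m'') (V ''v'')) (Asg ''m'' (K 0) (SucE (V ''m''))))"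
    have jM: "s' ''M'' j > 0 \<longleftrightarrow> j \<in> M" using I assms(2) by (auto simp: I_def marked_def)
    show "I (Suc j) (den ?b (store s' ''v'' 0 j))"
    proof (cases "j \<in> M")
      case False
      then have "{v \<in> M. v < Suc j} = {v \<in> M. v < j}" by (auto simp: less_Suc_eq)
      then show ?thesis using False I jM by (auto simp: I_def store_apply less_Suc_eq)
    next
      case True
      then have "{v \<in> M. v < Suc j} = insert j {v \<in> M. v < j}" by (auto simp: less_Suc_eq)
      then have c: "card {v \<in> M. v < Suc j} = Suc (card {v \<in> M. v < j})" by simp
      let ?m = "s' ''m'' 0"
      define s1 where "s1 = den ?b (store s' ''v'' 0 j)"
      have s1: "s1 ''M'' = s ''M''" "s1 ''m'' 0 = Suc ?m" "s1 ''ml'' = (s' ''ml'')(?m := j)"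
        using True jM I by (simp_all add: s1_def SucE_def store_apply I_def)
      have "\<exists>a<Suc ?m. ((s' ''ml'')(?m := j)) a = v" if v: "v \<in> M" "v < Suc j" for v
      proof (cases "v = j")
        case True
        then show ?thesis by (intro exI[of _ ?m]) simp
      next
        case False
        then obtain a where "a < ?m" "s' ''ml'' a = v" using v I by (auto simp: I_def less_Suc_eq)
        then show ?thesis by (intro exI[of _ a]) simp
      qed
      then show ?thesis unfolding s1_def[symmetric] using s1 I c by (simp add: I_def)
    qed
  qed
  moreover have "s ''n'' 0 = n" using assms by (simp add: genv_def)
  moreover have "{v \<in> M. v < n} = M" using assms(3) by auto
  ultimately have *: "I n (den listP s)" "{v \<in> M. v < n} = M" by auto
  then show m: "den listP s ''m'' 0 = card M" by (simp add: I_def)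
  show "\<exists>a<card M. den listP s ''ml'' a = x" if "x \<in> M"
  proof -
    have "x < n" using that assms(3) by auto
    then show ?thesis using * that m by (simp add: I_def)
  qed
qed

lemma modulatorP:
  assumes "genv s" "s ''M'' = (\<lambda>_. 0)" "s ''m'' 0 = 0"
  defines "s' \<equiv> den modulatorP s"
  defines "M \<equiv> marked s'"
  shows "A \<subseteq> M" "M \<subseteq> {..<n}" "hits_p3s M" "hits_p3s S \<Longrightarrow> finite S \<Longrightarrow> card M \<le> card A + 3 * card S"
    "s' ''m'' 0 = card M" "x \<in> M \<Longrightarrow> \<exists>a<card M. s' ''ml'' a = x"
proof -
  define s1 where "s1 = den markP (den initP s)"
  have s': "s' = den listP s1" by (simp add: s'_def modulatorP_def s1_def)
  note g = markP[OF initP[OF assms(1,2)], folded s1_def]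
  have "s' ''M'' = s1 ''M''" unfolding s' by (simp add: den_frame listP_def)
  then have M: "marked s1 = M" by (simp add: M_def marked_def)
  show "A \<subseteq> M" "M \<subseteq> {..<n}" "hits_p3s M" using g M by (auto simp: good_def)
  show "card M \<le> card A + 3 * card S" if "hits_p3s S" "finite S"
  proof -
    have "card M \<le> card A + 3 * card (S \<inter> M)" using g(1) M that by (auto simp: good_def)
    also have "card (S \<inter> M) \<le> card S" using that by (intro card_mono) auto
    finally show ?thesis by simp
  qed
  have "s1 ''m'' 0 = 0" using assms(3)
    unfolding s1_def by (simp add: den_frame markP_def tripleP_def initP_def)
  moreover have "genv s1" using g by (simp add: good_def)
  ultimately show "s' ''m'' 0 = card M" "x \<in> M \<Longrightarrow> \<exists>a<card M. s' ''ml'' a = x"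
    unfolding s' using listP[OF _ M] \<open>M \<subseteq> {..<n}\<close> by auto
qed

end

lemma cluster_hits:
  assumes "disjoint_union_of_cliques (delete_verts G S)"
    and "a \<notin> S" "b \<notin> S" "c \<notin> S" "(a, b) \<in> parcs G" "(b, c) \<in> parcs G" "a \<noteq> c"
  shows "(a, c) \<in> parcs G"
proof -
  from assms(1) obtain \<C> where C: "partition_on (pverts G - S) \<C>"
    "{(u, v) \<in> parcs G. u \<notin> S \<and> v \<notin> S} = {(u, v). u \<noteq> v \<and> (\<exists>C\<in>\<C>. u \<in> C \<and> v \<in> C)}"
    by (auto simp: disjoint_union_of_cliques_def delete_verts_def)
  have "(a, b) \<in> {(u, v). u \<noteq> v \<and> (\<exists>C\<in>\<C>. u \<in> C \<and> v \<in> C)}"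
    "(b, c) \<in> {(u, v). u \<noteq> v \<and> (\<exists>C\<in>\<C>. u \<in> C \<and> v \<in> C)}"
    using assms(2-6) unfolding C(2)[symmetric] by auto
  then obtain C1 C2 where CC: "C1 \<in> \<C>" "a \<in> C1" "b \<in> C1" "C2 \<in> \<C>" "b \<in> C2" "c \<in> C2" by auto
  have "C1 = C2" using partition_onD2[OF C(1)] CC by (meson disjointD disjoint_iff)
  then have "(a, c) \<in> {(u, v). u \<noteq> v \<and> (\<exists>C\<in>\<C>. u \<in> C \<and> v \<in> C)}" using CC assms(7) by auto
  then show ?thesis unfolding C(2)[symmetric] by auto
qed

locale path_instance =
  fixes I :: path_packing_instance
  assumes I: "I \<in> path_packing_instances"
begin

abbreviation "G \<equiv> inst_graph I"
abbreviation "n \<equiv> inst_order I"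
abbreviation "A \<equiv> inst_terminals I"
abbreviation "k \<equiv> inst_number I"
abbreviation "l \<equiv> inst_length I"

definition adj :: "nat \<Rightarrow> nat \<Rightarrow> bool" where "adj u v \<longleftrightarrow> (u, v) \<in> parcs G"

sublocale pair_graph G
  using I by (simp add: path_packing_instances_def)

lemma verts: "pverts G = {..<n}"
  using I by (simp add: path_packing_instances_def)

sublocale graph_instance n adj A
proof
  show "adj u v \<Longrightarrow> adj v u" for u v
    using pair_sym_arcs arcs_symmetric unfolding adj_def by blast
  show "\<not> adj u u" for u using pair_no_loops unfolding adj_def by fastforce
  show "adj u v \<Longrightarrow> u < n" for u v using in_arcsD1 verts unfolding adj_def by blast
  show "A \<subseteq> {..<n}" using I verts by (auto simp: path_packing_instances_def)
qed

text \<open>Deleting all vertices leaves the empty graph, so the minimum in \<open>cvd\<close> is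
  attained.\<close>

lemma cvd_hits: "\<exists>S. finite S \<and> card S = cvd G \<and> hits_p3s S"
proof -
  have "delete_verts G (pverts G) = \<lparr>pverts = {}, parcs = {}\<rparr>"
    using in_arcsD1 by (auto simp: delete_verts_def)
  then have "disjoint_union_of_cliques (delete_verts G (pverts G))"
    by (auto simp: disjoint_union_of_cliques_def partition_on_def disjoint_def intro!: exI[of _ "{}"])
  then have "\<exists>m. \<exists>S\<subseteq>pverts G. card S = m \<and> disjoint_union_of_cliques (delete_verts G S)" by blast
  from LeastI_ex[OF this] obtain S where
    S: "S \<subseteq> pverts G" "card S = cvd G" "disjoint_union_of_cliques (delete_verts G S)"
    unfolding cvd_def[symmetric] by blast
  have "hits_p3s S" using cluster_hits[OF S(3)] unfolding hits_p3s_def adj_def by blast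
  moreover have "finite S" using S(1) pair_finite_verts finite_subset by blast
  ultimately show ?thesis using S(2) by blast
qed

text \<open>A row-major index determines row and column by division with remainder, as columns are
  below \<open>n\<close>.\<close>

lemma genv_encode: "genv (encode_instance I)"
proof -
  have "(\<exists>(x, y)\<in>parcs G. n * u + v = x * n + y) \<longleftrightarrow> adj u v" if uv: "u < n" "v < n" for u v
  proof
    assume "\<exists>(x, y)\<in>parcs G. n * u + v = x * n + y"
    then obtain x y where xy: "(x, y) \<in> parcs G" "n * u + v = n * x + y" by (auto simp: mult.commute)
    then have "y < n" using in_arcsD2 verts by blast
    have quot: "r < N \<Longrightarrow> (N * q + r) div N = q" for N q r :: nat by simp
    have "x = u" using quot[OF uv(2), of u] quot[OF \<open>y < n\<close>, of x] xy(2) by simp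
    moreover have "y = v" using xy(2) calculation by simp
    ultimately show "adj u v" using xy by (simp add: adj_def)
  next
    assume "adj u v"
    then show "\<exists>(x, y)\<in>parcs G. n * u + v = x * n + y"
      by (intro bexI[of _ "(u, v)"]) (auto simp: adj_def mult.commute)
  qed
  then show ?thesis by (simp add: genv_def encode_instance_def)
qed

lemma a_path_iff:
  "a_path G A p \<longleftrightarrow> distinct p \<and> set p \<subseteq> {..<n} \<and> (\<forall>(u, v)\<in>set (vwalk_arcs p). adj u v) \<and>
     hd p \<noteq> last p \<and> set p \<inter> A = {hd p, last p}"
proof (cases "p = [] \<or> hd p = last p")
  case True
  then show ?thesis by (auto simp: a_path_def vpath_def vwalk_def)
next
  case False
  define m where "m = butlast (tl p)"
  have p: "p = hd p # m @ [last p]"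
    using False unfolding m_def by (cases p) (auto split: if_splits)
  have set_p: "set p = insert (hd p) (insert (last p) (set m))" by (subst p) auto
  have dist: "distinct p \<Longrightarrow> hd p \<notin> set m \<and> last p \<notin> set m" by (subst (asm) p) auto
  have arcs: "set (vwalk_arcs p) \<subseteq> parcs G \<longleftrightarrow> (\<forall>(u, v)\<in>set (vwalk_arcs p). adj u v)"
    by (auto simp: adj_def)
  have "hd p \<in> A \<and> last p \<in> A \<and> set m \<subseteq> pverts G - A \<longleftrightarrow> set p \<inter> A = {hd p, last p}"
    if "distinct p" "set p \<subseteq> pverts G"
  proof -
    have "set p \<inter> A = {hd p, last p} \<longleftrightarrow> hd p \<in> A \<and> last p \<in> A \<and> set m \<inter> A = {}"
      using dist[OF that(1)] unfolding set_p set_eq_iff Int_iff insert_iff empty_iff by metis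
    moreover have "set m \<subseteq> pverts G" using that(2) unfolding set_p by blast
    ultimately show ?thesis by blast
  qed
  then show ?thesis
    using False unfolding a_path_def vpath_def vwalk_def m_def[symmetric] with_proj_simps arcs verts[symmetric]
    by blast
qed

lemma yes_iff:
  assumes "cluster_instance n adj A M"
  shows "path_packing_yes I \<longleftrightarrow> cluster_instance.packing n adj A k l"
proof -
  interpret C: cluster_instance n adj A M by (rule assms)
  have ap: "a_path G A p \<longleftrightarrow> C.apath p" for p by (simp add: a_path_iff C.apath_def)
  have ne: "p \<noteq> []" if "C.apath p" for p using that by (auto simp: C.apath_def)
  have len: "vwalk_length p = l \<longleftrightarrow> length p = Suc l" if "C.apath p" for p
    using ne[OF that] by (cases p) auto
  show ?thesis unfolding path_packing_yes_def has_a_path_packing_def C.packing_def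
  proof
    assume "\<exists>P. finite P \<and> card P = k \<and> (\<forall>p\<in>P. a_path G A p \<and> vwalk_length p = l) \<and>
      pairwise (\<lambda>p q. set p \<inter> set q = {}) P"
    then obtain P where P: "finite P" "card P = k" "\<And>p. p \<in> P \<Longrightarrow> C.apath p \<and> length p = Suc l"
      "pairwise (\<lambda>p q. set p \<inter> set q = {}) P" using ap len by blast
    obtain h where h: "bij_betw h {0..<k} P" using ex_bij_betw_nat_finite[OF P(1)] P(2) by auto
    have "h i \<in> P" if "i < k" for i using h that by (auto simp: bij_betw_def)
    moreover have "h i \<noteq> h j" if "i < k" "j < k" "i \<noteq> j" for i j
      using h that by (auto simp: bij_betw_def inj_on_def)
    ultimately show "\<exists>p. (\<forall>i<k. C.apath (p i) \<and> length (p i) = Suc l) \<and>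
        (\<forall>i<k. \<forall>j<k. i \<noteq> j \<longrightarrow> set (p i) \<inter> set (p j) = {})"
      using P(3,4) unfolding pairwise_def by (intro exI[of _ h]) blast
  next
    assume "\<exists>p. (\<forall>i<k. C.apath (p i) \<and> length (p i) = Suc l) \<and>
        (\<forall>i<k. \<forall>j<k. i \<noteq> j \<longrightarrow> set (p i) \<inter> set (p j) = {})"
    then obtain p where p: "\<And>i. i < k \<Longrightarrow> C.apath (p i) \<and> length (p i) = Suc l"
      "\<And>i j. i < k \<Longrightarrow> j < k \<Longrightarrow> i \<noteq> j \<Longrightarrow> set (p i) \<inter> set (p j) = {}" by blast
    \<comment> \<open>Paths are nonempty, so disjoint ones are distinct, and the indexed family is a
      set of exactly \<open>k\<close> paths.\<close>
    have "inj_on p {..<k}"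
    proof (rule inj_onI)
      fix i j assume ij: "i \<in> {..<k}" "j \<in> {..<k}" "p i = p j"
      then have "set (p i) \<noteq> {}" using p(1)[of i] ne[of "p i"] by simp
      then show "i = j" using p(2)[of i j] ij by auto
    qed
    then have "card (p ` {..<k}) = k" by (simp add: card_image)
    moreover have "pairwise (\<lambda>p q. set p \<inter> set q = {}) (p ` {..<k})"
      using p(2) unfolding pairwise_def by (metis imageE lessThan_iff)
    ultimately show "\<exists>P. finite P \<and> card P = k \<and> (\<forall>p\<in>P. a_path G A p \<and> vwalk_length p = l) \<and>
      pairwise (\<lambda>p q. set p \<inter> set q = {}) P"
      using p(1) ap len by (intro exI[of _ "p ` {..<k}"]) auto
  qed
qed

end

text \<open>The sum dominates every loop bound of the search other than \<open>n\<close>: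
  \<open>L\<close>, \<open>L * L\<close>, \<open>Suc L\<close>, \<open>5 * (L * L)\<close> and the
  number of guesses. The constant 34 also covers the threshold 32 of the cost lemmas.\<close>

definition bnd :: "nat \<Rightarrow> nat" where
  "bnd L = 34 + (L + (5 * (L * L) + Suc L ^ (5 * (L * L))))"

lemma bnd_mono: "L \<le> L' \<Longrightarrow> bnd L \<le> bnd L'"
  unfolding bnd_def by (intro add_mono mult_le_mono order_refl order_trans[OF power_mono power_increasing]) auto

text \<open>The five stages take at most \<open>5 * Z ^ (degree - 1)\<close> steps together; the
  extra 1 absorbs the factor 5.\<close>

definition degree :: nat where
  "degree = pcost modulatorP + pcost lengthP + pcost boundsP + pcost powerP + pcost searchP + 1"

text \<open>A well-formed program may not write its loop bounds, yet \<open>L\<close>,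
  \<open>LL5\<close>, \<open>B\<close> and \<open>W\<close> have to be computed. Hence the stages,
  each looping only over cells fixed by the input or by earlier stages.\<close>

definition solveC :: com where
  "solveC = Seq (cmp_prog 0 modulatorP) (Seq (cmp_prog 0 lengthP) (Seq (cmp_prog 0 boundsP)
     (Seq (cmp_prog 0 powerP) (cmp_prog 0 searchP))))"

lemmas prog_defs = modulatorP_def initP_def markP_def tripleP_def listP_def lengthP_def boundsP_def powerP_def
  searchP_def checkP_def hallE_def freeE_def skeletonE_def SucE_def phiE_def lenE_def phiP_def repP_def
  decodeP_def keyE_def eligE_def feasE_def embE_def candE_def digE_def SimE_def AdjE_def macro_defs

lemma wf_stages:
  "wf_prog {''n''} modulatorP" "wf_prog {} lengthP" "wf_prog {''L''} boundsP" "wf_prog {''B'', ''LL5''} powerP"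
  "wf_prog {''n'', ''L'', ''LL'', ''LL5'', ''B'', ''W''} searchP"
  by (simp_all add: prog_defs)

lemma run_stage:
  assumes "wf_prog R p" "scratch \<notin> R" "\<forall>N\<in>R. s0 N 0 \<le> Z" "32 \<le> Z" "s \<simeq> s0"
  shows "run (cmp_prog d p) s (Z ^ pcost p) (\<lambda>s'. s' \<simeq> den p s0)"
  using run_cmp_prog[OF assms] by (rule run_mono) (auto simp: prog_post_def)

lemma (in path_instance) solveC:
  assumes Z: "Z = max 1 n * bnd (9 * (cvd G + card A))"
  shows "run solveC (encode_instance I) (Z ^ degree) (\<lambda>s'. s' ''out'' 0 = of_bool (path_packing_yes I))"
proof -
  define s0 s1 s2 s3 s4 where "s0 = encode_instance I" and "s1 = den modulatorP s0" and "s2 = den lengthP s1"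
    and "s3 = den boundsP s2" and "s4 = den powerP s3"
  note defs = s1_def s2_def s3_def s4_def
  define M where "M = marked s1"
  define L where "L = 3 * card M"
  have enc: "s0 ''n'' 0 = n" "s0 ''k'' 0 = k" "s0 ''l'' 0 = l" "s0 ''M'' = (\<lambda>_. 0)" "s0 ''m'' 0 = 0" "s0 ''out'' 0 = 0"
    by (auto simp: s0_def encode_instance_def fun_eq_iff)
  have genv: "genv s0" unfolding s0_def by (rule genv_encode)
  note md = modulatorP[OF genv enc(4,5), folded s1_def, folded M_def]
  obtain S where S: "finite S" "card S = cvd G" "hits_p3s S" using cvd_hits by blast
  have "card M \<le> card A + 3 * cvd G" using md(4)[OF S(3,1)] S(2) by simp
  \<comment> \<open>The 9 is the 3 of \<open>L = 3 * card M\<close> times the 3 of the greedily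
    chosen triples.\<close>
  then have Lb: "L \<le> 9 * (cvd G + card A)" by (simp add: L_def)
  interpret C: cluster_instance n adj A M
  proof
    show "adj u w" if "u \<notin> M" "v \<notin> M" "w \<notin> M" "adj u v" "adj v w" "u \<noteq> w" for u v w
      using md(3) that unfolding hits_p3s_def by blast
  qed (fact sym irrefl bound md)+
  interpret P: search_instance n adj A M k l L "s1 ''ml''"
    by standard (use md L_def in auto)
  have frame: "x \<notin> {''v'', ''M'', ''a'', ''b'', ''c'', ''ml'', ''m''} \<Longrightarrow> s1 x = s0 x"
    "x \<noteq> ''L'' \<Longrightarrow> s2 x = s1 x" "x \<notin> {''B'', ''LL'', ''LL5''} \<Longrightarrow> s3 x = s2 x"
    "x \<notin> {''W'', ''t''} \<Longrightarrow> s4 x = s3 x" for x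
    unfolding defs by (rule den_frame, simp add: written_stages)+
  have "s2 ''L'' 0 = L" using md(5) by (simp add: s2_def lengthP_def L_def store_apply)
  then have s3v: "s3 ''L'' 0 = L" "s3 ''B'' 0 = Suc L" "s3 ''LL'' 0 = L * L" "s3 ''LL5'' 0 = 5 * (L * L)"
    by (simp_all add: s3_def den_boundsP)
  then have s4v: "s4 ''L'' 0 = L" "s4 ''B'' 0 = Suc L" "s4 ''LL'' 0 = L * L" "s4 ''LL5'' 0 = 5 * (L * L)"
    "s4 ''W'' 0 = Suc L ^ (5 * (L * L))"
    by (simp_all add: frame(4)) (simp add: s4_def den_powerP)
  have s4f: "s4 x = s0 x" if "x \<in> {''n'', ''k'', ''l'', ''adj'', ''A'', ''out''}" for x
    using that by (auto simp: frame)
  have s4M: "s4 ''M'' = s1 ''M''" "s4 ''ml'' = s1 ''ml''" by (auto simp: frame)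
  have "P.env s4" unfolding P.env_def
    using genv enc s4v s4M by (simp add: s4f genv_def M_def marked_def)
  moreover have "s4 ''out'' 0 = 0" using enc by (simp add: s4f)
  ultimately have out: "den searchP s4 ''out'' 0 = of_bool (path_packing_yes I)"
    using P.searchP yes_iff[OF C.cluster_instance_axioms] by simp
  have "bnd L \<le> Z"
  proof -
    have "bnd L \<le> 1 * bnd (9 * (cvd G + card A))" using bnd_mono[OF Lb] by simp
    also have "\<dots> \<le> Z" unfolding Z by (intro mult_le_mono1) simp
    finally show ?thesis .
  qed
  moreover have "L * L \<le> 5 * (L * L)" by simp
  ultimately have b: "32 \<le> Z" "L \<le> Z" "Suc L \<le> Z" "L * L \<le> Z" "5 * (L * L) \<le> Z" "Suc L ^ (5 * (L * L)) \<le> Z"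
    unfolding bnd_def by linarith+
  have nZ: "n \<le> Z"
  proof -
    have "n * 1 \<le> max 1 n * bnd (9 * (cvd G + card A))" by (intro mult_le_mono) (auto simp: bnd_def)
    then show ?thesis by (simp add: Z)
  qed
  have s4n: "s4 ''n'' 0 = n" using enc by (simp add: s4f)
  have r1: "run (cmp_prog 0 modulatorP) s0 (Z ^ pcost modulatorP) (\<lambda>s'. s' \<simeq> s1)"
    unfolding s1_def by (rule run_stage[OF wf_stages(1) _ _ b(1)]) (use enc nZ in auto)
  have r2: "run (cmp_prog 0 lengthP) s (Z ^ pcost lengthP) (\<lambda>s'. s' \<simeq> s2)" if "s \<simeq> s1" for s
    unfolding s2_def by (rule run_stage[OF wf_stages(2) _ _ b(1) that]) auto
  have r3: "run (cmp_prog 0 boundsP) s (Z ^ pcost boundsP) (\<lambda>s'. s' \<simeq> s3)" if "s \<simeq> s2" for s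
    unfolding s3_def by (rule run_stage[OF wf_stages(3) _ _ b(1) that]) (use \<open>s2 ''L'' 0 = L\<close> b in auto)
  have r4: "run (cmp_prog 0 powerP) s (Z ^ pcost powerP) (\<lambda>s'. s' \<simeq> s4)" if "s \<simeq> s3" for s
    unfolding s4_def by (rule run_stage[OF wf_stages(4) _ _ b(1) that]) (use s3v b in auto)
  have r5: "run (cmp_prog 0 searchP) s (Z ^ pcost searchP) (\<lambda>s'. s' ''out'' 0 = of_bool (path_packing_yes I))"
    if "s \<simeq> s4" for s
  proof (rule run_mono[OF run_stage[OF wf_stages(5) _ _ b(1) that] order_refl])
    show "\<And>s'. s' \<simeq> den searchP s4 \<Longrightarrow> s' ''out'' 0 = of_bool (path_packing_yes I)"
      using out by (simp add: agree_def)
  qed (use s4n s4v nZ b in auto)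
  let ?T = "\<lambda>p. Z ^ pcost p"
  have "run solveC s0 (?T modulatorP + (?T lengthP + (?T boundsP + (?T powerP + ?T searchP))))
     (\<lambda>s'. s' ''out'' 0 = of_bool (path_packing_yes I))"
    unfolding solveC_def
    by (rule run_Seq[OF r1 run_Seq[OF r2 run_Seq[OF r3 run_Seq[OF r4 r5]]]]) (assumption | rule order_refl)+
  moreover have "?T modulatorP + (?T lengthP + (?T boundsP + (?T powerP + ?T searchP))) \<le> Z ^ degree"
  proof -
    define q where "q = degree - 1"
    have "?T modulatorP \<le> Z ^ q" "?T lengthP \<le> Z ^ q" "?T boundsP \<le> Z ^ q" "?T powerP \<le> Z ^ q"
      "?T searchP \<le> Z ^ q"
      using b(1) by (auto intro!: power_increasing simp: q_def degree_def)
    then have "?T modulatorP + (?T lengthP + (?T boundsP + (?T powerP + ?T searchP))) \<le> 5 * Z ^ q"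
      by linarith
    also have "\<dots> \<le> Z * Z ^ q" using b(1) by simp
    also have "\<dots> = Z ^ degree" by (simp add: q_def degree_def)
    finally show ?thesis .
  qed
  ultimately show ?thesis unfolding s0_def by (rule run_mono)
qed

definition time_bound :: "nat \<Rightarrow> nat" where
  "time_bound p = bnd (9 * p) ^ degree"

text \<open>The bound itself is computed by programs of the same language. Only termination counts
  here, so \<open>Z\<close> may depend on the input in any way.\<close>

lemma computable_time_bound: "computable time_bound"
proof -
  define p1 where "p1 = Asg ''L'' (K 0) (Sum ''z'' ''nine'' (V ''in''))"
  define p0 where "p0 = Asg ''nine'' (K 0) (K 9)"
  define p2 where "p2 = Sq (Asg ''Z'' (K 0) (Plus (K 34) (Plus (V ''L'') (Plus (V ''LL5'') (V ''W'')))))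
     (Sq (Asg ''d'' (K 0) (K degree)) (Asg ''out'' (K 0) (K 1)))"
  define p3 where "p3 = For ''t'' ''d'' (Asg ''out'' (K 0) (Sum ''z'' ''Z'' (V ''out'')))"
  define c where "c = Seq (cmp_prog 0 p0) (Seq (cmp_prog 0 p1) (Seq (cmp_prog 0 boundsP)
     (Seq (cmp_prog 0 powerP) (Seq (cmp_prog 0 p2) (cmp_prog 0 p3)))))"
  have "\<exists>t s. exec c (input_state n) t s \<and> s ''out'' 0 = time_bound n" for n
  proof -
    define s0 s1 s2 s3 s4 s5 where "s0 = den p0 (input_state n)" and "s1 = den p1 s0" and "s2 = den boundsP s1"
      and "s3 = den powerP s2" and "s4 = den p2 s3" and "s5 = den p3 s4"
    let ?L = "9 * n"
    have "s1 ''L'' 0 = ?L" by (simp add: s0_def s1_def p0_def p1_def input_state_def store_apply)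
    then have s2: "s2 ''L'' 0 = ?L" "s2 ''B'' 0 = Suc ?L" "s2 ''LL5'' 0 = 5 * (?L * ?L)"
      by (simp_all add: s2_def den_boundsP)
    have "s3 x = s2 x" if "x \<notin> {''W'', ''t''}" for x
      using that unfolding s3_def by (intro den_frame) (simp add: written_stages)
    then have s3: "s3 ''L'' 0 = ?L" "s3 ''LL5'' 0 = 5 * (?L * ?L)" "s3 ''W'' 0 = Suc ?L ^ (5 * (?L * ?L))"
      using s2 by (simp_all add: s3_def den_powerP)
    then have s4: "s4 ''Z'' 0 = bnd ?L" "s4 ''d'' 0 = degree" "s4 ''out'' 0 = 1"
      by (simp_all add: s4_def p2_def bnd_def store_apply)
    define J where "J j s' \<longleftrightarrow> s' ''Z'' 0 = bnd ?L \<and> s' ''out'' 0 = bnd ?L ^ j" for j and s' :: state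
    have "J (s4 ''d'' 0) s5" unfolding s5_def p3_def
      by (rule den_For_inv) (use s4 in \<open>auto simp: J_def store_apply\<close>)
    then have out: "s5 ''out'' 0 = time_bound n" using s4 by (simp add: J_def time_bound_def)
    define Z where "Z = 32 + s0 ''nine'' 0 + s1 ''L'' 0 + s2 ''B'' 0 + s2 ''LL5'' 0 + s4 ''Z'' 0 + s4 ''d'' 0"
    have Z: "32 \<le> Z" by (simp add: Z_def)
    have r0: "run (cmp_prog 0 p0) (input_state n) (Z ^ pcost p0) (\<lambda>s'. s' \<simeq> s0)"
      unfolding s0_def by (rule run_stage[where R = "{}", OF _ _ _ Z]) (auto simp: p0_def)
    have r1: "run (cmp_prog 0 p1) s (Z ^ pcost p1) (\<lambda>s'. s' \<simeq> s1)" if "s \<simeq> s0" for s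
      unfolding s1_def by (rule run_stage[where R = "{''nine''}", OF _ _ _ Z that]) (auto simp: p1_def V_def Z_def)
    have r2: "run (cmp_prog 0 boundsP) s (Z ^ pcost boundsP) (\<lambda>s'. s' \<simeq> s2)" if "s \<simeq> s1" for s
      unfolding s2_def by (rule run_stage[OF wf_stages(3) _ _ Z that]) (auto simp: Z_def)
    have r3: "run (cmp_prog 0 powerP) s (Z ^ pcost powerP) (\<lambda>s'. s' \<simeq> s3)" if "s \<simeq> s2" for s
      unfolding s3_def by (rule run_stage[OF wf_stages(4) _ _ Z that]) (auto simp: Z_def)
    have r4: "run (cmp_prog 0 p2) s (Z ^ pcost p2) (\<lambda>s'. s' \<simeq> s4)" if "s \<simeq> s3" for s
      unfolding s4_def by (rule run_stage[where R = "{}", OF _ _ _ Z that]) (auto simp: p2_def V_def)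
    have r5: "run (cmp_prog 0 p3) s (Z ^ pcost p3) (\<lambda>s'. s' \<simeq> s5)" if "s \<simeq> s4" for s
      unfolding s5_def by (rule run_stage[where R = "{''d'', ''Z''}", OF _ _ _ Z that]) (auto simp: p3_def V_def Z_def)
    have "\<exists>T. run c (input_state n) T (\<lambda>s'. s' \<simeq> s5)"
      unfolding c_def
      by (rule exI, rule run_Seq[OF r0 run_Seq[OF r1 run_Seq[OF r2 run_Seq[OF r3 run_Seq[OF r4 r5]]]]])
        (assumption | rule order_refl)+
    then obtain t s where "exec c (input_state n) t s" "s \<simeq> s5" by (auto simp: run_def)
    moreover from this(2) have "s ''out'' 0 = s5 ''out'' 0" by (simp add: agree_def)
    ultimately show ?thesis using out by auto
  qed
  then show ?thesis unfolding computable_def by blast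
qed

theorem theorem2:
  shows "fixed_parameter_tractable path_packing_instances encode_instance inst_order
           (\<lambda>I. cvd (inst_graph I) + card (inst_terminals I)) path_packing_yes"
proof -
  have "\<exists>t s. exec solveC (encode_instance I) t s \<and> s ''out'' 0 = of_bool (path_packing_yes I) \<and>
      t \<le> time_bound (cvd (inst_graph I) + card (inst_terminals I)) * max 1 (inst_order I) ^ degree"
    if "I \<in> path_packing_instances" for I
  proof -
    interpret path_instance I by standard (rule that)
    obtain t s where "exec solveC (encode_instance I) t s" "s ''out'' 0 = of_bool (path_packing_yes I)"
      and t: "t \<le> (max 1 n * bnd (9 * (cvd G + card A))) ^ degree"
      using solveC[OF refl] by (auto simp: run_def)
    \<comment> \<open>\<open>Z\<close> is a product, so its power separates the parameter from the
      order of the graph.\<close>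
    moreover from t have "t \<le> time_bound (cvd G + card A) * max 1 n ^ degree"
      by (simp only: time_bound_def power_mult_distrib mult.commute)
    ultimately show ?thesis by blast
  qed
  then show ?thesis unfolding fixed_parameter_tractable_def using computable_time_bound by blast
qed

end
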